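(* Let $f(x)\in\mathbf{Z}[x]$ be a separable nonconstant polynomial, and let $C$ be the hyperelliptic curve $y^2=f(x)$. Suppose that $f(x)$ has odd degree, or that it has even degree and some nonconstant irreducible divisor of $f(x)$ has abelian Galois group over $\mathbf{Q}$. Then there is an effectively computable constant $N$ (depending on $f$) such that the following holds for every prime $p\ge N$: if $m$ is any integer coprime to $p$, then there exist infinitely many squarefree integers $d\equiv m \pmod p$ such that the curve $C_d$ has a nontrivial point over every completion of $\mathbf{Q}$.
   Context: Squarefree integers may be negative and are nonzero. For a squarefree integer $d$, $C_d$ denotes the quadratic twist of $C$ by $d$, i.e. the hyperelliptic curve $dy^2=f(x)$. Points of $C_d$ at infinity and affine points $(x,y)$ with $f(x)=0$ are called trivial; thus, for a field $K\supseteq\mathbf{Q}$, $C_d$ has a nontrivial point over $K$ if and only if there exist $x,y\in K$ with $dy^2=f(x)$ and $f(x)\ne 0$. The completions of $\mathbf{Q}$ are $\mathbf{R}$ and $\mathbf{Q}_\ell$ for all primes $\ell$. The Galois group of an irreducible polynomial is the Galois group over $\mathbf{Q}$ of its splitting field. *)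

theory Defs
  imports
    "HOL-Algebra.QuotRing"
    "HOL-Algebra.Bij"
    "HOL-Algebra.Generated_Fields"
    "HOL-Algebra.Algebraic_Closure_Type"
    "HOL-Computational_Algebra.Computational_Algebra"
    "HOL-Number_Theory.Cong"
    "HOL-Library.Nat_Bijection"
    Complex_Main
begin

text \<open>\<open>quotient_of q\<close> is the reduced fraction representing \<open>q\<close>.\<close>

definition padic_val :: "nat \<Rightarrow> rat \<Rightarrow> int" where
  "padic_val l q =
     int (Factorial_Ring.multiplicity (int l) (fst (quotient_of q))) -
     int (Factorial_Ring.multiplicity (int l) (snd (quotient_of q)))"

definition padic_abs :: "nat \<Rightarrow> rat \<Rightarrow> real" where
  "padic_abs l q = (if q = 0 then 0 else real l powi (- padic_val l q))"

definition padic_Cauchy :: "nat \<Rightarrow> (nat \<Rightarrow> rat) \<Rightarrow> bool" where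
  "padic_Cauchy l s \<longleftrightarrow>
     (\<forall>e>0. \<exists>M. \<forall>m\<ge>M. \<forall>n\<ge>M. padic_abs l (s m - s n) < e)"

definition padic_null_seqs :: "nat \<Rightarrow> (nat \<Rightarrow> rat) set" where
  "padic_null_seqs l = {s. (\<lambda>n. padic_abs l (s n)) \<longlonglongrightarrow> 0}"

definition padic_Cauchy_ring :: "nat \<Rightarrow> (nat \<Rightarrow> rat) ring" where
  "padic_Cauchy_ring l =
     \<lparr>carrier = {s. padic_Cauchy l s},
      monoid.mult = (\<lambda>s t n. s n * t n), one = (\<lambda>n. 1),
      ring.zero = (\<lambda>n. 0), add = (\<lambda>s t n. s n + t n)\<rparr>"

text \<open>For a prime \<open>l\<close>, the completion of the rationals with respect to the \<open>l\<close>-adic absolute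
  value: Cauchy sequences modulo null sequences. The completion at infinity is the type
  \<^typ>\<open>real\<close>, viewed as a HOL-Algebra structure by \<^const>\<open>ring_of_type_algebra\<close>.\<close>

definition padic_field :: "nat \<Rightarrow> (nat \<Rightarrow> rat) set ring" where
  "padic_field l = padic_Cauchy_ring l Quot padic_null_seqs l"

definition eval_int_poly :: "('a, 'b) ring_scheme \<Rightarrow> int poly \<Rightarrow> 'a \<Rightarrow> 'a" where
  "eval_int_poly K f x =
     (\<Oplus>\<^bsub>K\<^esub>i\<in>{..Polynomial.degree f}. add_pow K (Polynomial.coeff f i) (x [^]\<^bsub>K\<^esub> i))"

text \<open>The twist by \<open>d\<close> of the curve \<open>y^2 = f(x)\<close> is \<open>d y^2 = f(x)\<close>; its trivial points are those at
  infinity and those with \<open>f(x) = 0\<close>.\<close>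

definition twist_has_nontrivial_point ::
  "('a, 'b) ring_scheme \<Rightarrow> int poly \<Rightarrow> int \<Rightarrow> bool" where
  "twist_has_nontrivial_point K f d \<longleftrightarrow>
     (\<exists>x\<in>carrier K. \<exists>y\<in>carrier K.
        add_pow K d (y [^]\<^bsub>K\<^esub> (2::nat)) = eval_int_poly K f x \<and>
        eval_int_poly K f x \<noteq> \<zero>\<^bsub>K\<^esub>)"

text \<open>No repeated roots in the algebraically closed field of complex numbers. This is a condition
  over a field: integer constant factors such as the 4 in \<open>4 x\<close> do not matter.\<close>

definition separable_int_poly :: "int poly \<Rightarrow> bool" where
  "separable_int_poly f \<longleftrightarrow> rsquarefree (map_poly complex_of_int f)"

definition splitting_field :: "int poly \<Rightarrow> complex set" where
  "splitting_field g =
     generate_field (ring_of_type_algebra :: complex ring)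
       {z. poly (map_poly complex_of_int g) z = 0}"

definition galois_group :: "int poly \<Rightarrow> (complex \<Rightarrow> complex) monoid" where
  "galois_group g =
     (let L = splitting_field g;
          R = (ring_of_type_algebra :: complex ring)\<lparr>carrier := L\<rparr>
      in BijGroup L
           \<lparr>carrier := {\<sigma> \<in> Bij L. \<sigma> \<in> ring_hom R R \<and> (\<forall>q\<in>\<rat>. \<sigma> q = q)}\<rparr>)"

text \<open>\<open>general_recursive k F\<close>: as a function of \<open>k\<close> arguments, \<open>F\<close> is a total recursive function
  (values of \<open>F\<close> on lists of length other than \<open>k\<close> are irrelevant). Minimisation is applied only
  to functions that always have a zero.\<close>

inductive general_recursive :: "nat \<Rightarrow> (nat list \<Rightarrow> nat) \<Rightarrow> bool" where
  zero: "general_recursive k (\<lambda>xs. 0)"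
| succ: "general_recursive 1 (\<lambda>xs. Suc (xs ! 0))"
| proj: "i < k \<Longrightarrow> general_recursive k (\<lambda>xs. xs ! i)"
| comp: "general_recursive (length Gs) F \<Longrightarrow> (\<forall>G\<in>set Gs. general_recursive k G) \<Longrightarrow>
    general_recursive k (\<lambda>xs. F (map (\<lambda>G. G xs) Gs))"
| prim_rec: "general_recursive k F \<Longrightarrow> general_recursive (Suc (Suc k)) G \<Longrightarrow>
    general_recursive (Suc k)
      (\<lambda>xs. rec_nat (F (tl xs)) (\<lambda>n r. G (n # r # tl xs)) (hd xs))"
| minimise: "general_recursive (Suc k) F \<Longrightarrow>
    (\<forall>xs. length xs = k \<longrightarrow> (\<exists>n. F (n # xs) = 0)) \<Longrightarrow>
    general_recursive k (\<lambda>xs. LEAST n. F (n # xs) = 0)"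

definition int_poly_encode :: "int poly \<Rightarrow> nat" where
  "int_poly_encode f = list_encode (map int_encode (coeffs f))"

definition effectively_computable :: "(int poly \<Rightarrow> nat) \<Rightarrow> bool" where
  "effectively_computable N \<longleftrightarrow>
     (\<exists>F. general_recursive 1 F \<and> (\<forall>f. N f = F [int_poly_encode f]))"

end

theory Submission
  imports Defs "HOL-Number_Theory.Number_Theory" "Jordan_Normal_Form.Determinant"
begin

text \<open>
  Take \<open>d = s D\<close>, where \<open>s\<close> is the squarefree part of a value \<open>f x0\<close> and \<open>D > 0\<close> is a product of
  distinct primes modulo which \<open>f\<close> has a root, with \<open>D\<close> congruent to 1 modulo four times every
  small prime. At the real place and at the small primes \<open>d\<close> is a square times \<open>f x0\<close>; at a large
  prime dividing \<open>d\<close> the polynomial \<open>f\<close> has a simple root, so by Hensel's lemma it takes every value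
  divisible by that prime; at any other large prime \<open>f\<close> takes both residue and non-residue values.

  The classes modulo \<open>p\<close> reached by such \<open>D\<close> form a group that contains all quotients of values of
  \<open>f\<close>, because the primes dividing a value of \<open>f\<close> are primes modulo which \<open>f\<close> has a root. Hence a
  proper subgroup would force a power \<open>f ^ e\<close>, with \<open>e\<close> a proper divisor of \<open>p - 1\<close>, to be constant
  modulo \<open>p\<close> away from the roots of \<open>f\<close>. That is impossible for \<open>p\<close> large in terms of the degree of
  \<open>f\<close>, which also settles the residue and non-residue values used above.
\<close>

section \<open>Congruences in polynomial rings and power residues\<close>

text \<open>Density theorems for the primes modulo which \<open>f\<close> has a root are replaced by
  pigeonhole. Among those prime to \<open>M = Q p\<close>, all but finitely many lie in a class
  modulo \<open>M\<close> that contains infinitely many of them, so that class is also met by such a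
  prime outside any given finite set. The finitely many exceptions are kept out of a quotient
  \<open>f a / f x0\<close> by making \<open>a\<close> congruent to \<open>x0\<close> modulo their
  product times \<open>f x0\<close>. Pigeonhole gives no bound on the exceptions, but they influence
  only \<open>d\<close>: the threshold for \<open>p\<close> comes from the degree, the leading
  coefficient and a constant \<open>R\<close> with \<open>u f + v f' = R\<close>, all bounded by the
  code of \<open>f\<close>.

  The obstacle is a subgroup of small index: then \<open>f ^ e\<close> can have degree above
  \<open>p\<close>, and counting roots does not prevent it from being constant modulo
  \<open>p\<close> off the roots of \<open>f\<close>. Congruences modulo powers of
  \<open>x^p - x\<close> carry more information. Since \<open>f\<close> is not invertible there,
  statements are multiplied by powers of \<open>f\<close>, and the work lies in keeping degrees in
  \<open>x\<close> small against \<open>p\<close>.\<close>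

definition ideq :: "'a::comm_ring_1 \<Rightarrow> 'a \<Rightarrow> 'a \<Rightarrow> 'a \<Rightarrow> bool" where
  "ideq a b x y \<longleftrightarrow> (\<exists>u v. x - y = a * u + b * v)"

lemma ideqI: "x - y = a * u + b * v \<Longrightarrow> ideq a b x y"
  unfolding ideq_def by blast

lemma ideq_refl [simp]: "ideq a b x x"
  by (rule ideqI[where u = 0 and v = 0]) simp

lemma ideq_sym: "ideq a b x y \<Longrightarrow> ideq a b y x"
proof -
  assume "ideq a b x y"
  then obtain u v where "x - y = a * u + b * v" unfolding ideq_def by blast
  then have "y - x = a * (- u) + b * (- v)" by (simp add: algebra_simps)
  then show ?thesis by (rule ideqI)
qed

lemma ideq_add: "ideq a b x y \<Longrightarrow> ideq a b z w \<Longrightarrow> ideq a b (x + z) (y + w)"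
proof -
  assume "ideq a b x y" "ideq a b z w"
  then obtain u v u' v' where "x - y = a * u + b * v" "z - w = a * u' + b * v'"
    unfolding ideq_def by blast
  then have "(x + z) - (y + w) = a * (u + u') + b * (v + v')"
    by (simp add: algebra_simps)
  then show ?thesis by (rule ideqI)
qed

lemma ideq_mult_right: "ideq a b x y \<Longrightarrow> ideq a b (x * z) (y * z)"
proof -
  assume "ideq a b x y"
  then obtain u v where "x - y = a * u + b * v" unfolding ideq_def by blast
  then have "x * z - y * z = a * (u * z) + b * (v * z)"
    by (metis (no_types) left_diff_distrib distrib_right mult.assoc)
  then show ?thesis by (rule ideqI)
qed

lemma ideq_trans [trans]: "ideq a b x y \<Longrightarrow> ideq a b y z \<Longrightarrow> ideq a b x z"
  using ideq_add[of a b x y y z] ideq_add[of a b "x + y" "y + z" "- y" "- y"] by simp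

lemma ideq_mult: "ideq a b x y \<Longrightarrow> ideq a b z w \<Longrightarrow> ideq a b (x * z) (y * w)"
  using ideq_mult_right[of a b x y z] ideq_mult_right[of a b z w y]
  by (metis ideq_trans mult.commute)

lemma ideq_mult_left: "ideq a b x y \<Longrightarrow> ideq a b (z * x) (z * y)"
  by (simp add: ideq_mult)

lemma ideq_power: "ideq a b x y \<Longrightarrow> ideq a b (x ^ n) (y ^ n)"
  by (induction n) (auto intro: ideq_mult)

lemma ideq_sum: "(\<And>i. i \<in> I \<Longrightarrow> ideq a b (x i) (y i)) \<Longrightarrow> ideq a b (sum x I) (sum y I)"
  by (induction I rule: infinite_finite_induct) (auto intro: ideq_add)

lemma ideq_diff_0: "ideq a b (x - y) 0 \<longleftrightarrow> ideq a b x y"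
  by (simp add: ideq_def)

lemma ideq_dvd: "b dvd x - y \<Longrightarrow> ideq a b x y"
  unfolding dvd_def by (metis ideqI add_0 mult_zero_right)

lemma ideq_dvd': "a dvd x - y \<Longrightarrow> ideq a b x y"
  unfolding dvd_def by (metis ideqI add.right_neutral mult_zero_right)

section \<open>Reduction modulo a monic polynomial and a constant\<close>

lemma monic_division:
  fixes D P :: "'a::idom poly"
  assumes "lead_coeff D = 1"
  obtains Q R where "P = D * Q + R" "R = 0 \<or> degree R < degree D"
proof -
  obtain q r where qr: "pseudo_divmod P D = (q, r)" by force
  have "D \<noteq> 0" using assms by auto
  from pseudo_divmod[OF this qr] assms show ?thesis
    by (intro that[of q r]) auto
qed

text \<open>Residues modulo a monic \<open>D\<close> are unique: once the cofactor of
  \<open>c\<close> is reduced modulo \<open>D\<close>, what is left of the multiple of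
  \<open>D\<close> has degree below that of \<open>D\<close> and must vanish.\<close>

lemma dvd_of_degree_less:
  fixes D P :: "'a::idom poly"
  assumes monic: "lead_coeff D = 1" and cong: "ideq D [:c:] P 0"
    and deg: "degree P < degree D"
  shows "[:c:] dvd P"
proof -
  obtain A B where AB: "P = D * A + [:c:] * B"
    using cong unfolding ideq_def by auto
  obtain Q R where QR: "B = D * Q + R" "R = 0 \<or> degree R < degree D"
    using monic_division[OF monic] by blast
  have eq: "P - [:c:] * R = D * (A + [:c:] * Q)"
    unfolding AB QR(1) by (simp add: algebra_simps)
  have "degree ([:c:] * R) < degree D"
    using QR(2) deg by (auto intro: le_less_trans[OF degree_smult_le])
  then have "degree (P - [:c:] * R) < degree D"
    using deg by (intro degree_diff_less)
  then have "A + [:c:] * Q = 0"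
    unfolding eq using monic degree_mult_right_le[of "A + [:c:] * Q" D]
    by (cases "A + [:c:] * Q = 0") (auto simp: mult.commute)
  with eq have "P = [:c:] * R" by simp
  then show ?thesis by (rule dvdI)
qed

lemma not_const_dvd:
  fixes P :: "'a::idom poly"
  assumes "\<not> c dvd coeff P i" shows "\<not> [:c:] dvd P"
  using assms by (auto simp: const_poly_dvd_iff)

text \<open>Uniqueness of \<open>D\<close>-adic digits modulo the prime \<open>c\<close>: the lowest
  digit is the residue modulo \<open>D\<close>, and a monic \<open>D\<close> can be cancelled modulo
  \<open>c\<close>.\<close>

lemma dvd_coeffs_of_dvd_poly:
  fixes D :: "'a::idom poly" and Y :: "'a poly poly"
  assumes "lead_coeff D = 1" "prime_elem c"
    and "\<And>i. degree (coeff Y i) < degree D" and "[:c:] dvd poly Y D"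
  shows "[:c:] dvd coeff Y i"
  using assms(3,4)
proof (induction Y arbitrary: i)
  case 0
  then show ?case by simp
next
  case (pCons a Y)
  have pe: "prime_elem [:c:]" using assms(2) by (rule lift_prime_elem_poly)
  have d: "[:c:] dvd a + D * poly Y D" using pCons.prems(2) by simp
  have a: "[:c:] dvd a"
  proof (rule dvd_of_degree_less[OF assms(1)])
    from d obtain z where "a + D * poly Y D = [:c:] * z" by (auto simp: dvd_def)
    then have "a - 0 = D * (- poly Y D) + [:c:] * z" by (simp add: algebra_simps)
    then show "ideq D [:c:] a 0" by (rule ideqI)
    show "degree a < degree D" using pCons.prems(1)[of 0] by simp
  qed
  then have "[:c:] dvd D * poly Y D" using d by (simp add: dvd_add_right_iff)
  moreover have "\<not> [:c:] dvd D"
    using not_const_dvd[of c D "degree D"] assms(1,2) by (metis prime_elem_not_unit)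
  ultimately have "[:c:] dvd poly Y D" using pe by (simp add: prime_elem_dvd_mult_iff)
  moreover have "\<And>i. degree (coeff Y i) < degree D"
    using pCons.prems(1)[of "Suc j" for j] by simp
  ultimately have "\<And>i. [:c:] dvd coeff Y i" using pCons.IH by blast
  with a show ?case by (cases i) auto
qed

section \<open>Frobenius, and polynomials vanishing at all residues modulo p\<close>

lemma freshman:
  fixes x y :: "'a::comm_ring_1"
  assumes "prime p"
  shows "\<exists>z. (x + y) ^ p = x ^ p + y ^ p + of_nat p * z"
proof -
  have p: "p \<ge> 2" using assms prime_ge_2_nat by blast
  have d: "\<exists>w. of_nat (p choose i) * x ^ i * y ^ (p - i) = of_nat p * w"
    if "i \<in> {1..<p}" for i
  proof -
    have "p dvd (p choose i)" using assms that by (intro dvd_choose_prime) auto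
    then show ?thesis by (auto simp: dvd_def mult.assoc)
  qed
  then obtain w where w: "\<And>i. i \<in> {1..<p} \<Longrightarrow> of_nat (p choose i) * x ^ i * y ^ (p - i) = of_nat p * w i"
    by metis
  have "{..p} = insert 0 (insert p {1..<p})" using p by auto
  then have "(x + y) ^ p = y ^ p + (x ^ p + (\<Sum>i\<in>{1..<p}. of_nat (p choose i) * x ^ i * y ^ (p - i)))"
    unfolding binomial_ring using p by simp
  also have "\<dots> = x ^ p + y ^ p + of_nat p * (\<Sum>i\<in>{1..<p}. w i)"
    using w by (simp add: sum_distrib_left)
  finally show ?thesis by blast
qed

lemma fermat_int:
  assumes "prime (p::nat)" shows "int p dvd a ^ p - a"
proof (cases "int p dvd a")
  case True
  then show ?thesis using prime_gt_0_nat[OF assms]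
    by (intro dvd_diff) (auto intro: dvd_trans[OF _ dvd_power])
next
  case False
  have "coprime a (int p)"
    using False assms prime_imp_coprime[of "int p" a] by (simp add: coprime_commute)
  then have "[a ^ (p - 1) = 1] (mod int p)"
    using residues.euler_theorem[of "int p" a] assms prime_gt_1_nat[OF assms]
    by (simp add: residues_def totient_prime)
  then have "[a ^ (p - 1) * a = 1 * a] (mod int p)" by (rule cong_mult) simp
  then show ?thesis using prime_gt_0_nat[OF assms]
    by (simp only: cong_iff_dvd_diff power_minus_mult mult_1_left)
qed

lemma poly_frobenius:
  assumes "prime p"
  shows "[:int p:] dvd pcompose f (monom 1 p) - f ^ p"
proof (induction f)
  case 0
  then show ?case using prime_gt_0_nat[OF assms] by (simp add: power_0_left)
next
  case (pCons a f)
  have m: "monom 1 p = ([:0, 1:] :: int poly) ^ p" by (simp add: monom_altdef)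
  obtain z where z: "([:a:] + [:0, 1:] * f) ^ p = [:a:] ^ p + ([:0, 1:] * f) ^ p + of_nat p * z"
    using freshman[OF assms] by blast
  have e: "pCons a f = [:a:] + [:0, 1:] * f" by simp
  have c: "pcompose (pCons a f) (monom 1 p) = [:a:] + [:0,1:] ^ p * pcompose f (monom 1 p)"
    unfolding pcompose_pCons m by simp
  have np: "of_nat p = [:int p:]" by (simp add: of_nat_poly)
  have "pcompose (pCons a f) (monom 1 p) - (pCons a f) ^ p =
     - [:a ^ p - a:] + [:0, 1:] ^ p * (pcompose f (monom 1 p) - f ^ p) - [:int p:] * z"
    unfolding c unfolding e z power_mult_distrib np poly_const_pow by (simp add: algebra_simps)
  also have "[:int p:] dvd \<dots>"
    using fermat_int[OF assms, of a]
    by (intro dvd_diff[OF dvd_add[OF _ dvd_mult[OF pCons.IH]] dvd_triv_left] dvd_minus_iff[THEN iffD2])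
      auto
  finally show ?case .
qed

text \<open>Lagrange's bound on the number of roots over the field of residues modulo
  \<open>q\<close>, expressed in integers. Since \<open>P\<close> vanishes at \<open>a\<close> only
  modulo \<open>q\<close>, the remainder of the division by \<open>x - a\<close> is carried along as
  a constant divisible by \<open>q\<close>.\<close>

lemma const_dvd_of_roots:
  fixes P :: "int poly"
  assumes "prime q" "finite A" "degree P < card A"
    and "\<And>a b. a \<in> A \<Longrightarrow> b \<in> A \<Longrightarrow> q dvd a - b \<Longrightarrow> a = b"
    and "\<And>a. a \<in> A \<Longrightarrow> q dvd poly P a"
  shows "[:q:] dvd P"
  using assms(2-5)
proof (induction "card A" arbitrary: A P)
  case 0
  then show ?case by simp
next
  case (Suc n)
  then obtain a where a: "a \<in> A" by fastforce
  define Q where "Q = synthetic_div P a"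
  have PQ: "P = [:- a, 1:] * Q + [:poly P a:]"
    unfolding Q_def using synthetic_div_correct'[of a P] by simp
  have Pa: "[:q:] dvd [:poly P a:]" using Suc.prems(4)[OF a] by simp
  show ?case
  proof (cases "degree P = 0")
    case True
    then have "P = [:poly P a:]" by (metis degree_eq_zeroE mult_zero_right poly_pCons add.right_neutral poly_0)
    with Pa show ?thesis by simp
  next
    case False
    have "[:q:] dvd Q"
    proof (rule Suc.hyps(1)[of "A - {a}"])
      show "n = card (A - {a})" using Suc.hyps(2) Suc.prems(1) a by simp
      show "finite (A - {a})" using Suc.prems by simp
      show "degree Q < card (A - {a})"
        using Suc.prems(1,2) a False by (simp add: Q_def degree_synthetic_div)
      show "\<And>x y. x \<in> A - {a} \<Longrightarrow> y \<in> A - {a} \<Longrightarrow> q dvd x - y \<Longrightarrow> x = y"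
        using Suc.prems(3) by blast
      show "q dvd poly Q b" if b: "b \<in> A - {a}" for b
      proof -
        have "poly P b = (b - a) * poly Q b + poly P a" by (subst PQ) (simp add: algebra_simps)
        then have "q dvd (b - a) * poly Q b"
          using Suc.prems(4)[OF a] Suc.prems(4)[of b] b by (metis DiffD1 add_diff_cancel_right' dvd_diff)
        moreover have "\<not> q dvd b - a" using Suc.prems(3)[of b a] a b by blast
        ultimately show ?thesis using assms(1) by (simp add: prime_dvd_mult_iff)
      qed
    qed
    then show ?thesis using Pa by (subst PQ) (intro dvd_add dvd_mult)
  qed
qed

lemma const_dvd_of_vanishing:
  fixes P :: "int poly"
  assumes "prime (p::nat)" "degree P < p" "\<And>a. int p dvd poly P a"
  shows "[:int p:] dvd P"
proof (rule const_dvd_of_roots[of _ "int ` {..<p}"])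
  show "prime (int p)" using assms(1) by simp
  show "degree P < card (int ` {..<p})" using assms(2) by (simp add: card_image)
  show "a = b" if ab: "a \<in> int ` {..<p}" "b \<in> int ` {..<p}" "int p dvd a - b" for a b
  proof -
    have "\<bar>a - b\<bar> < int p" using ab by auto
    then show ?thesis using dvd_imp_le_int[of "a - b" "int p"] ab(3) by auto
  qed
qed (use assms in auto)

definition artin_schreier :: "nat \<Rightarrow> int poly" where
  "artin_schreier p = monom 1 p - [:0, 1:]"

lemma artin_schreier_monic:
  assumes "p \<ge> 2" shows "degree (artin_schreier p) = p" "lead_coeff (artin_schreier p) = 1"
proof -
  have "degree [:0, 1::int:] < degree (monom (1::int) p)" using assms by (simp add: degree_monom_eq)
  then show d: "degree (artin_schreier p) = p"
    unfolding artin_schreier_def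
    by (metis degree_add_eq_left degree_minus diff_conv_add_uminus degree_monom_eq zero_neq_one)
  show "lead_coeff (artin_schreier p) = 1"
    unfolding d using assms by (simp add: artin_schreier_def coeff_pCons split: nat.split)
qed

text \<open>By Fermat \<open>x^p - x\<close> vanishes at every integer modulo \<open>p\<close>, so
  the remainder of \<open>P\<close> modulo it still vanishes everywhere modulo \<open>p\<close>. Its
  degree is below \<open>p\<close>, hence all its coefficients are divisible by
  \<open>p\<close>.\<close>

lemma ideq_artin_schreier_of_vanishing:
  fixes P :: "int poly"
  assumes "prime p" "\<And>a. int p dvd poly P a"
  shows "ideq (artin_schreier p) [:int p:] P 0"
proof -
  have p: "p \<ge> 2" using assms(1) prime_ge_2_nat by blast
  note m = artin_schreier_monic[OF p]
  obtain Q R where QR: "P = artin_schreier p * Q + R" "R = 0 \<or> degree R < degree (artin_schreier p)"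
    using monic_division[OF m(2)] by blast
  have "int p dvd poly R a" for a
  proof -
    have "poly R a = poly P a - poly (artin_schreier p) a * poly Q a" unfolding QR(1) by simp
    moreover have "int p dvd poly (artin_schreier p) a"
      using fermat_int[OF assms(1)] by (simp add: artin_schreier_def poly_monom)
    ultimately show ?thesis using assms(2) by (metis dvd_diff dvd_mult2)
  qed
  then have "[:int p:] dvd R"
    using QR(2) p m(1) by (intro const_dvd_of_vanishing[OF assms(1)]) auto
  then obtain z where "R = [:int p:] * z" by (auto simp: dvd_def)
  then have "P - 0 = artin_schreier p * Q + [:int p:] * z" using QR(1) by simp
  then show ?thesis by (rule ideqI)
qed

text \<open>The polynomial \<open>f (x + T)\<close> with \<open>T\<close> as outer variable and
  \<open>x\<close> inside the coefficients: \<open>poly\<close> then substitutes for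
  \<open>T\<close>, and \<open>pderiv\<close> differentiates with respect to
  \<open>T\<close>.\<close>

definition taylor_shift :: "int poly \<Rightarrow> int poly poly" where
  "taylor_shift f = pcompose (map_poly (\<lambda>a. [:a:]) f) [:[:0, 1:], 1:]"

lemma taylor_shift_0 [simp]: "taylor_shift 0 = 0"
  by (simp add: taylor_shift_def)

lemma taylor_shift_pCons:
  "taylor_shift (pCons a f) = [:[:a:]:] + [:[:0, 1:], 1:] * taylor_shift f"
  by (simp add: taylor_shift_def map_poly_pCons pcompose_pCons)

lemma taylor_shift_const [simp]: "taylor_shift [:a:] = [:[:a:]:]"
  by (simp add: taylor_shift_pCons)

lemma taylor_shift_add: "taylor_shift (f + g) = taylor_shift f + taylor_shift g"
proof (induction f arbitrary: g)
  case (pCons a f)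
  obtain b g' where g: "g = pCons b g'" by (cases g)
  have "[:[:a + b:]:] = [:[:a:]:] + [:[:b:]:]" by simp
  then have "taylor_shift (pCons a f + g) =
      [:[:a:]:] + [:[:b:]:] + [:[:0, 1:], 1:] * (taylor_shift f + taylor_shift g')"
    unfolding g add_pCons taylor_shift_pCons pCons.IH by (simp only:)
  then show ?case unfolding g taylor_shift_pCons by (simp only: distrib_left add_ac)
qed simp

lemma taylor_shift_smult: "taylor_shift (smult c f) = [:[:c:]:] * taylor_shift f"
  by (induction f) (simp_all add: taylor_shift_pCons algebra_simps)

lemma taylor_shift_mult: "taylor_shift (f * g) = taylor_shift f * taylor_shift g"
proof (induction f)
  case (pCons a f)
  have "taylor_shift (pCons a f * g) = taylor_shift (smult a g) + taylor_shift (pCons 0 (f * g))"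
    by (simp add: taylor_shift_add)
  also have "\<dots> = taylor_shift (pCons a f) * taylor_shift g"
    unfolding taylor_shift_pCons taylor_shift_smult pCons.IH by (simp add: algebra_simps)
  finally show ?case .
qed simp

lemma pderiv_taylor_shift: "pderiv (taylor_shift f) = taylor_shift (pderiv f)"
proof (induction f)
  case (pCons a f)
  have "pderiv [:[:0, 1::int:], 1:] = 1" by (simp add: pderiv_pCons one_pCons)
  then have "pderiv (taylor_shift (pCons a f)) =
      taylor_shift f + [:[:0, 1:], 1:] * pderiv (taylor_shift f)"
    unfolding taylor_shift_pCons pderiv_add pderiv_mult by (simp add: pderiv_pCons)
  then show ?case
    unfolding pCons.IH pderiv_pCons taylor_shift_add taylor_shift_pCons by simp
qed simp

lemma poly_taylor_shift: "poly (taylor_shift f) D = pcompose f ([:0, 1:] + D)"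
  by (induction f) (simp_all add: taylor_shift_pCons pcompose_pCons algebra_simps)

lemma coeff_0_taylor_shift: "coeff (taylor_shift f) 0 = f"
  by (simp add: poly_0_coeff_0[symmetric] poly_taylor_shift)

lemma degree_taylor_shift: "degree (taylor_shift f) = degree f"
  by (simp add: taylor_shift_def degree_pcompose degree_map_poly)

lemma lead_coeff_taylor_shift: "coeff (taylor_shift f) (degree f) = [:lead_coeff f:]"
proof -
  have "lead_coeff (taylor_shift f) = [:lead_coeff f:]"
    unfolding taylor_shift_def
    by (subst lead_coeff_comp) (simp_all add: degree_map_poly coeff_map_poly)
  then show ?thesis by (simp only: degree_taylor_shift)
qed

text \<open>Controls the degree in \<open>x\<close>. Coefficients of degree below \<open>p\<close>
  are the digits of an expansion in powers of \<open>T = x^p - x\<close>, and only for them can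
  divisibility by \<open>p\<close> be read off coefficientwise.\<close>

definition coeff_degrees_le :: "'a::comm_ring_1 poly poly \<Rightarrow> nat \<Rightarrow> bool" where
  "coeff_degrees_le P D \<longleftrightarrow> (\<forall>i. degree (coeff P i) \<le> D)"

lemma coeff_degrees_le_mono: "coeff_degrees_le P D \<Longrightarrow> D \<le> D' \<Longrightarrow> coeff_degrees_le P D'"
  unfolding coeff_degrees_le_def using le_trans by blast

lemma coeff_degrees_le_add:
  "coeff_degrees_le P D \<Longrightarrow> coeff_degrees_le Q D \<Longrightarrow> coeff_degrees_le (P + Q) D"
  unfolding coeff_degrees_le_def by (simp add: degree_add_le)

lemma coeff_degrees_le_diff:
  "coeff_degrees_le P D \<Longrightarrow> coeff_degrees_le Q D \<Longrightarrow> coeff_degrees_le (P - Q) D"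
  unfolding coeff_degrees_le_def by (simp add: degree_diff_le)

lemma coeff_degrees_le_mult:
  assumes "coeff_degrees_le P D" "coeff_degrees_le Q D'"
  shows "coeff_degrees_le (P * Q) (D + D')"
  unfolding coeff_degrees_le_def coeff_mult
proof (intro allI degree_sum_le)
  fix i j
  show "degree (coeff P j * coeff Q (i - j)) \<le> D + D'"
    using assms degree_mult_le[of "coeff P j" "coeff Q (i - j)"]
    unfolding coeff_degrees_le_def by (meson add_mono le_trans)
qed simp

lemma coeff_degrees_le_const: "degree a \<le> D \<Longrightarrow> coeff_degrees_le [:a:] D"
  unfolding coeff_degrees_le_def by (simp add: coeff_pCons split: nat.split)

lemma coeff_degrees_le_power:
  "coeff_degrees_le P D \<Longrightarrow> coeff_degrees_le (P ^ k) (k * D)"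
proof (induction k)
  case 0
  then show ?case using coeff_degrees_le_const[of 1 0] by (simp add: one_pCons)
next
  case (Suc k)
  then show ?case using coeff_degrees_le_mult[of P D "P ^ k" "k * D"] by simp
qed

lemma coeff_degrees_le_taylor_shift: "coeff_degrees_le (taylor_shift f) (degree f)"
proof (induction f)
  case 0
  then show ?case by (simp add: coeff_degrees_le_def)
next
  case (pCons a f)
  show ?case
  proof (cases "f = 0")
    case True
    then show ?thesis by (auto intro: coeff_degrees_le_const)
  next
    case False
    have "coeff_degrees_le [:[:0, 1::int:], 1:] 1"
      by (auto simp: coeff_degrees_le_def coeff_pCons split: nat.split)
    from coeff_degrees_le_mult[OF this pCons.IH] show ?thesis
      unfolding taylor_shift_pCons using False
      by (intro coeff_degrees_le_add) (auto intro: coeff_degrees_le_const)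
  qed
qed

section \<open>Existence and uniqueness of approximate k-th roots\<close>

lemma power_add_square:
  fixes u t :: "'a::comm_ring_1"
  shows "\<exists>z. (u + t) ^ k = u ^ k + of_nat k * u ^ (k - 1) * t + t ^ 2 * z"
proof (induction k)
  case 0
  then show ?case by (intro exI[of _ 0]) simp
next
  case (Suc k)
  then obtain z where z: "(u + t) ^ k = u ^ k + of_nat k * u ^ (k - 1) * t + t ^ 2 * z" by blast
  have "of_nat k * u ^ (k - 1) * u = of_nat k * u ^ k"
    by (cases k) (simp_all add: mult_ac)
  then have "(u + t) ^ Suc k = u ^ Suc k + of_nat (Suc k) * u ^ (Suc k - 1) * t +
      t ^ 2 * (of_nat k * u ^ (k - 1) + u * z + t * z)"
    unfolding power_Suc2[of "u + t"] z by (simp add: algebra_simps power2_eq_square)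
  then show ?case by blast
qed

text \<open>Hensel lifting in the variable \<open>T\<close> of the \<open>k\<close>-th root of \<open>f (x + T) / f x\<close>; the powers of \<open>f\<close>
  clear the denominators, and the degrees in \<open>x\<close> stay bounded independently of \<open>p\<close>.\<close>

lemma approximate_root:
  fixes f :: "int poly" and p \<kappa> :: int and k M :: nat
  assumes \<kappa>: "p dvd 1 - int k * \<kappa>" and k: "k \<ge> 1" and M: "M \<ge> 1"
  shows "\<exists>V L. L \<le> (k + 1) ^ M \<and> degree V < M \<and> coeff_degrees_le V (degree f * L) \<and>
    coeff V 0 = f ^ L \<and>
    (\<forall>i<M. [:p:] dvd coeff ([:f:] * V ^ k - [:f ^ (L * k):] * taylor_shift f) i)"
  using M
proof (induction M rule: dec_induct)
  case base
  show ?case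
    by (intro exI[of _ 1] exI[of _ 0])
       (auto simp: coeff_degrees_le_def coeff_0_taylor_shift)
next
  case (step M)
  define n where "n = degree f"
  obtain V L where L: "L \<le> (k + 1) ^ M" and V: "degree V < M" "coeff_degrees_le V (n * L)"
    "coeff V 0 = f ^ L" and
    E: "\<forall>i<M. [:p:] dvd coeff ([:f:] * V ^ k - [:f ^ (L * k):] * taylor_shift f) i"
    using step.IH unfolding n_def by blast
  define E where "E = [:f:] * V ^ k - [:f ^ (L * k):] * taylor_shift f"
  \<comment> \<open>The exponent solves \<open>s k = 1 + (L + s) (k - 1)\<close>. After scaling by
    \<open>f ^ s\<close>, the old defect \<open>f ^ (s k) \<eta>\<close> and the linear term
    \<open>k f ^ (s k) y\<close> of the correction carry the same power of \<open>f\<close>, so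
    \<open>y = - \<kappa> \<eta>\<close> cancels the defect modulo \<open>p\<close>. The new
    exponent \<open>1 + L k\<close> explains the bound \<open>(k + 1) ^ M\<close>.\<close>
  define s where "s = 1 + L * (k - 1)"
  define \<eta> where "\<eta> = coeff E M"
  define y where "y = - smult \<kappa> \<eta>"
  define U where "U = [:f ^ s:] * V"
  define V' where "V' = U + monom y M"
  define L' where "L' = L + s"
  have L'_eq: "L' = 1 + L * k"
    using k unfolding L'_def s_def by (cases k) auto
  have L': "L' \<le> (k + 1) ^ Suc M"
  proof -
    have "L * k \<le> k * (k + 1) ^ M" using L by simp
    moreover have "1 \<le> (k + 1) ^ M" by simp
    ultimately show ?thesis unfolding L'_eq power_Suc by (simp only: add_mult_distrib mult_1 mult.commute)
  qed
  have dpow: "degree (f ^ j) \<le> n * j" for j unfolding n_def by (rule degree_power_le)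
  have cE: "coeff_degrees_le E (n * L')"
  proof -
    have "coeff_degrees_le ([:f:] * V ^ k) (n + k * (n * L))"
      by (intro coeff_degrees_le_mult coeff_degrees_le_power V coeff_degrees_le_const) (simp add: n_def)
    moreover have "coeff_degrees_le ([:f ^ (L * k):] * taylor_shift f) (n * (L * k) + n)"
      using coeff_degrees_le_taylor_shift[of f]
      by (intro coeff_degrees_le_mult coeff_degrees_le_const dpow) (simp add: n_def)
    ultimately show ?thesis unfolding E_def L'_eq
      by (intro coeff_degrees_le_diff) (auto simp: algebra_simps elim!: coeff_degrees_le_mono)
  qed
  have cU: "coeff_degrees_le U (n * L')"
    using coeff_degrees_le_mult[OF coeff_degrees_le_const[OF dpow[of s]] V(2)]
    unfolding U_def L'_def by (simp add: algebra_simps)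
  have dy: "degree y \<le> n * L'"
    using cE degree_smult_le[of \<kappa> \<eta>] unfolding y_def \<eta>_def coeff_degrees_le_def
    by (metis degree_minus le_trans)
  have "coeff_degrees_le V' (n * L')"
    unfolding V'_def using cU dy
    by (intro coeff_degrees_le_add) (auto simp: coeff_degrees_le_def)
  moreover have "degree V' < Suc M"
  proof -
    have "degree U \<le> M" using V(1) degree_mult_le[of "[:f ^ s:]" V] unfolding U_def by simp
    then show ?thesis unfolding V'_def using degree_monom_le[of y M] by (simp add: degree_add_le less_Suc_eq_le)
  qed
  moreover have U0: "coeff U 0 = f ^ L'"
    using V(3) unfolding U_def L'_def by (simp add: power_add)
  then have "coeff V' 0 = f ^ L'"
    unfolding V'_def using step.hyps by simp
  moreover have "[:p:] dvd coeff ([:f:] * V' ^ k - [:f ^ (L' * k):] * taylor_shift f) i" if i: "i < Suc M" for i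
  proof -
    obtain z where z: "V' ^ k = U ^ k + of_nat k * U ^ (k - 1) * monom y M + monom y M ^ 2 * z"
      unfolding V'_def using power_add_square by blast
    have "U ^ k = [:f ^ (s * k):] * V ^ k"
      unfolding U_def power_mult_distrib by (simp add: poly_const_pow power_mult)
    moreover have "[:f ^ (L' * k):] = [:f ^ (s * k):] * [:f ^ (L * k):]"
      unfolding L'_def by (simp add: power_add algebra_simps)
    ultimately have expand: "[:f:] * V' ^ k - [:f ^ (L' * k):] * taylor_shift f =
        [:f ^ (s * k):] * E + monom y M * ([:of_nat k * f:] * U ^ (k - 1)) + monom y M ^ 2 * ([:f:] * z)"
      unfolding z E_def by (simp add: algebra_simps of_nat_poly)
    \<comment> \<open>The quadratic term starts at \<open>T ^ (2 M)\<close>, which lies beyond the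
      index \<open>M\<close> because \<open>M \<ge> 1\<close>.\<close>
    have sq: "coeff (monom y M ^ 2 * ([:f:] * z)) i = 0"
    proof -
      have "monom y M ^ 2 * ([:f:] * z) = monom (y * y) (M + M) * ([:f:] * z)"
        by (simp add: power2_eq_square mult_monom)
      then show ?thesis using i step.hyps by (simp add: coeff_monom_mult)
    qed
    show ?thesis
    proof (cases "i = M")
      case False
      then have "coeff (monom y M * ([:of_nat k * f:] * U ^ (k - 1))) i = 0"
        using i by (simp add: coeff_monom_mult)
      moreover have "[:p:] dvd coeff ([:f ^ (s * k):] * E) i"
        using E[folded E_def] False i by (simp del: const_poly_dvd_iff)
      ultimately show ?thesis unfolding expand coeff_add sq by (simp only: add_0_right)
    next
      case True
      have "coeff (U ^ (k - 1)) 0 = f ^ (L' * (k - 1))"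
        using U0 by (metis poly_0_coeff_0 poly_power power_mult)
      moreover have "s * k = Suc (L' * (k - 1))"
        using k unfolding L'_eq s_def by (cases k) (auto simp: algebra_simps)
      ultimately have "coeff ([:f:] * V' ^ k - [:f ^ (L' * k):] * taylor_shift f) i =
          f ^ (s * k) * \<eta> + y * (of_nat k * f ^ (s * k))"
        unfolding expand coeff_add sq using True by (simp add: coeff_monom_mult \<eta>_def mult.assoc)
      also have "\<dots> = [:1 - int k * \<kappa>:] * (f ^ (s * k) * \<eta>)"
        unfolding y_def by (simp add: of_nat_poly algebra_simps smult_diff_left)
      also have "[:p:] dvd \<dots>" using \<kappa> by (intro dvd_mult2) simp
      finally show ?thesis .
    qed
  qed
  ultimately show ?case using L' unfolding n_def by blast
qed

lemma ideq_poly_of_coeffs: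
  fixes E :: "'a::comm_ring_1 poly"
  assumes "\<And>i. i < M \<Longrightarrow> c dvd coeff E i"
  shows "ideq (D ^ M) c (poly E D) 0"
  using assms
proof (induction M arbitrary: E)
  case 0
  show ?case by (rule ideqI[where u = "poly E D" and v = 0]) simp
next
  case (Suc M)
  obtain a F where E: "E = pCons a F" by (cases E)
  have "ideq (D ^ M) c (poly F D) 0"
    using Suc.prems[of "Suc i" for i] by (intro Suc.IH) (simp add: E)
  then obtain u v where uv: "poly F D = D ^ M * u + c * v" unfolding ideq_def by auto
  obtain w where "a = c * w" using Suc.prems[of 0] by (auto simp: E dvd_def)
  then have "poly E D - 0 = D ^ Suc M * u + c * (w + D * v)"
    by (simp add: E uv algebra_simps)
  then show ?case by (rule ideqI)
qed

text \<open>Modulo the prime \<open>q\<close> the product \<open>P S\<close> is a nonzero constant.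
  Degrees add modulo a prime, so \<open>P\<close> is constant there as well; \<open>a\<close> and
  \<open>b\<close> are indices of the highest coefficients that survive modulo
  \<open>q\<close>.\<close>

lemma coeffs_dvd_of_mult_coeffs_dvd:
  fixes P S :: "'a::idom poly"
  assumes q: "prime_elem q" and pos: "\<And>i. i > 0 \<Longrightarrow> q dvd coeff (P * S) i"
    and zero: "\<not> q dvd coeff (P * S) 0" and i: "i > 0"
  shows "q dvd coeff P i"
proof (rule ccontr)
  assume nd: "\<not> q dvd coeff P i"
  have top: "\<exists>j\<ge>j0. \<not> q dvd coeff R j \<and> (\<forall>l>j. q dvd coeff R l)" if "\<not> q dvd coeff R j0" for R :: "'a poly" and j0
  proof -
    let ?J = "{j. \<not> q dvd coeff R j}"
    have "?J \<subseteq> {..degree R}" by (auto intro!: leI simp: coeff_eq_0)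
    then have fin: "finite ?J" by (rule finite_subset) simp
    have "Max ?J \<in> ?J" using fin that by (intro Max_in) auto
    moreover have "j0 \<le> Max ?J" using fin that by (intro Max_ge) auto
    moreover have "\<forall>l>Max ?J. q dvd coeff R l" using fin Max_ge leD by blast
    ultimately show ?thesis by blast
  qed
  from top[OF nd] obtain a where a: "a \<ge> i" "\<not> q dvd coeff P a" "\<forall>l>a. q dvd coeff P l" by blast
  have "\<not> q dvd coeff S 0" using zero by (auto simp: coeff_mult)
  from top[OF this] obtain b where b: "\<not> q dvd coeff S b" "\<forall>l>b. q dvd coeff S l" by blast
  have "coeff (P * S) (a + b) = coeff P a * coeff S b + (\<Sum>j\<in>{..a+b} - {a}. coeff P j * coeff S (a + b - j))"
    unfolding coeff_mult by (subst sum.remove[of _ a]) auto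
  moreover have "q dvd (\<Sum>j\<in>{..a+b} - {a}. coeff P j * coeff S (a + b - j))"
  proof (rule dvd_sum)
    fix j assume "j \<in> {..a+b} - {a}"
    then have "j > a \<or> a + b - j > b" by auto
    then show "q dvd coeff P j * coeff S (a + b - j)" using a(3) b(2) by auto
  qed
  moreover have "q dvd coeff (P * S) (a + b)" using pos a(1) i by auto
  ultimately have "q dvd coeff P a * coeff S b" by (simp only: dvd_add_left_iff)
  then show False using a(2) b(1) q by (simp add: prime_elem_dvd_mult_iff)
qed

text \<open>As \<open>f\<close> cannot be cancelled, one copy of it stays in front and turns the
  factors \<open>x\<close> into \<open>y\<close> one at a time.\<close>

lemma ideq_mult_powers:
  assumes "ideq a b (f * x) (f * y)"
  shows "ideq a b (f * x ^ i) (f * y ^ i)"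
proof (induction i)
  case (Suc i)
  have "ideq a b (f * x ^ i * x) (f * y ^ i * x)" using Suc by (rule ideq_mult_right)
  also have "f * y ^ i * x = f * x * y ^ i" by (simp add: ac_simps)
  also have "ideq a b (f * x * y ^ i) (f * y * y ^ i)" using assms by (rule ideq_mult_right)
  finally show ?case by (simp add: ac_simps)
qed simp

text \<open>Uniqueness in Hensel's lemma. In \<open>w ^ k - v ^ k = (w - v) C\<close> the cofactor
  \<open>C\<close> is close to \<open>k v ^ (k - 1)\<close>, a unit up to powers of
  \<open>f\<close>. The relation \<open>f ^ \<sigma> = \<mu> f C\<close> holds modulo
  \<open>a\<close> and \<open>b\<close> only; its \<open>M\<close>-th power puts
  \<open>f ^ (\<sigma> M)\<close> into the ideal of \<open>a ^ M\<close>, \<open>b\<close> and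
  \<open>C\<close>, so multiplying by it removes \<open>C\<close>.\<close>

lemma ideq_diff_of_power_eq:
  fixes w v f F a c :: "'a::comm_ring_1"
  assumes congr: "ideq a b (f * w) (f * v)"
    and powers: "ideq (a ^ M) b (f * w ^ k) (f * v ^ k)"
    and unit: "ideq a b (\<mu> * of_nat k * f * v ^ (k - 1)) (f ^ \<sigma>)"
  shows "ideq (a ^ M) b (f ^ (\<sigma> * M + 1) * (w - v)) 0"
proof -
  define C where "C = (\<Sum>i<k. w ^ i * v ^ (k - 1 - i))"
  have fact: "w ^ k - v ^ k = (w - v) * C"
    unfolding C_def by (subst power_diff_sumr2) (simp add: ac_simps)
  have "ideq a b (f * C) (\<Sum>i<k. f * v ^ (k - 1))"
    unfolding C_def sum_distrib_left
  proof (rule ideq_sum)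
    fix i assume i: "i \<in> {..<k}"
    have "ideq a b (f * w ^ i * v ^ (k - 1 - i)) (f * v ^ i * v ^ (k - 1 - i))"
      using ideq_mult_powers[OF congr] by (rule ideq_mult_right)
    also have "f * v ^ i * v ^ (k - 1 - i) = f * v ^ (k - 1)"
      using i by (simp add: mult.assoc flip: power_add)
    finally show "ideq a b (f * (w ^ i * v ^ (k - 1 - i))) (f * v ^ (k - 1))"
      by (simp add: mult.assoc)
  qed
  then have "ideq a b (\<mu> * (f * C)) (\<mu> * of_nat k * f * v ^ (k - 1))"
    by (simp add: mult.assoc) (metis ideq_mult_left)
  from ideq_trans[OF this unit] obtain h h' where "\<mu> * (f * C) - f ^ \<sigma> = a * h + b * h'"
    unfolding ideq_def by blast
  then have fs: "f ^ \<sigma> = (\<mu> * f * C - a * h) - b * h'" by (simp add: algebra_simps)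
  \<comment> \<open>An expansion to first order is enough: it is applied once to split off a
    multiple of \<open>b\<close> and once to split off a multiple of \<open>C\<close>, leaving
    \<open>(- (a h)) ^ M\<close>.\<close>
  have binom: "\<exists>z. (x + y) ^ M = y ^ M + x * z" for x y :: 'a
  proof (induction M)
    case (Suc M)
    then obtain z where "(x + y) ^ M = y ^ M + x * z" by blast
    then have "(x + y) ^ Suc M = y ^ Suc M + x * (y ^ M + (x + y) * z)" by (simp add: algebra_simps)
    then show ?case by blast
  qed (intro exI[of _ 0], simp)
  obtain z where "(- (b * h') + (\<mu> * f * C - a * h)) ^ M = (\<mu> * f * C - a * h) ^ M + - (b * h') * z"
    using binom by blast
  moreover obtain z' where "(\<mu> * f * C + - (a * h)) ^ M = (- (a * h)) ^ M + \<mu> * f * C * z'"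
    using binom by blast
  moreover have "- (b * h') + (\<mu> * f * C - a * h) = f ^ \<sigma>" unfolding fs by simp
  moreover have "\<mu> * f * C + - (a * h) = \<mu> * f * C - a * h" by simp
  moreover have "(- (a * h)) ^ M = a ^ M * (- h) ^ M"
    by (metis mult_minus_right power_mult_distrib)
  ultimately have pow: "f ^ (\<sigma> * M) = a ^ M * (- h) ^ M + \<mu> * f * C * z' - b * (h' * z)"
    unfolding power_mult by simp
  have e: "f ^ (\<sigma> * M + 1) * (w - v) =
      a ^ M * ((- h) ^ M * f * (w - v)) + b * (- h' * z * f * (w - v)) + (f * (w ^ k - v ^ k)) * (\<mu> * f * z')"
  proof -
    have "f ^ (\<sigma> * M + 1) * (w - v) = f ^ (\<sigma> * M) * (f * (w - v))"
      by (simp add: mult_ac)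
    also have "\<dots> = (a ^ M * (- h) ^ M + \<mu> * f * C * z' - b * (h' * z)) * (f * (w - v))"
      by (simp only: pow)
    also have "\<dots> = a ^ M * ((- h) ^ M * f * (w - v)) + b * (- h' * z * f * (w - v)) +
        (f * ((w - v) * C)) * (\<mu> * f * z')"
      by (simp add: algebra_simps)
    finally show ?thesis unfolding fact .
  qed
  have "ideq (a ^ M) b (f * (w ^ k - v ^ k)) 0"
    using powers by (simp add: right_diff_distrib ideq_diff_0)
  then obtain x y where "f * (w ^ k - v ^ k) = a ^ M * x + b * y" unfolding ideq_def by auto
  then have "f ^ (\<sigma> * M + 1) * (w - v) - 0 =
      a ^ M * ((- h) ^ M * f * (w - v) + x * (\<mu> * f * z')) + b * (- h' * z * f * (w - v) + y * (\<mu> * f * z'))"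
    unfolding e by (simp add: algebra_simps)
  then show ?thesis by (rule ideqI)
qed

text \<open>This is \<open>2 (n^2 \<sigma> + n L + 2 n)\<close> with \<open>L\<close> and \<sigma>
  replaced by the bounds \<open>(n + 1) ^ n\<close> and \<open>1 + (n + 1) ^ n n\<close> valid for
  \<open>k \<le> n\<close>, where \<open>\<sigma> = 1 + L (k - 1)\<close>. The factor 2 is there
  because \<open>e\<close> may take up almost half of \<open>p\<close>.\<close>

definition power_residue_bound :: "nat \<Rightarrow> nat" where
  "power_residue_bound n = 2 * (n * n * (1 + (n + 1) ^ n * n) + n * (n + 1) ^ n + 2 * n)"

text \<open>If \<open>f V ^ k = f ^ N f (x + T)\<close> modulo \<open>p\<close>, then, since \<open>k \<ge> 2\<close>, \<open>V\<close> divides \<open>f ^ N\<close> times both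
  \<open>f (x + T)\<close> and its derivative, hence, by separability, a constant in \<open>T\<close>.\<close>

lemma taylor_shift_not_power:
  fixes f u v :: "int poly" and V :: "int poly poly" and p R :: int
  assumes p: "prime p" and k: "k \<ge> 2"
    and bezout: "u * f + v * pderiv f = [:R:]" "\<not> p dvd R"
    and lc: "\<not> p dvd lead_coeff f" and deg: "degree f > 0"
  shows "\<not> [:[:p:]:] dvd [:f:] * V ^ k - [:f ^ N:] * taylor_shift f"
proof
  define q where "q = [:p:]"
  assume "[:[:p:]:] dvd [:f:] * V ^ k - [:f ^ N:] * taylor_shift f"
  then obtain W where W: "[:f:] * V ^ k - [:f ^ N:] * taylor_shift f = [:q:] * W"
    unfolding q_def by (rule dvdE)
  have pe: "prime_elem q"
    unfolding q_def by (intro lift_prime_elem_poly prime_imp_prime_elem p)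
  have nf: "\<not> q dvd f" unfolding q_def using lc by (rule not_const_dvd)
  obtain k' where k': "k = Suc (Suc k')" using k that[of "k - 2"] by simp
  define F FN Q K where "F = [:f:]" and "FN = [:f ^ N:]" and "Q = [:q:]" and "K = [:of_nat k :: int poly:]"
  \<comment> \<open>The quotient by \<open>V\<close> of the Bezout combination of
    \<open>f V ^ k\<close> and its derivative in \<open>T\<close>; the exponent \<open>k - 2\<close>
    is where \<open>k \<ge> 2\<close> enters.\<close>
  define Y where "Y = taylor_shift u * F * V ^ (k - 1) + taylor_shift v * F * K * V ^ (k - 2) * pderiv V"
  have pc: "pderiv ([:a:] * Z) = [:a:] * pderiv Z" for a :: "int poly" and Z
    by (simp add: pderiv_smult)
  have pk: "pderiv (V ^ k) = K * V ^ (k - 1) * pderiv V"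
    unfolding K_def pderiv_power by simp
  have W1: "F * V ^ k - FN * taylor_shift f = Q * W" using W unfolding F_def FN_def Q_def .
  have "pderiv (F * V ^ k - FN * taylor_shift f) = pderiv (Q * W)" by (simp only: W1)
  then have W2: "F * (K * V ^ (k - 1) * pderiv V) - FN * taylor_shift (pderiv f) = Q * pderiv W"
    unfolding pderiv_diff F_def FN_def Q_def pc pk pderiv_taylor_shift .
  have bz: "taylor_shift u * taylor_shift f + taylor_shift v * taylor_shift (pderiv f) = [:[:R:]:]"
    by (simp only: taylor_shift_mult[symmetric] taylor_shift_add[symmetric] bezout(1) taylor_shift_const)
  have "FN * [:[:R:]:] =
     taylor_shift u * (FN * taylor_shift f) + taylor_shift v * (FN * taylor_shift (pderiv f))"
    by (simp only: distrib_left mult.left_commute bz[symmetric])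
  also have "FN * taylor_shift f = F * V ^ k - Q * W" using W1 by (simp add: algebra_simps)
  also have "FN * taylor_shift (pderiv f) = F * (K * V ^ (k - 1) * pderiv V) - Q * pderiv W"
    using W2 by (simp add: algebra_simps)
  also have "taylor_shift u * (F * V ^ k - Q * W) +
      taylor_shift v * (F * (K * V ^ (k - 1) * pderiv V) - Q * pderiv W) =
      V * Y - Q * (taylor_shift u * W + taylor_shift v * pderiv W)"
    unfolding Y_def k' by (simp add: algebra_simps)
  finally have "V * Y = FN * [:[:R:]:] + Q * (taylor_shift u * W + taylor_shift v * pderiv W)"
    by (simp add: algebra_simps)
  moreover have "FN * [:[:R:]:] = [:f ^ N * [:R:]:]" unfolding FN_def by simp
  ultimately have VS: "V * Y = [:f ^ N * [:R:]:] + [:q:] * (taylor_shift u * W + taylor_shift v * pderiv W)"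
    unfolding Q_def by (simp only:)
  have cVS: "coeff (V * Y) i = coeff [:f ^ N * [:R:]:] i + q * coeff (taylor_shift u * W + taylor_shift v * pderiv W) i" for i
    unfolding VS by simp
  have fN: "\<not> q dvd f ^ N * [:r:]" if "\<not> p dvd r" for r
  proof -
    have "\<not> q dvd f ^ N" using nf pe prime_elem_dvd_power by blast
    moreover have "\<not> q dvd [:r:]" unfolding q_def using that by simp
    ultimately show ?thesis using pe prime_elem_dvd_mult_iff by blast
  qed
  have "\<not> q dvd f ^ N * [:R:]" using bezout(2) by (rule fN)
  then have "\<not> q dvd coeff (V * Y) 0" unfolding cVS by (simp add: dvd_add_left_iff)
  moreover have "q dvd coeff (V * Y) i" if "i > 0" for i
    unfolding cVS using that by (simp add: coeff_pCons split: nat.split)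
  ultimately have V: "q dvd coeff V i" if "i > 0" for i
    using coeffs_dvd_of_mult_coeffs_dvd[OF pe] that by blast
  \<comment> \<open>Now \<open>f V ^ k\<close> is constant in \<open>T\<close> modulo
    \<open>p\<close>, whereas \<open>f ^ N f (x + T)\<close> has the top coefficient
    \<open>f ^ N\<close> times the leading coefficient of \<open>f\<close>, which does not vanish
    modulo \<open>p\<close>.\<close>
  have "[:q:] dvd V - [:coeff V 0:]"
    using V by (auto simp: const_poly_dvd_iff coeff_pCons split: nat.split)
  then have "ideq 0 [:q:] (V ^ k) ([:coeff V 0:] ^ k)" by (intro ideq_power ideq_dvd)
  then obtain Z where Z: "V ^ k = [:coeff V 0 ^ k:] + [:q:] * Z"
    unfolding ideq_def by (auto simp: poly_const_pow algebra_simps)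
  have "q dvd coeff ([:f:] * V ^ k) (degree f)"
    unfolding Z using deg by (simp add: coeff_pCons split: nat.split)
  moreover have "coeff ([:f:] * V ^ k) (degree f) = f ^ N * [:lead_coeff f:] + q * coeff W (degree f)"
  proof -
    have "[:f:] * V ^ k = [:f ^ N:] * taylor_shift f + [:q:] * W" using W by (simp add: algebra_simps)
    then show ?thesis by (simp add: lead_coeff_taylor_shift)
  qed
  ultimately have "q dvd f ^ N * [:lead_coeff f:]" by (metis dvd_add_left_iff dvd_triv_left)
  then show False using fN[OF lc] by blast
qed

text \<open>The case in which root counting suffices: \<open>f (f ^ e - c)\<close> would vanish at
  all residues although its degree is below \<open>p\<close>, so \<open>f ^ e - c\<close> would be
  zero modulo \<open>p\<close>, against its leading coefficient.\<close>

lemma exists_nonroot_not_power_residue_small_degree: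
  fixes f :: "int poly"
  assumes p: "prime (p::nat)" and lc: "\<not> int p dvd lead_coeff f"
    and n: "degree f > 0" and e: "e > 0" and deg: "degree f * (e + 1) < p"
  shows "\<exists>a. \<not> int p dvd poly f a \<and> \<not> int p dvd poly f a ^ e - c"
proof (rule ccontr)
  assume "\<not> ?thesis"
  then have van: "int p dvd poly (f * (f ^ e - [:c:])) a" for a
    by (auto intro: dvd_mult dvd_mult2)
  have "degree (f ^ e - [:c:]) \<le> degree f * e"
    by (intro degree_diff_le) (auto intro: degree_power_le)
  then have "degree (f * (f ^ e - [:c:])) < p"
    using deg degree_mult_le[of f "f ^ e - [:c:]"] by simp
  from const_dvd_of_vanishing[OF p this van]
  have "[:int p:] dvd f * (f ^ e - [:c:])" .
  moreover have "\<not> [:int p:] dvd f" using lc by (rule not_const_dvd)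
  moreover have pe: "prime_elem [:int p:]" using p by (intro lift_prime_elem_poly) auto
  ultimately have "[:int p:] dvd f ^ e - [:c:]" by (simp add: prime_elem_dvd_mult_iff)
  then have "int p dvd coeff (f ^ e - [:c:]) (degree f * e)" by (simp add: const_poly_dvd_iff)
  moreover have "degree (f ^ e) = degree f * e" using n by (subst degree_power_eq) auto
  then have "coeff (f ^ e - [:c:]) (degree f * e) = lead_coeff f ^ e"
    using n e lead_coeff_power[of f e] by (simp add: coeff_pCons split: nat.split)
  ultimately show False using lc p prime_dvd_power[of "int p"] by auto
qed

text \<open>An elementary substitute for the Weil bound. By Frobenius, \<open>f ^ e\<close> is a \<open>k\<close>-th root of
  \<open>f (x ^ p) / f x = f (x + T) / f x\<close> with \<open>T = x ^ p - x\<close>. If it is constant away from the roots of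
  \<open>f\<close>, it agrees with the \<open>T\<close>-adic expansion of such a root modulo \<open>T ^ n\<close>. Since \<open>p\<close> is large, both
  sides have degree less than that of \<open>T ^ n\<close>, so they are equal, and uniqueness of \<open>T\<close>-adic digits
  makes \<open>f (x + T) / f x\<close> a \<open>k\<close>-th power in independent variables \<open>x\<close> and \<open>T\<close>.\<close>

lemma exists_nonroot_not_power_residue:
  fixes f u v :: "int poly" and R c :: int and p k e :: nat
  assumes p: "prime p" and ke: "k * e = p - 1" and k: "k \<ge> 2"
    and bezout: "u * f + v * pderiv f = [:R:]" "\<not> int p dvd R"
    and lc: "\<not> int p dvd lead_coeff f" and deg: "degree f > 0"
    and bound: "p > power_residue_bound (degree f)"
  shows "\<exists>a. \<not> int p dvd poly f a \<and> \<not> int p dvd poly f a ^ e - c"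
proof (rule ccontr)
  assume contra: "\<not> ?thesis"
  define n where "n = degree f"
  define T where "T = artin_schreier p"
  define q where "q = [:int p:]"
  have p2: "p \<ge> 2" using p prime_ge_2_nat by blast
  have pp: "prime (int p)" using p by simp
  note monic = artin_schreier_monic[OF p2, folded T_def]
  have pe: "prime_elem q" unfolding q_def using p by (intro lift_prime_elem_poly) auto
  have nf: "\<not> q dvd f" unfolding q_def using lc by (rule not_const_dvd)
  have e: "e > 0" using ke p2 by (cases e) auto
  have np: "2 * (n * n) + 2 * n < p"
    using bound unfolding power_residue_bound_def n_def[symmetric] by (simp add: algebra_simps)
  \<comment> \<open>For \<open>k > n\<close> the exponent \<open>e\<close> is so small that root
    counting already decides. With \<open>k \<le> n\<close> the bounds on \<open>L\<close> and
    \<sigma> depend on \<open>n\<close> only.\<close>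
  have kn: "k \<le> n"
  proof (rule ccontr)
    assume "\<not> k \<le> n"
    then have "(n + 1) * e \<le> k * e" by (intro mult_right_mono) auto
    then have 1: "n * e + e \<le> p - 1" using ke by simp
    have "n * (e + 1) < p"
    proof (cases "e \<ge> n")
      case True
      then show ?thesis using 1 p2 by simp
    next
      case False
      then have "n * (e + 1) \<le> n * n" by (intro mult_left_mono) auto
      then show ?thesis using np by linarith
    qed
    then show False
      using exists_nonroot_not_power_residue_small_degree[OF p lc deg e] contra unfolding n_def by blast
  qed
  have "\<exists>a. \<not> int p dvd poly f a"
    using const_dvd_of_vanishing[OF p, of f] np nf unfolding n_def q_def by fastforce
  then obtain a0 where a0: "\<not> int p dvd poly f a0" by blast
  have ck: "int p dvd c ^ k - 1"
  proof -
    have "int p dvd poly f a0 ^ e - c" using contra a0 by blast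
    then have "[c = poly f a0 ^ e] (mod int p)" by (simp add: cong_iff_dvd_diff dvd_diff_commute)
    then have "[c ^ k = (poly f a0 ^ e) ^ k] (mod int p)" by (rule cong_pow)
    also have "(poly f a0 ^ e) ^ k = poly f a0 ^ (e * k)" by (simp only: power_mult)
    also have "e * k = p - 1" using ke by (simp only: mult.commute)
    finally have "[c ^ k = poly f a0 ^ (p - 1)] (mod int p)" .
    moreover have "poly f a0 * (poly f a0 ^ (p - 1) - 1) = poly f a0 ^ p - poly f a0"
      using p2 by (cases p) (simp_all add: right_diff_distrib)
    then have "int p dvd poly f a0 * (poly f a0 ^ (p - 1) - 1)" using fermat_int[OF p] by simp
    then have "int p dvd poly f a0 ^ (p - 1) - 1" using a0 pp by (simp add: prime_dvd_mult_iff)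
    then have "[poly f a0 ^ (p - 1) = 1] (mod int p)" by (simp add: cong_iff_dvd_diff)
    ultimately have "[c ^ k = 1] (mod int p)" by (rule cong_trans)
    then show ?thesis by (simp add: cong_iff_dvd_diff)
  qed
  have cop_k: "coprime (int k) (int p)"
  proof -
    have "k < p" using kn np by (metis add_lessD1 le_less_trans le_add2 mult_2 trans_less_add1)
    then have "\<not> int p dvd int k" using k by (auto dest: zdvd_imp_le)
    then show ?thesis using prime_imp_coprime[OF pp] by (metis coprime_commute)
  qed
  have "coprime c (int p)"
  proof -
    have "\<not> int p dvd c"
    proof
      assume "int p dvd c"
      then have "int p dvd c ^ k" using k dvd_trans[OF _ dvd_power[of k c]] by simp
      then have "int p dvd c ^ k - (c ^ k - 1)" using ck by (rule dvd_diff)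
      then have "int p dvd 1" by simp
      then show False using pp by (simp add: not_prime_unit)
    qed
    then show ?thesis using prime_imp_coprime[OF pp] by (metis coprime_commute)
  qed
  then have "coprime (int k * c ^ (k - 1)) (int p)" using cop_k by simp
  then obtain \<mu> where \<mu>: "[int k * c ^ (k - 1) * \<mu> = 1] (mod int p)"
    using cong_solve_coprime_int by blast
  obtain \<kappa> where "[int k * \<kappa> = 1] (mod int p)"
    using cop_k cong_solve_coprime_int by blast
  then have \<kappa>: "int p dvd 1 - int k * \<kappa>" by (simp add: cong_iff_dvd_diff dvd_diff_commute)
  obtain V L where L: "L \<le> (k + 1) ^ n" and V: "degree V < n" "coeff_degrees_le V (n * L)"
    "coeff V 0 = f ^ L" and
    E: "\<And>i. i < n \<Longrightarrow> q dvd coeff ([:f:] * V ^ k - [:f ^ (L * k):] * taylor_shift f) i"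
    using approximate_root[OF \<kappa>, of n f] k kn unfolding n_def q_def by fastforce
  define E where "E = [:f:] * V ^ k - [:f ^ (L * k):] * taylor_shift f"
  define \<sigma> where "\<sigma> = 1 + L * (k - 1)"
  \<comment> \<open>The exact root: since \<open>k e = p - 1\<close>,
    \<open>f w ^ k = f ^ (L k) f ^ p\<close>. The approximate root \<open>v0\<close> starts with
    \<open>f ^ L\<close> and \<open>w\<close> with \<open>c f ^ L\<close>, up to a factor
    \<open>f\<close>; hence \<open>v0\<close> is multiplied by \<open>c\<close>, a
    \<open>k\<close>-th root of unity modulo \<open>p\<close>.\<close>
  define w where "w = f ^ (e + L)"
  define v0 where "v0 = poly V T"
  define v1 where "v1 = [:c:] * v0"
  have Lb: "L \<le> (n + 1) ^ n" using L kn by (meson add_le_mono1 le_trans power_mono zero_le)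
  have "(1 + L * (k - 1)) \<le> 1 + (n + 1) ^ n * n"
    using Lb kn by (intro add_left_mono mult_mono) auto
  then have "n * n * \<sigma> \<le> n * n * (1 + (n + 1) ^ n * n)" unfolding \<sigma>_def by simp
  moreover have "n * L \<le> n * (n + 1) ^ n" using Lb by simp
  ultimately have "2 * (n * n * \<sigma> + n * L + 2 * n) \<le> power_residue_bound n"
    unfolding power_residue_bound_def by (rule mult_left_mono[OF add_mono[OF add_mono order_refl]]) simp
  then have big: "2 * (n * n * \<sigma> + n * L + 2 * n) < p"
    using bound unfolding n_def by (rule le_less_trans)
  have ET: "poly E T = f * v0 ^ k - f ^ (L * k) * pcompose f (monom 1 p)"
    unfolding E_def v0_def T_def by (simp add: poly_taylor_shift artin_schreier_def)
  have frob: "ideq a q (pcompose f (monom 1 p)) (f ^ p)" for a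
    using poly_frobenius[OF p] unfolding q_def by (rule ideq_dvd)
  have c1: "ideq a q (v1 ^ k) (v0 ^ k)" for a
  proof -
    have "v1 ^ k - v0 ^ k = [:c ^ k - 1:] * v0 ^ k"
      unfolding v1_def power_mult_distrib by (simp add: poly_const_pow algebra_simps smult_diff_left)
    moreover have "q dvd \<dots>" unfolding q_def using ck by (intro dvd_mult2) simp
    ultimately show ?thesis by (metis ideq_dvd)
  qed
  have fw: "f * w ^ k = f ^ (L * k) * f ^ p"
  proof -
    have "1 + (e + L) * k = L * k + p" using ke p2 by (simp add: algebra_simps)
    then show ?thesis unfolding w_def power_add[symmetric] power_mult[symmetric]
      by (metis power_Suc plus_1_eq_Suc)
  qed
  have "ideq (T ^ n) q (f * v0 ^ k) (f ^ (L * k) * pcompose f (monom 1 p))"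
  proof -
    have "ideq (T ^ n) q (poly E T) 0" using E unfolding E_def by (rule ideq_poly_of_coeffs)
    then show ?thesis by (simp only: ET ideq_diff_0)
  qed
  also have "ideq (T ^ n) q \<dots> (f ^ (L * k) * f ^ p)" using frob by (rule ideq_mult_left)
  also have "\<dots> = f * w ^ k" using fw by simp
  finally have "ideq (T ^ n) q (f * w ^ k) (f * v0 ^ k)" by (rule ideq_sym)
  also have "ideq (T ^ n) q (f * v0 ^ k) (f * v1 ^ k)"
    using c1 by (intro ideq_mult_left) (rule ideq_sym)
  finally have powers: "ideq (T ^ n) q (f * w ^ k) (f * v1 ^ k)" .
  have "T dvd poly V T - poly V 0"
    by (cases V) simp
  then have v0f: "ideq T q v0 (f ^ L)" using V(3) unfolding v0_def by (auto simp: poly_0_coeff_0 intro: ideq_dvd')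
  \<comment> \<open>At roots of \<open>f\<close> nothing is known about \<open>f ^ e\<close>; only
    \<open>f (f ^ e - c)\<close> vanishes at all integers modulo \<open>p\<close>, hence the factor
    \<open>f\<close> on both sides.\<close>
  have congr: "ideq T q (f * w) (f * v1)"
  proof -
    have "ideq T q (f * (f ^ e - [:c:])) 0"
      unfolding T_def q_def using contra
      by (intro ideq_artin_schreier_of_vanishing[OF p]) (auto intro: dvd_mult dvd_mult2)
    then have "ideq T q (f * f ^ e) (f * [:c:])" by (simp only: ideq_diff_0 right_diff_distrib)
    then have "ideq T q (f * f ^ e * f ^ L) (f * [:c:] * f ^ L)" by (rule ideq_mult_right)
    also have "ideq T q (f * [:c:] * f ^ L) (f * [:c:] * v0)"
      using v0f by (intro ideq_mult_left) (rule ideq_sym)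
    finally show ?thesis unfolding w_def v1_def power_add by (simp only: mult.assoc)
  qed
  have unit: "ideq T q ([:\<mu>:] * of_nat k * f * v1 ^ (k - 1)) (f ^ \<sigma>)"
  proof -
    have "ideq T q (v0 ^ (k - 1)) ((f ^ L) ^ (k - 1))" using v0f by (rule ideq_power)
    then have "ideq T q ([:\<mu>:] * of_nat k * f * [:c ^ (k - 1):] * v0 ^ (k - 1))
       ([:\<mu>:] * of_nat k * f * [:c ^ (k - 1):] * (f ^ L) ^ (k - 1))" by (rule ideq_mult_left)
    also have "[:\<mu>:] * of_nat k * f * [:c ^ (k - 1):] * (f ^ L) ^ (k - 1) =
        [:int k * c ^ (k - 1) * \<mu>:] * f ^ \<sigma>"
      unfolding \<sigma>_def by (simp add: of_nat_poly power_mult power_add mult_ac)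
    also have "ideq T q \<dots> (1 * f ^ \<sigma>)"
    proof (intro ideq_mult_right ideq_dvd)
      show "q dvd [:int k * c ^ (k - 1) * \<mu>:] - 1"
        using \<mu> by (simp add: q_def one_pCons cong_iff_dvd_diff)
    qed
    finally show ?thesis unfolding v1_def power_mult_distrib by (simp add: poly_const_pow mult_ac)
  qed
  have zero: "ideq (T ^ n) q (f ^ (\<sigma> * n + 1) * (w - v1)) 0"
    using ideq_diff_of_power_eq[OF congr powers unit] .
  have dv0: "degree v0 \<le> n * L + (n - 1) * p"
  proof -
    have "degree (poly V T) \<le> n * L + degree V * p"
      using V(2)
    proof (induction V)
      case (pCons a V)
      have a: "degree a \<le> n * L" and V: "coeff_degrees_le V (n * L)"
        using pCons.prems unfolding coeff_degrees_le_def by (metis coeff_pCons_0, metis coeff_pCons_Suc)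
      show ?case
      proof (cases "V = 0")
        case True
        then show ?thesis using a by simp
      next
        case False
        have "degree (T * poly V T) \<le> p + (n * L + degree V * p)"
          using degree_mult_le[of T "poly V T"] pCons.IH[OF V] monic(1) by simp
        then show ?thesis using a False by (auto intro!: degree_add_le)
      qed
    qed simp
    also have "\<dots> \<le> n * L + (n - 1) * p"
      using V(1) by (intro add_left_mono mult_right_mono) linarith+
    finally show ?thesis unfolding v0_def .
  qed
  have n1: "n \<ge> 2" using k kn by simp
  \<comment> \<open>The budget is \<open>n p\<close>, the degree of \<open>T ^ n\<close>.
    \<open>w\<close> uses \<open>n (e + L)\<close>, where \<open>2 e < p\<close> because
    \<open>k \<ge> 2\<close>; \<open>v1\<close> uses \<open>n L + (n - 1) p\<close>, because
    \<open>V\<close> has degree below \<open>n\<close> in \<open>T\<close>. Both leave room for the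
    factor \<open>f ^ (\<sigma> n + 1)\<close>.\<close>
  have "degree (w - v1) + n * (\<sigma> * n + 1) < n * p"
  proof -
    have "2 * e \<le> k * e" using k by simp
    then have e2: "2 * e < p" using ke p2 by simp
    have "degree w \<le> n * (e + L)" unfolding w_def n_def by (rule degree_power_le)
    moreover have "n * (e + L) + n * (\<sigma> * n + 1) < n * p"
    proof -
      have "L + \<sigma> * n + 1 \<le> n * n * \<sigma> + n * L + 2 * n"
      proof -
        have "L \<le> n * L" "\<sigma> * n \<le> n * n * \<sigma>" using n1 by auto
        then show ?thesis using n1 by linarith
      qed
      then have "2 * (L + \<sigma> * n + 1) \<le> 2 * (n * n * \<sigma> + n * L + 2 * n)"
        by (simp only: mult_le_mono2)
      then have "2 * (L + \<sigma> * n + 1) < p" using big by (rule le_less_trans)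
      moreover have "e + m < p" if "2 * m < p" for m using that e2 by linarith
      ultimately have "e + (L + \<sigma> * n + 1) < p" by blast
      then have "e + L + (\<sigma> * n + 1) < p" by (simp only: add.assoc)
      then have "n * (e + L + (\<sigma> * n + 1)) < n * p" using n1 by (intro mult_strict_left_mono) auto
      then show ?thesis by (simp only: distrib_left add.assoc)
    qed
    moreover have "degree v1 \<le> n * L + (n - 1) * p"
      using dv0 degree_smult_le[of c v0] unfolding v1_def by simp
    moreover have "n * L + (n - 1) * p + n * (\<sigma> * n + 1) < n * p"
    proof -
      have "n * (\<sigma> * n + 1) = n * n * \<sigma> + n" by (simp add: algebra_simps)
      moreover have "b + (a + n) < p" if "2 * (a + b + 2 * n) < p" for a b using that by presburger
      ultimately have "n * L + n * (\<sigma> * n + 1) < p" using big by (simp only:)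
      moreover have "(n - 1) * p + p = n * p" using n1 by (cases n) auto
      ultimately show ?thesis by linarith
    qed
    moreover have "degree (w - v1) \<le> max (degree w) (degree v1)" by (rule degree_diff_le_max)
    ultimately show ?thesis by linarith
  qed
  moreover have "degree (f ^ (\<sigma> * n + 1) * (w - v1)) \<le> n * (\<sigma> * n + 1) + degree (w - v1)"
    using degree_mult_le[of "f ^ (\<sigma> * n + 1)" "w - v1"] degree_power_le[of f "\<sigma> * n + 1"]
    unfolding n_def by linarith
  moreover have Tn: "lead_coeff (T ^ n) = 1" "degree (T ^ n) = n * p"
  proof -
    have "T \<noteq> 0" using monic(2) by auto
    then show "degree (T ^ n) = n * p" using monic(1) by (simp add: degree_power_eq)
    show "lead_coeff (T ^ n) = 1" using monic(2) by (simp only: lead_coeff_power power_one)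
  qed
  ultimately have "degree (f ^ (\<sigma> * n + 1) * (w - v1)) < degree (T ^ n)" by simp
  then have "q dvd f ^ (\<sigma> * n + 1) * (w - v1)"
    using zero Tn(1) unfolding q_def by (intro dvd_of_degree_less) auto
  then have "q dvd w - v1"
    using nf pe by (auto simp: prime_elem_dvd_mult_iff dest: prime_elem_dvd_power)
  \<comment> \<open>Congruence modulo \<open>p\<close> alone: the root is now exact, not merely
    modulo \<open>T ^ n\<close>, so \<open>p\<close> divides the value of \<open>E\<close> at
    \<open>T\<close> and therefore each of its \<open>T\<close>-adic digits.\<close>
  then have "ideq 0 q w v1" by (rule ideq_dvd)
  then have "ideq 0 q (f * w ^ k) (f * v1 ^ k)" by (intro ideq_mult_left ideq_power)
  also have "ideq 0 q (f * v1 ^ k) (f * v0 ^ k)" using c1 by (rule ideq_mult_left)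
  finally have "ideq 0 q (f * v0 ^ k) (f * w ^ k)" by (rule ideq_sym)
  also have "f * w ^ k = f ^ (L * k) * f ^ p" by (rule fw)
  also have "ideq 0 q \<dots> (f ^ (L * k) * pcompose f (monom 1 p))"
    using frob by (intro ideq_mult_left) (rule ideq_sym)
  finally have "ideq 0 q (poly E T) 0" unfolding ET by (simp add: ideq_diff_0)
  then have qE: "q dvd poly E T" unfolding ideq_def by auto
  have cE: "coeff_degrees_le E (n * (L * k) + n)"
  proof -
    have "coeff_degrees_le ([:f:] * V ^ k) (n + k * (n * L))"
      by (intro coeff_degrees_le_mult coeff_degrees_le_power V coeff_degrees_le_const) (simp add: n_def)
    moreover have "coeff_degrees_le ([:f ^ (L * k):] * taylor_shift f) (n * (L * k) + n)"
      using coeff_degrees_le_taylor_shift[of f] degree_power_le[of f "L * k"]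
      by (intro coeff_degrees_le_mult coeff_degrees_le_const) (auto simp: n_def)
    ultimately show ?thesis unfolding E_def
      by (intro coeff_degrees_le_diff) (auto simp: algebra_simps elim!: coeff_degrees_le_mono)
  qed
  have "n * (L * k) + n < p"
  proof -
    have "L * k = L * (k - 1) + L" using k by (cases k) auto
    then have "L * k + 1 = \<sigma> + L" unfolding \<sigma>_def by simp
    then have "n * (L * k) + n = n * \<sigma> + n * L" by (metis distrib_left mult.right_neutral)
    also have "\<dots> \<le> n * n * \<sigma> + n * L" using n1 by simp
    finally have le: "n * (L * k) + n \<le> n * n * \<sigma> + n * L" .
    have "c < p" if "c \<le> a + b" "2 * (a + b + 2 * n) < p" for a b c using that by presburger
    from this[OF le big] show ?thesis .
  qed
  then have "degree (coeff E i) < degree T" for i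
    using cE monic(1) unfolding coeff_degrees_le_def by (metis le_less_trans)
  then have "q dvd coeff E i" for i
    using qE monic(2) p unfolding q_def by (intro dvd_coeffs_of_dvd_poly[of T]) auto
  then have "[:[:int p:]:] dvd E" unfolding q_def[symmetric] by (simp add: const_poly_dvd_iff)
  then show False
    using taylor_shift_not_power[OF pp k bezout lc deg] unfolding E_def by blast
qed

section \<open>Local points on twists\<close>

lemma padic_val_divide:
  assumes l: "prime l" and ab: "a \<noteq> 0" "b \<noteq> 0"
  shows "padic_val l (of_int a / of_int b) =
    int (multiplicity (int l) a) - int (multiplicity (int l) b)"
proof -
  obtain c d where q: "quotient_of (of_int a / of_int b) = (c, d)" by force
  have d: "d \<noteq> 0" using quotient_of_denom_pos[OF q] by simp
  have "(of_int a / of_int b :: rat) = of_int c / of_int d" using quotient_of_div[OF q] .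
  then have "(of_int (a * d) :: rat) = of_int (c * b)"
    using ab d by (simp add: frac_eq_eq)
  then have eq: "a * d = c * b" by (simp only: of_int_eq_iff)
  have c: "c \<noteq> 0" using eq ab d by auto
  have pe: "prime_elem (int l)" using l by auto
  have "multiplicity (int l) a + multiplicity (int l) d = multiplicity (int l) c + multiplicity (int l) b"
    using arg_cong[OF eq, of "multiplicity (int l)"] pe ab c d
    by (simp add: prime_elem_multiplicity_mult_distrib)
  then show ?thesis unfolding padic_val_def q by simp
qed

lemma rat_as_fraction: fixes x :: rat
  obtains a b :: int where "x = of_int a / of_int b" "b \<noteq> 0"
proof -
  obtain a b where ab: "quotient_of x = (a, b)" by force
  show ?thesis using that[of a b] quotient_of_div[OF ab] quotient_of_denom_pos[OF ab] by simp
qed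

lemma padic_abs_nonneg: "padic_abs l x \<ge> 0"
  by (simp add: padic_abs_def)

lemma padic_abs_0 [simp]: "padic_abs l 0 = 0"
  by (simp add: padic_abs_def)

lemma padic_abs_pos: "prime l \<Longrightarrow> x \<noteq> 0 \<Longrightarrow> padic_abs l x > 0"
  using prime_gt_0_nat[of l] by (simp add: padic_abs_def)

lemma padic_abs_mult:
  assumes "prime l" shows "padic_abs l (x * y) = padic_abs l x * padic_abs l y"
proof (cases "x = 0 \<or> y = 0")
  case False
  obtain a b where x: "x = of_int a / of_int b" "b \<noteq> 0" by (rule rat_as_fraction)
  obtain c d where y: "y = of_int c / of_int d" "d \<noteq> 0" by (rule rat_as_fraction)
  have nz: "a \<noteq> 0" "c \<noteq> 0" using False x y by auto
  have xy: "x * y = of_int (a * c) / of_int (b * d)" unfolding x y by simp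
  have pe: "prime_elem (int l)" using assms by auto
  have "padic_val l (x * y) = padic_val l x + padic_val l y"
    unfolding xy unfolding x y using nz x(2) y(2) assms pe
    by (subst (1 2 3) padic_val_divide) (auto simp: prime_elem_multiplicity_mult_distrib)
  then show ?thesis using False prime_gt_0_nat[OF assms]
    by (simp add: padic_abs_def power_int_add[symmetric])
qed auto

lemma padic_abs_minus: "padic_abs l (- x) = padic_abs l x"
  by (simp add: padic_abs_def padic_val_def rat_uminus_code Let_def case_prod_beta)

lemma padic_val_add:
  assumes "prime l" "x \<noteq> 0" "y \<noteq> 0" "x + y \<noteq> 0"
  shows "padic_val l (x + y) \<ge> min (padic_val l x) (padic_val l y)"
proof -
  obtain a b where x: "x = of_int a / of_int b" "b \<noteq> 0" by (rule rat_as_fraction)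
  obtain c d where y: "y = of_int c / of_int d" "d \<noteq> 0" by (rule rat_as_fraction)
  have x': "x = of_int (a * d) / of_int (b * d)" using x y by simp
  have y': "y = of_int (c * b) / of_int (b * d)" using x y by simp
  have xy: "x + y = of_int (a * d + c * b) / of_int (b * d)" 
    unfolding of_int_add add_divide_distrib by (simp only: x'[symmetric] y'[symmetric])
  have "a * d + c * b \<noteq> 0"
  proof
    assume "a * d + c * b = 0"
    then have "x + y = of_int 0 / of_int (b * d)" using xy by (simp only:)
    then show False using assms(4) by simp
  qed
  then have nz: "a * d \<noteq> 0" "c * b \<noteq> 0" "a * d + c * b \<noteq> 0" "b * d \<noteq> 0"
    using assms x y by auto
  let ?m = "multiplicity (int l)"
  have "int l ^ min (?m (a * d)) (?m (c * b)) dvd a * d + c * b"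
    by (intro dvd_add multiplicity_dvd') auto
  moreover have "\<not> is_unit (int l)" using assms(1) by (metis not_prime_unit prime_nat_int_transfer)
  ultimately have "?m (a * d + c * b) \<ge> min (?m (a * d)) (?m (c * b))"
    using nz by (intro multiplicity_geI) auto
  then show ?thesis
    unfolding xy unfolding x' y' padic_val_divide[OF assms(1) nz(1,4)] padic_val_divide[OF assms(1) nz(2,4)]
      padic_val_divide[OF assms(1) nz(3,4)] by linarith
qed

lemma padic_abs_add:
  assumes "prime l" shows "padic_abs l (x + y) \<le> max (padic_abs l x) (padic_abs l y)"
proof (cases "x = 0 \<or> y = 0 \<or> x + y = 0")
  case True
  then show ?thesis using padic_abs_nonneg[of l] by (auto simp: max_def)
next
  case False
  have l: "real l > 1" using prime_gt_1_nat[OF assms] by simp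
  have "- padic_val l (x + y) \<le> max (- padic_val l x) (- padic_val l y)"
    using padic_val_add[OF assms] False by fastforce
  then have "real l powi (- padic_val l (x + y)) \<le> real l powi (max (- padic_val l x) (- padic_val l y))"
    using l by (intro power_int_increasing) auto
  then show ?thesis using False by (auto simp: padic_abs_def max_def split: if_splits)
qed

lemma padic_abs_diff:
  "prime l \<Longrightarrow> padic_abs l (x - y) \<le> max (padic_abs l x) (padic_abs l y)"
  using padic_abs_add[of l x "- y"] by (simp add: padic_abs_minus)

lemma padic_abs_of_int_le:
  assumes "prime l" "int l ^ n dvd k" shows "padic_abs l (of_int k) \<le> (1 / real l) ^ n"
proof (cases "k = 0")
  case False
  have l: "real l > 1" using prime_gt_1_nat[OF assms(1)] by simp
  have "\<not> is_unit (int l)" using assms(1) by (metis not_prime_unit prime_nat_int_transfer)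
  then have "n \<le> multiplicity (int l) k" using assms(2) False by (intro multiplicity_geI) auto
  moreover have "padic_val l (of_int k) = int (multiplicity (int l) k)"
    using padic_val_divide[OF assms(1) False, of 1] by simp
  ultimately have "real l powi (- padic_val l (of_int k)) \<le> real l powi (- int n)"
    using l by (intro power_int_increasing) auto
  then show ?thesis using False by (simp add: padic_abs_def power_int_minus power_divide divide_simps)
qed simp

section \<open>Cauchy sequences and the ideal of null sequences\<close>

lemma padic_Cauchy_add:
  assumes "prime l" "padic_Cauchy l s" "padic_Cauchy l t"
  shows "padic_Cauchy l (\<lambda>n. s n + t n)"
  unfolding padic_Cauchy_def
proof (intro allI impI)
  fix e :: real assume "e > 0"
  obtain M where M: "\<And>m n. m \<ge> M \<Longrightarrow> n \<ge> M \<Longrightarrow> padic_abs l (s m - s n) < e"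
    using assms(2)[unfolded padic_Cauchy_def, rule_format, OF \<open>e > 0\<close>] by auto
  obtain N where N: "\<And>m n. m \<ge> N \<Longrightarrow> n \<ge> N \<Longrightarrow> padic_abs l (t m - t n) < e"
    using assms(3)[unfolded padic_Cauchy_def, rule_format, OF \<open>e > 0\<close>] by auto
  show "\<exists>M. \<forall>m\<ge>M. \<forall>n\<ge>M. padic_abs l ((s m + t m) - (s n + t n)) < e"
  proof (intro exI[of _ "max M N"] allI impI)
    fix m n assume mn: "m \<ge> max M N" "n \<ge> max M N"
    have "padic_abs l ((s m - s n) + (t m - t n)) < e"
      using padic_abs_add[OF assms(1), of "s m - s n" "t m - t n"] M[of m n] N[of m n] mn by simp
    then show "padic_abs l ((s m + t m) - (s n + t n)) < e" by (simp only: add_diff_add)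
  qed
qed

lemma padic_Cauchy_minus: "padic_Cauchy l s \<Longrightarrow> padic_Cauchy l (\<lambda>n. - s n)"
  unfolding padic_Cauchy_def minus_diff_minus padic_abs_minus .

lemma padic_Cauchy_const: "padic_Cauchy l (\<lambda>n. c)"
  unfolding padic_Cauchy_def by simp

lemma padic_Cauchy_bounded:
  assumes "prime l" "padic_Cauchy l s"
  obtains C where "C > 0" "\<And>n. padic_abs l (s n) \<le> C"
proof -
  obtain M where M: "\<forall>m\<ge>M. \<forall>n\<ge>M. padic_abs l (s m - s n) < 1"
    using assms(2)[unfolded padic_Cauchy_def, rule_format, of 1] by auto
  define C where "C = 1 + (\<Sum>n\<le>M. padic_abs l (s n))"
  have le: "padic_abs l (s n) \<le> C" for n
  proof (cases "n \<le> M")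
    case True
    then have "padic_abs l (s n) \<le> (\<Sum>n\<le>M. padic_abs l (s n))"
      by (intro member_le_sum) (auto simp: padic_abs_nonneg)
    then show ?thesis unfolding C_def by simp
  next
    case False
    have "padic_abs l (s n) \<le> max (padic_abs l (s n - s M)) (padic_abs l (s M))"
      using padic_abs_add[OF assms(1), of "s n - s M" "s M"] by simp
    moreover have "padic_abs l (s n - s M) < 1" using M False by simp
    moreover have "padic_abs l (s M) \<le> (\<Sum>n\<le>M. padic_abs l (s n))"
      by (intro member_le_sum) (auto simp: padic_abs_nonneg)
    ultimately show ?thesis unfolding C_def using sum_nonneg[of "{..M}" "\<lambda>n. padic_abs l (s n)"]
      by (auto simp: padic_abs_nonneg max_def split: if_splits)
  qed
  moreover have "C > 0" unfolding C_def
    using sum_nonneg[of "{..M}" "\<lambda>n. padic_abs l (s n)"] padic_abs_nonneg by fastforce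
  ultimately show ?thesis using that by blast
qed

lemma padic_Cauchy_mult:
  assumes l: "prime l" and "padic_Cauchy l s" "padic_Cauchy l t"
  shows "padic_Cauchy l (\<lambda>n. s n * t n)"
  unfolding padic_Cauchy_def
proof (intro allI impI)
  fix e :: real assume e: "e > 0"
  obtain C where C: "C > 0" "\<And>n. padic_abs l (s n) \<le> C" using padic_Cauchy_bounded[OF l assms(2)] by blast
  obtain D where D: "D > 0" "\<And>n. padic_abs l (t n) \<le> D" using padic_Cauchy_bounded[OF l assms(3)] by blast
  have "e / C > 0" "e / D > 0" using e C D by auto
  then obtain M N where M: "\<And>m n. m \<ge> M \<Longrightarrow> n \<ge> M \<Longrightarrow> padic_abs l (s m - s n) < e / D"
    and N: "\<And>m n. m \<ge> N \<Longrightarrow> n \<ge> N \<Longrightarrow> padic_abs l (t m - t n) < e / C"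
    using assms(2)[unfolded padic_Cauchy_def, rule_format, of "e / D"]
      assms(3)[unfolded padic_Cauchy_def, rule_format, of "e / C"] by blast
  show "\<exists>M. \<forall>m\<ge>M. \<forall>n\<ge>M. padic_abs l (s m * t m - s n * t n) < e"
  proof (intro exI[of _ "max M N"] allI impI)
    fix m n assume mn: "m \<ge> max M N" "n \<ge> max M N"
    have eq: "s m * t m - s n * t n = s m * (t m - t n) + (s m - s n) * t n" by (simp add: algebra_simps)
    have "padic_abs l (s m * (t m - t n)) \<le> C * padic_abs l (t m - t n)"
      unfolding padic_abs_mult[OF l] using C by (intro mult_right_mono) (auto simp: padic_abs_nonneg)
    also have "\<dots> < e" using N[of m n] mn C(1) by (simp add: field_simps)
    finally have 1: "padic_abs l (s m * (t m - t n)) < e" .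
    have "padic_abs l ((s m - s n) * t n) \<le> padic_abs l (s m - s n) * D"
      unfolding padic_abs_mult[OF l] using D by (intro mult_left_mono) (auto simp: padic_abs_nonneg)
    also have "\<dots> < e" using M[of m n] mn D(1) by (simp add: field_simps)
    finally have 2: "padic_abs l ((s m - s n) * t n) < e" .
    show "padic_abs l (s m * t m - s n * t n) < e"
      unfolding eq using padic_abs_add[OF l, of "s m * (t m - t n)" "(s m - s n) * t n"] 1 2 by simp
  qed
qed

lemma padic_null_add:
  assumes "prime l" "s \<in> padic_null_seqs l" "t \<in> padic_null_seqs l"
  shows "(\<lambda>n. s n + t n) \<in> padic_null_seqs l"
  unfolding padic_null_seqs_def mem_Collect_eq
proof (rule tendsto_sandwich[of "\<lambda>_. 0"])
  show "(\<lambda>n. padic_abs l (s n) + padic_abs l (t n)) \<longlonglongrightarrow> 0"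
    using tendsto_add[of "\<lambda>n. padic_abs l (s n)" 0 sequentially "\<lambda>n. padic_abs l (t n)" 0] assms(2,3)
    by (simp add: padic_null_seqs_def)
  have "padic_abs l (s n + t n) \<le> padic_abs l (s n) + padic_abs l (t n)" for n
    using padic_abs_add[OF assms(1), of "s n" "t n"] padic_abs_nonneg[of l "s n"] padic_abs_nonneg[of l "t n"] by linarith
  then show "\<forall>\<^sub>F n in sequentially. padic_abs l (s n + t n) \<le> padic_abs l (s n) + padic_abs l (t n)" by simp
qed (auto simp: padic_abs_nonneg)

lemma padic_null_minus: "s \<in> padic_null_seqs l \<Longrightarrow> (\<lambda>n. - s n) \<in> padic_null_seqs l"
  by (simp add: padic_null_seqs_def padic_abs_minus)

lemma padic_null_mult:
  assumes l: "prime l" and "s \<in> padic_null_seqs l" "padic_Cauchy l t"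
  shows "(\<lambda>n. t n * s n) \<in> padic_null_seqs l"
  unfolding padic_null_seqs_def mem_Collect_eq
proof -
  obtain D where D: "D > 0" "\<And>n. padic_abs l (t n) \<le> D" using padic_Cauchy_bounded[OF l assms(3)] by blast
  show "(\<lambda>n. padic_abs l (t n * s n)) \<longlonglongrightarrow> 0"
  proof (rule tendsto_sandwich[of "\<lambda>_. 0"])
    show "(\<lambda>n. D * padic_abs l (s n)) \<longlonglongrightarrow> 0"
      using tendsto_mult_left[of "\<lambda>n. padic_abs l (s n)" 0 sequentially D] assms(2)
      by (simp add: padic_null_seqs_def)
    show "\<forall>\<^sub>F n in sequentially. padic_abs l (t n * s n) \<le> D * padic_abs l (s n)"
      unfolding padic_abs_mult[OF l] using D by (intro always_eventually allI mult_right_mono) (auto simp: padic_abs_nonneg)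
  qed (auto simp: padic_abs_nonneg)
qed

lemma padic_null_imp_Cauchy:
  assumes "prime l" "s \<in> padic_null_seqs l" shows "padic_Cauchy l s"
  unfolding padic_Cauchy_def
proof (intro allI impI)
  fix e :: real assume "e > 0"
  then obtain M where M: "\<And>n. n \<ge> M \<Longrightarrow> padic_abs l (s n) < e"
    using assms(2) unfolding padic_null_seqs_def by (auto simp: LIMSEQ_iff padic_abs_nonneg)
  have "padic_abs l (s m - s n) < e" if "m \<ge> M" "n \<ge> M" for m n
    using padic_abs_diff[OF assms(1), of "s m" "s n"] M[OF that(1)] M[OF that(2)] by simp
  then show "\<exists>M. \<forall>m\<ge>M. \<forall>n\<ge>M. padic_abs l (s m - s n) < e" by blast
qed

lemma padic_Cauchy_ring_cring:
  assumes "prime l" shows "cring (padic_Cauchy_ring l)"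
proof (rule cringI)
  show "abelian_group (padic_Cauchy_ring l)"
  proof (rule abelian_groupI)
    fix s assume "s \<in> carrier (padic_Cauchy_ring l)"
    then show "\<exists>t\<in>carrier (padic_Cauchy_ring l). t \<oplus>\<^bsub>padic_Cauchy_ring l\<^esub> s = \<zero>\<^bsub>padic_Cauchy_ring l\<^esub>"
      by (intro bexI[of _ "\<lambda>n. - s n"]) (auto simp: padic_Cauchy_ring_def padic_Cauchy_minus)
  qed (auto simp: padic_Cauchy_ring_def padic_Cauchy_add[OF assms] padic_Cauchy_const algebra_simps)
  show "Group.comm_monoid (padic_Cauchy_ring l)"
    by (rule comm_monoidI)
       (auto simp: padic_Cauchy_ring_def padic_Cauchy_mult[OF assms] padic_Cauchy_const algebra_simps)
qed (auto simp: padic_Cauchy_ring_def algebra_simps)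

lemma padic_null_seqs_ideal:
  assumes "prime l" shows "ideal (padic_null_seqs l) (padic_Cauchy_ring l)"
proof -
  interpret R: cring "padic_Cauchy_ring l" using assms by (rule padic_Cauchy_ring_cring)
  have inv: "\<ominus>\<^bsub>padic_Cauchy_ring l\<^esub> s = (\<lambda>n. - s n)" if "s \<in> carrier (padic_Cauchy_ring l)" for s
  proof -
    have "(\<lambda>n. - s n) \<in> carrier (padic_Cauchy_ring l)"
      using that by (simp add: padic_Cauchy_ring_def padic_Cauchy_minus)
    moreover have "(\<lambda>n. - s n) \<oplus>\<^bsub>padic_Cauchy_ring l\<^esub> s = \<zero>\<^bsub>padic_Cauchy_ring l\<^esub>"
      by (simp add: padic_Cauchy_ring_def)
    ultimately show ?thesis using that by (metis R.minus_equality)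
  qed
  have sub: "padic_null_seqs l \<subseteq> carrier (padic_Cauchy_ring l)"
    using padic_null_imp_Cauchy[OF assms] by (auto simp: padic_Cauchy_ring_def)
  show ?thesis
  proof (rule idealI)
    show "ring (padic_Cauchy_ring l)" by (rule R.ring_axioms)
    show "subgroup (padic_null_seqs l) (add_monoid (padic_Cauchy_ring l))"
    proof (rule R.add.subgroupI)
      show "padic_null_seqs l \<subseteq> carrier (padic_Cauchy_ring l)" by (rule sub)
      show "padic_null_seqs l \<noteq> {}" by (auto simp: padic_null_seqs_def intro!: exI[of _ "\<lambda>n. 0"])
      show "\<ominus>\<^bsub>padic_Cauchy_ring l\<^esub> s \<in> padic_null_seqs l" if "s \<in> padic_null_seqs l" for s
        using inv[of s] sub that padic_null_minus by auto
      show "s \<oplus>\<^bsub>padic_Cauchy_ring l\<^esub> t \<in> padic_null_seqs l" if "s \<in> padic_null_seqs l" "t \<in> padic_null_seqs l" for s t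
        using padic_null_add[OF assms that] by (simp add: padic_Cauchy_ring_def)
    qed
    show "t \<otimes>\<^bsub>padic_Cauchy_ring l\<^esub> s \<in> padic_null_seqs l"
      if "s \<in> padic_null_seqs l" "t \<in> carrier (padic_Cauchy_ring l)" for s t
      using padic_null_mult[OF assms that(1)] that(2) by (simp add: padic_Cauchy_ring_def)
    show "s \<otimes>\<^bsub>padic_Cauchy_ring l\<^esub> t \<in> padic_null_seqs l"
      if "s \<in> padic_null_seqs l" "t \<in> carrier (padic_Cauchy_ring l)" for s t
    proof -
      have "(\<lambda>n. s n * t n) = (\<lambda>n. t n * s n)" by (simp add: mult.commute)
      then show ?thesis
        using padic_null_mult[OF assms that(1)] that(2) by (simp add: padic_Cauchy_ring_def)
    qed
  qed
qed

section \<open>Computing with classes of Cauchy sequences\<close>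

abbreviation padic_class :: "nat \<Rightarrow> (nat \<Rightarrow> rat) \<Rightarrow> (nat \<Rightarrow> rat) set" where
  "padic_class l s \<equiv> padic_null_seqs l +>\<^bsub>padic_Cauchy_ring l\<^esub> s"

lemma poly_map_poly_of_int:
  "poly (map_poly of_int f) (of_int z) = (of_int (poly f z) :: 'a::comm_ring_1)"
  by (induction f) (simp_all add: map_poly_pCons)

context
  fixes l :: nat
  assumes l: "prime l"
begin

interpretation R: cring "padic_Cauchy_ring l" using l by (rule padic_Cauchy_ring_cring)
interpretation I: ideal "padic_null_seqs l" "padic_Cauchy_ring l" using l by (rule padic_null_seqs_ideal)
interpretation K: cring "padic_field l"
  unfolding padic_field_def by (rule I.quotient_is_cring[OF R.cring_axioms])

lemma padic_class_hom: "padic_class l \<in> Ring.ring_hom (padic_Cauchy_ring l) (padic_field l)"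
  unfolding padic_field_def by (rule I.rcos_ring_hom)

lemma padic_class_closed: "padic_Cauchy l s \<Longrightarrow> padic_class l s \<in> carrier (padic_field l)"
  using ring_hom_closed[OF padic_class_hom, of s] by (simp add: padic_Cauchy_ring_def)

lemma padic_class_add:
  "padic_Cauchy l s \<Longrightarrow> padic_Cauchy l t \<Longrightarrow>
    padic_class l s \<oplus>\<^bsub>padic_field l\<^esub> padic_class l t = padic_class l (\<lambda>n. s n + t n)"
  using ring_hom_add[OF padic_class_hom, of s t] by (simp add: padic_Cauchy_ring_def)

lemma padic_class_mult:
  "padic_Cauchy l s \<Longrightarrow> padic_Cauchy l t \<Longrightarrow>
    padic_class l s \<otimes>\<^bsub>padic_field l\<^esub> padic_class l t = padic_class l (\<lambda>n. s n * t n)"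
  using ring_hom_mult[OF padic_class_hom, of s t] by (simp add: padic_Cauchy_ring_def)

lemma padic_class_one: "padic_class l (\<lambda>n. 1) = \<one>\<^bsub>padic_field l\<^esub>"
  using ring_hom_one[OF padic_class_hom] by (simp add: padic_Cauchy_ring_def)

lemma padic_class_zero: "padic_class l (\<lambda>n. 0) = \<zero>\<^bsub>padic_field l\<^esub>"
  using ring_hom_zero[OF padic_class_hom R.ring_axioms K.ring_axioms] by (simp add: padic_Cauchy_ring_def)

lemma padic_class_minus:
  assumes "padic_Cauchy l s"
  shows "\<ominus>\<^bsub>padic_field l\<^esub> padic_class l s = padic_class l (\<lambda>n. - s n)"
proof (rule K.minus_equality)
  show "padic_class l (\<lambda>n. - s n) \<oplus>\<^bsub>padic_field l\<^esub> padic_class l s = \<zero>\<^bsub>padic_field l\<^esub>"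
    using padic_class_add[OF padic_Cauchy_minus[OF assms] assms] by (simp add: padic_class_zero)
qed (use assms padic_Cauchy_minus in \<open>auto intro: padic_class_closed\<close>)

lemma padic_class_eq_iff:
  assumes "padic_Cauchy l s" "padic_Cauchy l t"
  shows "padic_class l s = padic_class l t \<longleftrightarrow> (\<lambda>n. s n - t n) \<in> padic_null_seqs l"
proof -
  have carr: "s \<in> carrier (padic_Cauchy_ring l)" "t \<in> carrier (padic_Cauchy_ring l)"
    using assms by (auto simp: padic_Cauchy_ring_def)
  have "(\<lambda>n. - t n) \<in> carrier (padic_Cauchy_ring l)"
    using assms by (simp add: padic_Cauchy_ring_def padic_Cauchy_minus)
  moreover have "(\<lambda>n. - t n) \<oplus>\<^bsub>padic_Cauchy_ring l\<^esub> t = \<zero>\<^bsub>padic_Cauchy_ring l\<^esub>"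
    by (simp add: padic_Cauchy_ring_def)
  ultimately have "\<ominus>\<^bsub>padic_Cauchy_ring l\<^esub> t = (\<lambda>n. - t n)" using carr by (metis R.minus_equality)
  then have "s \<ominus>\<^bsub>padic_Cauchy_ring l\<^esub> t = (\<lambda>n. s n - t n)"
    unfolding a_minus_def by (simp add: padic_Cauchy_ring_def)
  then show ?thesis using R.quotient_eq_iff_same_a_r_cos[OF I.ideal_axioms carr] by simp
qed

lemma padic_Cauchy_power: "padic_Cauchy l s \<Longrightarrow> padic_Cauchy l (\<lambda>n. s n ^ k)"
  by (induction k) (auto intro: padic_Cauchy_const padic_Cauchy_mult[OF l])

lemma padic_class_power:
  "padic_Cauchy l s \<Longrightarrow> padic_class l s [^]\<^bsub>padic_field l\<^esub> (k::nat) = padic_class l (\<lambda>n. s n ^ k)"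
  by (induction k)
     (simp_all add: padic_class_one padic_class_mult padic_Cauchy_power mult.commute)

lemma padic_class_add_pow_nat:
  "padic_Cauchy l s \<Longrightarrow> add_pow (padic_field l) (k::nat) (padic_class l s) = padic_class l (\<lambda>n. of_nat k * s n)"
proof (induction k)
  case 0
  then show ?case by (simp add: padic_class_zero)
next
  case (Suc k)
  have "padic_Cauchy l (\<lambda>n. of_nat k * s n)"
    using Suc.prems by (intro padic_Cauchy_mult[OF l] padic_Cauchy_const)
  then show ?case
    using Suc by (simp add: K.add.nat_pow_Suc padic_class_add padic_class_closed algebra_simps)
qed

lemma padic_class_add_pow_int:
  assumes "padic_Cauchy l s"
  shows "add_pow (padic_field l) (k::int) (padic_class l s) = padic_class l (\<lambda>n. of_int k * s n)"
proof (cases "k \<ge> 0")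
  case True
  then show ?thesis
    using padic_class_add_pow_nat[OF assms, of "nat k"] by (simp add: add_pow_int_ge of_nat_nat)
next
  case False
  have "padic_Cauchy l (\<lambda>n. of_nat (nat (- k)) * s n)"
    using assms by (intro padic_Cauchy_mult[OF l] padic_Cauchy_const)
  then show ?thesis
    using padic_class_add_pow_nat[OF assms, of "nat (- k)"] False
    by (simp add: add_pow_int_lt padic_class_minus of_nat_nat)
qed

lemma padic_class_sum:
  assumes "finite A" "\<And>i. i \<in> A \<Longrightarrow> padic_Cauchy l (s i)"
  shows "padic_Cauchy l (\<lambda>n. \<Sum>i\<in>A. s i n) \<and>
    (\<Oplus>\<^bsub>padic_field l\<^esub>i\<in>A. padic_class l (s i)) = padic_class l (\<lambda>n. \<Sum>i\<in>A. s i n)"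
  using assms
proof (induction A)
  case empty
  then show ?case by (simp add: padic_class_zero padic_Cauchy_const)
next
  case (insert a A)
  then show ?case
    by (subst K.finsum_insert)
       (auto simp: padic_class_add padic_Cauchy_add[OF l] intro: padic_class_closed)
qed

lemma padic_class_eval:
  assumes "padic_Cauchy l s"
  shows "padic_Cauchy l (\<lambda>n. poly (map_poly of_int f) (s n))"
    and "eval_int_poly (padic_field l) f (padic_class l s) = padic_class l (\<lambda>n. poly (map_poly of_int f) (s n))"
proof -
  have c: "padic_Cauchy l (\<lambda>n. of_int (coeff f i) * s n ^ i)" for i
    using assms by (intro padic_Cauchy_mult[OF l] padic_Cauchy_const padic_Cauchy_power)
  have p: "poly (map_poly of_int f) x = (\<Sum>i\<le>degree f. of_int (coeff f i) * x ^ i)" for x :: rat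
    by (simp add: poly_altdef degree_map_poly coeff_map_poly)
  have "eval_int_poly (padic_field l) f (padic_class l s) =
     (\<Oplus>\<^bsub>padic_field l\<^esub>i\<in>{..degree f}. padic_class l (\<lambda>n. of_int (coeff f i) * s n ^ i))"
    unfolding eval_int_poly_def
    by (simp add: padic_class_power[OF assms] padic_class_add_pow_int padic_Cauchy_power[OF assms])
  then show "padic_Cauchy l (\<lambda>n. poly (map_poly of_int f) (s n))"
    "eval_int_poly (padic_field l) f (padic_class l s) = padic_class l (\<lambda>n. poly (map_poly of_int f) (s n))"
    using padic_class_sum[of "{..degree f}" "\<lambda>i n. of_int (coeff f i) * s n ^ i"] c
    by (simp_all add: p)
qed

lemma padic_null_of_dvd:
  assumes "\<And>n. int l ^ n dvd k n"
  shows "(\<lambda>n. of_int (k n)) \<in> padic_null_seqs l"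
  unfolding padic_null_seqs_def mem_Collect_eq
proof (rule tendsto_sandwich[of "\<lambda>_. 0"])
  show "(\<lambda>n. (1 / real l) ^ n) \<longlonglongrightarrow> 0"
    using prime_gt_1_nat[OF l] by (intro LIMSEQ_realpow_zero) auto
  show "\<forall>\<^sub>F n in sequentially. padic_abs l (of_int (k n)) \<le> (1 / real l) ^ n"
    using padic_abs_of_int_le[OF l assms] by simp
qed (auto simp: padic_abs_nonneg)

lemma padic_Cauchy_of_int:
  assumes "\<And>n. int l ^ n dvd x (Suc n) - x n"
  shows "padic_Cauchy l (\<lambda>n. of_int (x n))"
proof -
  have d: "int l ^ M dvd x (M + j) - x M" for M j
  proof (induction j)
    case (Suc j)
    have "int l ^ M dvd x (Suc (M + j)) - x (M + j)"
      using assms[of "M + j"] by (meson dvd_trans le_add1 le_imp_power_dvd)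
    from dvd_add[OF this Suc] show ?case by simp
  qed simp
  show ?thesis unfolding padic_Cauchy_def
  proof (intro allI impI)
    fix e :: real assume "e > 0"
    have "(\<lambda>n. (1 / real l) ^ n) \<longlonglongrightarrow> 0"
      using prime_gt_1_nat[OF l] by (intro LIMSEQ_realpow_zero) auto
    then obtain M where M: "(1 / real l) ^ M < e"
      using \<open>e > 0\<close> order_tendstoD(2) eventually_sequentially by (metis le_refl)
    have "padic_abs l (of_int (x m) - of_int (x n)) < e" if "m \<ge> M" "n \<ge> M" for m n
    proof -
      have "int l ^ M dvd x m - x M" "int l ^ M dvd x n - x M"
        using d[of M "m - M"] d[of M "n - M"] that by simp_all
      then have "int l ^ M dvd (x m - x M) - (x n - x M)" by (rule dvd_diff)
      then have "padic_abs l (of_int (x m - x n)) \<le> (1 / real l) ^ M"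
        by (intro padic_abs_of_int_le[OF l]) simp
      then show ?thesis using M by simp
    qed
    then show "\<exists>M. \<forall>m\<ge>M. \<forall>n\<ge>M. padic_abs l (of_int (x m) - of_int (x n)) < e" by blast
  qed
qed

text \<open>Bridge to integer congruences: a point is given by two integer sequences whose
  \<open>n\<close>-th terms are correct modulo \<open>l ^ n\<close>. The common value
  \<open>c\<close> of both sides is an ordinary nonzero integer, and a nonzero constant sequence is
  not null, so the point is nontrivial.\<close>

lemma twist_has_nontrivial_point_padicI:
  assumes x: "\<And>n. int l ^ n dvd x (Suc n) - x n" and y: "\<And>n. int l ^ n dvd y (Suc n) - y n"
    and fx: "\<And>n. int l ^ n dvd poly f (x n) - c" and dy: "\<And>n. int l ^ n dvd d * y n ^ 2 - c"
    and c: "c \<noteq> 0"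
  shows "twist_has_nontrivial_point (padic_field l) f d"
proof -
  let ?x = "\<lambda>n. of_int (x n) :: rat" and ?y = "\<lambda>n. of_int (y n) :: rat" and ?c = "\<lambda>n. of_int c :: rat"
  have X: "padic_Cauchy l ?x" and Y: "padic_Cauchy l ?y"
    using x y by (auto intro: padic_Cauchy_of_int)
  have Y2: "padic_Cauchy l (\<lambda>n. of_int d * ?y n ^ 2)"
    using Y by (intro padic_Cauchy_mult[OF l] padic_Cauchy_const padic_Cauchy_power)
  have ev: "eval_int_poly (padic_field l) f (padic_class l ?x) = padic_class l ?c"
    unfolding padic_class_eval(2)[OF X] padic_class_eq_iff[OF padic_class_eval(1)[OF X] padic_Cauchy_const]
    unfolding poly_map_poly_of_int using padic_null_of_dvd[OF fx] by simp
  have "add_pow (padic_field l) d (padic_class l ?y [^]\<^bsub>padic_field l\<^esub> (2::nat)) =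
      padic_class l (\<lambda>n. of_int d * ?y n ^ 2)"
    unfolding padic_class_power[OF Y] by (rule padic_class_add_pow_int[OF padic_Cauchy_power[OF Y]])
  also have "\<dots> = padic_class l ?c"
    unfolding padic_class_eq_iff[OF Y2 padic_Cauchy_const]
    using padic_null_of_dvd[OF dy] by simp
  finally have pt: "add_pow (padic_field l) d (padic_class l ?y [^]\<^bsub>padic_field l\<^esub> (2::nat)) = padic_class l ?c" .
  have "padic_class l ?c \<noteq> padic_class l (\<lambda>n. 0)"
    unfolding padic_class_eq_iff[OF padic_Cauchy_const padic_Cauchy_const]
    using padic_abs_pos[OF l, of "of_int c"] c by (auto simp: padic_null_seqs_def tendsto_const_iff)
  then show ?thesis
    unfolding twist_has_nontrivial_point_def
    using padic_class_closed[OF X] padic_class_closed[OF Y] pt ev padic_class_zero by metis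
qed

end

section \<open>Hensel's lemma and points over the l-adic fields\<close>

lemma diff_dvd_poly_diff: "a - b dvd poly h a - poly h b" for a b :: "'a::comm_ring_1"
proof (induction h)
  case (pCons c h)
  have "poly (pCons c h) a - poly (pCons c h) b = (a - b) * poly h a + b * (poly h a - poly h b)"
    by (simp add: algebra_simps)
  then show ?case using pCons.IH by simp
qed simp

lemma hensel_sequence:
  fixes h :: "int poly"
  assumes q: "prime (q::int)" and r: "q dvd poly h r" "\<not> q dvd poly (pderiv h) r"
  shows "\<exists>x. (\<forall>n. q ^ n dvd x (Suc n) - x n) \<and> (\<forall>n. q ^ n dvd poly h (x n))"
proof -
  \<comment> \<open>The precision runs one ahead of the index, so that the given root modulo
    \<open>q\<close> can serve as term 0.\<close>
  define good where "good n a \<longleftrightarrow> q ^ Suc n dvd poly h a \<and> q dvd a - r" for n a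
  have step: "\<exists>b. good (Suc n) b \<and> q ^ Suc n dvd b - a" if "good n a" for n a
  proof -
    from that obtain t where t: "poly h a = q ^ Suc n * t" unfolding good_def by (auto simp: dvd_def)
    have "q dvd poly (pderiv h) a - poly (pderiv h) r"
    proof -
      have "a - r dvd poly (pderiv h) a - poly (pderiv h) r" by (rule diff_dvd_poly_diff)
      then show ?thesis using that unfolding good_def by (metis dvd_trans)
    qed
    then have "\<not> q dvd poly (pderiv h) a" using r(2) by (metis dvd_diff_right_iff dvd_diff_commute diff_diff_eq2 add_diff_cancel_left')
    then have "coprime (poly (pderiv h) a) q" using prime_imp_coprime[OF q] by (metis coprime_commute)
    then obtain i where i: "[poly (pderiv h) a * i = 1] (mod q)" using cong_solve_coprime_int by blast
    define b where "b = a + q ^ Suc n * (- t * i)"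
    obtain z where z: "poly h (a + e) = poly h a + e * poly (pderiv h) a + e ^ 2 * z e" for e
    proof -
      have "\<exists>z. poly h (a + e) = poly h a + e * poly (pderiv h) a + e ^ 2 * z" for e
      proof (induction h)
        case (pCons c h)
        then obtain z where z: "poly h (a + e) = poly h a + e * poly (pderiv h) a + e ^ 2 * z" by blast
        show ?case
          by (intro exI[of _ "poly (pderiv h) a + (a + e) * z"])
             (simp add: z pderiv_pCons algebra_simps power2_eq_square)
      qed simp
      then show ?thesis using that by metis
    qed
    have "q dvd 1 - i * poly (pderiv h) a"
      using i by (simp add: cong_iff_dvd_diff dvd_diff_commute mult.commute)
    then obtain w where w: "1 - i * poly (pderiv h) a = q * w" by (auto simp: dvd_def)
    have "poly h b = q ^ Suc n * t * (1 - i * poly (pderiv h) a) + (q ^ Suc n) ^ 2 * ((t * i) ^ 2 * z (q ^ Suc n * (- t * i)))"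
      unfolding b_def z t by (simp add: algebra_simps power_mult_distrib)
    also have "\<dots> = q ^ Suc (Suc n) * (t * w + q ^ n * ((t * i) ^ 2 * z (q ^ Suc n * (- t * i))))"
      unfolding w by (simp add: algebra_simps power2_eq_square)
    finally have "q ^ Suc (Suc n) dvd poly h b" by (rule dvdI)
    moreover have "q dvd b - r"
    proof -
      have "b - r = (a - r) + q * (q ^ n * (- t * i))" unfolding b_def by simp
      then show ?thesis using that unfolding good_def by (metis dvd_add dvd_triv_left)
    qed
    ultimately show ?thesis unfolding good_def b_def by (intro exI[of _ "a + q ^ Suc n * (- t * i)"]) auto
  qed
  have "good 0 r" unfolding good_def using r(1) by simp
  then obtain x where x: "\<And>n. good n (x n)" "\<And>n. q ^ Suc n dvd x (Suc n) - x n"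
    using dependent_nat_choice[of good "\<lambda>n a b. q ^ Suc n dvd b - a"] step by metis
  have "q ^ n dvd q ^ Suc n" for n by simp
  then show ?thesis using x unfolding good_def by (metis dvd_trans)
qed

text \<open>Roots modulo \<open>q\<close> are simple: at a common root of \<open>f\<close> and its
  derivative the identity would give \<open>q dvd R\<close>.\<close>

lemma bezout_not_dvd:
  fixes f u v :: "int poly"
  assumes "u * f + v * pderiv f = [:R:]" "\<not> q dvd R" "q dvd poly f r"
  shows "\<not> q dvd poly (pderiv f) r"
proof
  assume "q dvd poly (pderiv f) r"
  then have "q dvd poly (u * f + v * pderiv f) r" using assms(3) by simp
  then show False using assms(1,2) by simp
qed

lemma twist_padic_point_of_root:
  fixes f u v :: "int poly"
  assumes l: "prime l" and bezout: "u * f + v * pderiv f = [:R:]" "\<not> int l dvd R"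
    and root: "int l dvd poly f r" and d: "d \<noteq> 0"
  shows "twist_has_nontrivial_point (padic_field l) f d"
proof -
  \<comment> \<open>The point has \<open>y = l\<close>. The value \<open>d l^2\<close> vanishes
    modulo \<open>l\<close>, so a root of \<open>f\<close> modulo \<open>l\<close> is also one of
    \<open>f - c\<close>, still simple, and lifts to a solution \<open>x\<close>.\<close>
  define c where "c = d * int l ^ 2"
  have pl: "prime (int l)" using l by simp
  have "int l dvd poly (f - [:c:]) r" unfolding c_def using root by simp
  moreover have "\<not> int l dvd poly (pderiv (f - [:c:])) r"
    using bezout_not_dvd[OF bezout root] by (simp add: pderiv_diff pderiv_pCons)
  ultimately obtain x where "\<And>n. int l ^ n dvd x (Suc n) - x n" "\<And>n. int l ^ n dvd poly (f - [:c:]) (x n)"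
    using hensel_sequence[OF pl] by blast
  then show ?thesis
    using d prime_gt_0_nat[OF l]
    by (intro twist_has_nontrivial_point_padicI[OF l, of x "\<lambda>_. int l" f c]) (auto simp: c_def)
qed

lemma twist_padic_point_of_unit:
  fixes f u v :: "int poly"
  assumes l: "prime l" and bezout: "u * f + v * pderiv f = [:R:]" "\<not> int l dvd R"
    and lc: "\<not> int l dvd lead_coeff f" and deg: "degree f > 0"
    and bound: "l > power_residue_bound (degree f)" and d: "\<not> int l dvd d"
  shows "twist_has_nontrivial_point (padic_field l) f d"
proof -
  have pl: "prime (int l)" using l by simp
  have "power_residue_bound (degree f) \<ge> 2" using deg unfolding power_residue_bound_def by simp
  then have l2: "l > 2" using bound by simp
  then have odd: "odd l" using l by (metis prime_odd_nat)
  define e where "e = (l - 1) div 2"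
  have e: "2 * e = l - 1" unfolding e_def using odd by simp
  \<comment> \<open>The case \<open>k = 2\<close> with the constant \<open>- (d ^ e)\<close>: the
    powers \<open>f a ^ e\<close> and \<open>d ^ e\<close> are both 1 or -1 modulo \<open>l\<close>,
    so if they are not opposite they are equal, and \<open>f a * d\<close> is a square modulo
    \<open>l\<close> by Euler's criterion.\<close>
  obtain a where a: "\<not> int l dvd poly f a" "\<not> int l dvd poly f a ^ e - (- (d ^ e))"
    using exists_nonroot_not_power_residue[OF l e _ bezout lc deg bound] by blast
  have sq: "int l dvd b ^ e * b ^ e - 1" if "\<not> int l dvd b" for b
  proof -
    have "b * (b ^ e * b ^ e - 1) = b ^ l - b"
    proof -
      have "l = Suc (e + e)" using e l2 by simp
      then have "b ^ l = b * (b ^ e * b ^ e)" by (simp add: power_add)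
      then show ?thesis by (simp add: right_diff_distrib)
    qed
    then have "int l dvd b * (b ^ e * b ^ e - 1)" using fermat_int[OF l, of b] by simp
    then show ?thesis using that pl prime_dvd_mult_iff by blast
  qed
  define g where "g = poly f a"
  have "int l dvd (g ^ e * g ^ e - 1) - (d ^ e * d ^ e - 1)"
    using sq[OF a(1)] sq[OF d] unfolding g_def by (rule dvd_diff)
  also have "(g ^ e * g ^ e - 1) - (d ^ e * d ^ e - 1) = (g ^ e - (- (d ^ e))) * (g ^ e - d ^ e)"
    by (simp add: algebra_simps)
  finally have "int l dvd g ^ e - d ^ e" using a(2) pl prime_dvd_mult_iff unfolding g_def by blast
  then have "int l dvd (g ^ e - d ^ e) * d ^ e + (d ^ e * d ^ e - 1)" using sq[OF d] by simp
  also have "(g ^ e - d ^ e) * d ^ e + (d ^ e * d ^ e - 1) = (g * d) ^ e - 1"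
    by (simp add: algebra_simps power_mult_distrib)
  finally have "[(g * d) ^ e = 1] (mod int l)" by (simp add: cong_iff_dvd_diff)
  moreover have "[Legendre (g * d) (int l) = (g * d) ^ e] (mod int l)"
    using euler_criterion[OF l l2, of "g * d"] unfolding e_def .
  ultimately have "[Legendre (g * d) (int l) = 1] (mod int l)" by (rule cong_trans[rotated])
  moreover have "\<not> [- 1 = 1] (mod int l)" "\<not> [0 = 1] (mod int l)"
    using l2 zdvd_imp_le[of "int l" 2] by (auto simp: cong_iff_dvd_diff)
  ultimately have "QuadRes (int l) (g * d)" unfolding Legendre_def by (auto split: if_splits)
  then obtain z where z: "int l dvd z ^ 2 - g * d" unfolding QuadRes_def by (auto simp: cong_iff_dvd_diff)
  have "coprime d (int l)" using prime_imp_coprime[OF pl d] by (simp only: coprime_commute)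
  then obtain i where "[d * i = 1] (mod int l)" using cong_solve_coprime_int by blast
  then obtain j where j: "d * i = 1 + int l * j"
    by (metis cong_iff_lin cong_sym)
  define y0 where "y0 = z * i"
  \<comment> \<open>With \<open>x = a\<close> fixed, only \<open>d y^2 = g\<close> has to be lifted;
    \<open>z i\<close> solves it modulo \<open>l\<close> because \<open>i\<close> inverts
    \<open>d\<close> there.\<close>
  define h where "h = [:- g, 0, d:]"
  have hy: "int l dvd poly h y0"
  proof -
    have "poly h y0 = (z ^ 2 - g * d) * (d * i ^ 2) + g * ((d * i) ^ 2 - 1)"
      unfolding h_def y0_def by (simp add: algebra_simps power2_eq_square)
    moreover have "(d * i) ^ 2 - 1 = int l * (j * (2 + int l * j))"
      unfolding j by (simp add: algebra_simps power2_eq_square)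
    ultimately show ?thesis using z by simp
  qed
  have "\<not> int l dvd y0"
  proof
    assume "int l dvd y0"
    then have "int l dvd y0 ^ 2 * d - poly h y0" using hy by (intro dvd_diff) (auto simp: power2_eq_square)
    then show False using a(1) unfolding h_def g_def by (simp add: algebra_simps power2_eq_square)
  qed
  moreover have "\<not> int l dvd 2" using l2 zdvd_imp_le[of "int l" 2] by auto
  ultimately have "\<not> int l dvd 2 * d * y0" using d pl prime_dvd_mult_iff by blast
  moreover have "poly (pderiv h) y0 = 2 * d * y0" unfolding h_def by (simp add: pderiv_pCons)
  ultimately obtain y where y: "\<And>n. int l ^ n dvd y (Suc n) - y n" "\<And>n. int l ^ n dvd poly h (y n)"
    using hensel_sequence[OF pl hy] by auto
  have "int l ^ n dvd d * y n ^ 2 - g" for n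
    using y(2)[of n] unfolding h_def by (simp add: algebra_simps power2_eq_square)
  then show ?thesis
    using y(1) a(1)
    by (intro twist_has_nontrivial_point_padicI[OF l, of "\<lambda>_. a" y f g]) (auto simp: g_def)
qed

lemma twist_padic_point_of_value:
  assumes l: "prime l" and D: "[D = 1] (mod (4 * int l))" and f: "poly f x = s * t ^ 2" "poly f x \<noteq> 0"
  shows "twist_has_nontrivial_point (padic_field l) f (s * D)"
proof -
  have pl: "prime (int l)" using l by simp
  obtain j where j: "D = 1 + 4 * int l * j" using D by (metis cong_iff_lin cong_sym)
  \<comment> \<open>\<open>4 h(w) = D (1 + 2 w)^2 - 1\<close>, so a root \<open>w\<close> makes
    \<open>1 + 2 w\<close> an inverse square root of \<open>D\<close>. As \<open>D\<close> is 1
    modulo \<open>4 l\<close>, \<open>w = 0\<close> is a root modulo \<open>l\<close> with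
    derivative \<open>D\<close>, a unit; completing the square in this way also covers
    \<open>l = 2\<close>.\<close>
  define h where "h = [:int l * j, D, D:]"
  have "\<not> int l dvd D"
  proof
    assume "int l dvd D"
    then have "int l dvd D - int l * (4 * j)" by (intro dvd_diff) auto
    then have "int l dvd 1" unfolding j by simp
    then show False using pl not_prime_unit by blast
  qed
  then obtain w where w: "\<And>n. int l ^ n dvd w (Suc n) - w n" "\<And>n. int l ^ n dvd poly h (w n)"
    using hensel_sequence[OF pl, of h 0] by (auto simp: h_def pderiv_pCons)
  show ?thesis
  proof (rule twist_has_nontrivial_point_padicI[OF l, of "\<lambda>_. x" "\<lambda>n. t * (1 + 2 * w n)" f "poly f x"])
    show "int l ^ n dvd t * (1 + 2 * w (Suc n)) - t * (1 + 2 * w n)" for n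
    proof -
      have "t * (1 + 2 * w (Suc n)) - t * (1 + 2 * w n) = 2 * t * (w (Suc n) - w n)" by (simp add: algebra_simps)
      then show ?thesis using w(1) by simp
    qed
    show "int l ^ n dvd s * D * (t * (1 + 2 * w n))\<^sup>2 - poly f x" for n
    proof -
      have "s * D * (t * (1 + 2 * w n))\<^sup>2 - poly f x = poly f x * 4 * poly h (w n) + poly f x * (D - (1 + 4 * int l * j))"
        unfolding h_def f(1) by (simp add: algebra_simps power2_eq_square)
      also have "\<dots> = poly h (w n) * (poly f x * 4)" unfolding j by simp
      finally show ?thesis using w(2) by simp
    qed
  qed (use f in auto)
qed

section \<open>The real place\<close>

lemma ring_of_type_algebra_simps:
  "carrier (ring_of_type_algebra :: 'a::comm_ring_1 ring) = UNIV"
  "\<zero>\<^bsub>(ring_of_type_algebra :: 'a ring)\<^esub> = 0" "\<one>\<^bsub>(ring_of_type_algebra :: 'a ring)\<^esub> = 1"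
  "x \<oplus>\<^bsub>(ring_of_type_algebra :: 'a ring)\<^esub> y = x + y"
  "x \<otimes>\<^bsub>(ring_of_type_algebra :: 'a ring)\<^esub> y = x * y"
  by (simp_all add: ring_of_type_algebra_def)

lemma finsum_ring_of_type_algebra:
  "finite A \<Longrightarrow> (\<Oplus>\<^bsub>(ring_of_type_algebra :: 'a::comm_ring_1 ring)\<^esub>i\<in>A. g i) = sum g A"
proof (induction A rule: finite_induct)
  interpret K: cring "ring_of_type_algebra :: 'a ring" by (rule cring_from_type_algebra)
  {
    case empty
    show ?case by (simp add: ring_of_type_algebra_simps)
  next
    case (insert a A)
    then show ?case
      by (subst K.finsum_insert) (auto simp: ring_of_type_algebra_simps)
  }
qed

lemma nat_pow_ring_of_type_algebra:
  "x [^]\<^bsub>(ring_of_type_algebra :: 'a::comm_ring_1 ring)\<^esub> (k::nat) = x ^ k"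
  by (induction k) (simp_all add: ring_of_type_algebra_simps mult.commute)

lemma add_pow_ring_of_type_algebra:
  "add_pow (ring_of_type_algebra :: 'a::comm_ring_1 ring) (k::int) x = of_int k * x"
proof -
  let ?K = "ring_of_type_algebra :: 'a ring"
  interpret K: cring ?K by (rule cring_from_type_algebra)
  have nat: "add_pow ?K (j::nat) x = of_nat j * x" for j
    by (induction j) (simp_all add: K.add.nat_pow_Suc ring_of_type_algebra_simps algebra_simps)
  have inv: "\<ominus>\<^bsub>?K\<^esub> y = - y" for y
    by (rule K.minus_equality) (simp_all add: ring_of_type_algebra_simps)
  show ?thesis
  proof (cases "k \<ge> 0")
    case True
    then show ?thesis using nat[of "nat k"] by (simp add: add_pow_int_ge of_nat_nat)
  next
    case False
    then show ?thesis using nat[of "nat (- k)"] by (simp add: add_pow_int_lt inv of_nat_nat)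
  qed
qed

lemma twist_real_point_of_value:
  assumes D: "D > 0" and f: "poly f x = s * t ^ 2" "poly f x \<noteq> 0"
  shows "twist_has_nontrivial_point (ring_of_type_algebra :: real ring) f (s * D)"
proof -
  let ?K = "ring_of_type_algebra :: real ring"
  have ev: "eval_int_poly ?K f (of_int x) = of_int (poly f x)"
  proof -
    have "eval_int_poly ?K f (of_int x) = (\<Sum>i\<le>degree f. of_int (coeff f i) * of_int x ^ i)"
      unfolding eval_int_poly_def
      by (simp add: finsum_ring_of_type_algebra nat_pow_ring_of_type_algebra add_pow_ring_of_type_algebra)
    then show ?thesis by (simp add: poly_altdef)
  qed
  have "add_pow ?K (s * D) ((real_of_int t / sqrt (real_of_int D)) [^]\<^bsub>?K\<^esub> (2::nat)) = real_of_int (poly f x)"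
    unfolding nat_pow_ring_of_type_algebra add_pow_ring_of_type_algebra f(1)
    using D by (simp add: power_divide)
  moreover have "carrier ?K = UNIV" "\<zero>\<^bsub>?K\<^esub> = 0" by (simp_all add: ring_of_type_algebra_simps)
  ultimately show ?thesis
    unfolding twist_has_nontrivial_point_def using ev f(2) by (metis UNIV_I of_int_eq_0_iff)
qed

section \<open>An explicit bound for the bad primes\<close>

lemma coeff_sum_monom:
  "coeff (\<Sum>j<k. monom (c j) j) i = (if i < k then c i else 0)"
  by (simp add: coeff_sum if_distrib cong: if_cong)

lemma degree_eq_card_roots_complex:
  fixes p :: "complex poly"
  assumes "rsquarefree p"
  shows "card {z. poly p z = 0} = degree p"
proof -
  have p0: "p \<noteq> 0" using assms by (simp add: rsquarefree_def)
  have "p = smult (lead_coeff p) (\<Prod>z | poly p z = 0. [:- z, 1:])"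
    using complex_poly_decompose_rsquarefree[OF assms] by simp
  then have "degree p = degree (\<Prod>z | poly p z = 0. [:- z, 1:])"
    using p0 by (metis degree_smult_eq leading_coeff_0_iff)
  also have "\<dots> = (\<Sum>z | poly p z = 0. degree [:- z, 1:])"
    by (rule degree_prod_eq_sum_degree) auto
  finally show ?thesis by simp
qed

lemma abs_det_le:
  fixes A :: "int mat"
  assumes A: "A \<in> carrier_mat n n" and b: "\<And>i j. i < n \<Longrightarrow> j < n \<Longrightarrow> \<bar>A $$ (i, j)\<bar> \<le> b"
  shows "\<bar>det A\<bar> \<le> fact n * b ^ n"
proof -
  have "\<bar>det A\<bar> \<le> (\<Sum>p | p permutes {0..<n}. \<bar>signof p * (\<Prod>i = 0..<n. A $$ (i, p i))\<bar>)"
    unfolding det_def'[OF A] by (rule sum_abs)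
  also have "\<dots> \<le> (\<Sum>p | p permutes {0..<n}. b ^ n)"
  proof (rule sum_mono)
    fix p assume "p \<in> {p. p permutes {0..<n}}"
    then have p: "p permutes {0..<n}" by simp
    have "\<bar>signof p * (\<Prod>i = 0..<n. A $$ (i, p i))\<bar> = (\<Prod>i = 0..<n. \<bar>A $$ (i, p i)\<bar>)"
      by (simp add: abs_mult abs_prod sign_def)
    also have "\<dots> \<le> (\<Prod>i = 0..<n. b)"
    proof (rule prod_mono)
      fix i assume "i \<in> {0..<n}"
      then have "i < n" "p i < n" using permutes_in_image[OF p, of i] by auto
      then show "0 \<le> \<bar>A $$ (i, p i)\<bar> \<and> \<bar>A $$ (i, p i)\<bar> \<le> b" using b by simp
    qed
    finally show "\<bar>signof p * (\<Prod>i = 0..<n. A $$ (i, p i))\<bar> \<le> b ^ n" by simp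
  qed
  also have "\<dots> = fact n * b ^ n" by (simp add: card_permutations)
  finally show ?thesis .
qed

text \<open>The kernel of the Sylvester matrix is trivial: at a complex root of \<open>f\<close> the
  derivative does not vanish, so \<open>W\<close> does, and \<open>W\<close> cannot have
  \<open>degree f\<close> distinct roots.\<close>

lemma sylvester_combination_eq_0:
  fixes f U W :: "int poly"
  assumes sep: "rsquarefree (map_poly complex_of_int f)"
    and eq: "U * f + W * pderiv f = 0" and deg: "degree W < degree f"
  shows "W = 0 \<and> U = 0"
proof -
  let ?h = "map_poly complex_of_int"
  have hadd: "?h (p + q) = ?h p + ?h q" for p q by (rule poly_eqI) (simp add: coeff_map_poly)
  have hmult: "?h (p * q) = ?h p * ?h q" for p q by (rule poly_eqI) (simp add: coeff_map_poly coeff_mult)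
  have der: "?h (pderiv f) = pderiv (?h f)" by (rule poly_eqI) (simp add: coeff_pderiv coeff_map_poly)
  have hom: "?h U * ?h f + ?h W * pderiv (?h f) = 0"
    using arg_cong[OF eq, of ?h] by (simp add: hadd hmult der)
  have "?h W = 0"
  proof (rule ccontr)
    assume nz: "?h W \<noteq> 0"
    have "{z. poly (?h f) z = 0} \<subseteq> {z. poly (?h W) z = 0}"
    proof
      fix z assume z: "z \<in> {z. poly (?h f) z = 0}"
      have "poly (?h U * ?h f + ?h W * pderiv (?h f)) z = 0" using hom by simp
      then have "poly (?h W) z * poly (pderiv (?h f)) z = 0" using z by simp
      then show "z \<in> {z. poly (?h W) z = 0}" using sep z unfolding rsquarefree_roots by auto
    qed
    then have "card {z. poly (?h f) z = 0} \<le> card {z. poly (?h W) z = 0}"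
      using poly_roots_finite[OF nz] by (intro card_mono)
    also have "\<dots> \<le> degree (?h W)" using nz by (rule card_poly_roots_bound)
    finally show False
      using deg degree_eq_card_roots_complex[OF sep] by (simp add: degree_map_poly)
  qed
  then have W: "W = 0" by (simp add: map_poly_eq_0_iff)
  moreover have "f \<noteq> 0" using sep by (auto simp: rsquarefree_def)
  ultimately show ?thesis using eq by simp
qed

text \<open>The constant is the resultant of \<open>f\<close> and its derivative, computed as a Sylvester determinant.\<close>

lemma bounded_bezout:
  fixes f :: "int poly"
  assumes sep: "rsquarefree (map_poly complex_of_int f)" and deg: "degree f > 0"
    and H: "\<And>i. \<bar>coeff f i\<bar> \<le> H"
  shows "\<exists>u v R. u * f + v * pderiv f = [:R:] \<and> R \<noteq> 0 \<and>
    \<bar>R\<bar> \<le> fact (2 * degree f - 1) * (int (degree f) * H) ^ (2 * degree f - 1)"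
proof -
  define n where "n = degree f"
  define N where "N = 2 * n - 1"
  \<comment> \<open>The columns are the coefficients of \<open>x^j f\<close> for
    \<open>j < n - 1\<close> and of \<open>x^j f'\<close> for \<open>j < n\<close>:
    \<open>2 n - 1\<close> polynomials, all of degree below \<open>2 n - 1\<close>.\<close>
  define g where "g j = (if j < n - 1 then monom 1 j * f else monom 1 (j - (n - 1)) * pderiv f)" for j
  define A where "A = mat N N (\<lambda>(i, j). coeff (g j) i)"
  have n: "n \<ge> 1" using deg unfolding n_def by simp
  have A: "A \<in> carrier_mat N N" unfolding A_def by simp
  have H0: "H \<ge> 0" using H[of 0] by simp
  have dg: "degree (g j) < N" if "j < N" for j
  proof -
    have "degree (monom (1::int) k * h) \<le> k + degree h" for k h
      using degree_mult_le[of "monom (1::int) k" h] by (simp add: degree_monom_eq)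
    from this[of j f] this[of "j - (n - 1)" "pderiv f"] show ?thesis
      using that n unfolding g_def N_def n_def by (auto simp: degree_pderiv)
  qed
  \<comment> \<open>One vector read in two ways: as cofactors of \<open>f\<close> and its
    derivative, and, by \<open>mult\<close> below, as an argument of the matrix
    \<open>A\<close>.\<close>
  define comb where "comb x = (\<Sum>j<n - 1. monom (x j) j) * f + (\<Sum>j<n. monom (x (n - 1 + j)) j) * pderiv f" for x
  have comb: "comb x = (\<Sum>j<N. smult (x j) (g j))" for x
  proof -
    have N': "N = n + (n - 1)" using n unfolding N_def by simp
    have "(\<Sum>j<N. smult (x j) (g j)) =
        (\<Sum>j<n - 1. smult (x j) (g j)) + (\<Sum>j = 0 + (n - 1)..<n + (n - 1). smult (x j) (g j))"
      unfolding N' lessThan_atLeast0 by (simp add: sum.atLeastLessThan_concat)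
    also have "(\<Sum>j = 0 + (n - 1)..<n + (n - 1). smult (x j) (g j)) =
        (\<Sum>j<n. smult (x (n - 1 + j)) (g (n - 1 + j)))"
      unfolding sum.shift_bounds_nat_ivl lessThan_atLeast0 by (simp only: add.commute)
    also have "(\<Sum>j<n - 1. smult (x j) (g j)) = (\<Sum>j<n - 1. monom (x j) j) * f"
      unfolding sum_distrib_right g_def by (intro sum.cong) (auto simp: smult_monom simp flip: mult_smult_left)
    also have "(\<Sum>j<n. smult (x (n - 1 + j)) (g (n - 1 + j))) = (\<Sum>j<n. monom (x (n - 1 + j)) j) * pderiv f"
      unfolding sum_distrib_right g_def by (intro sum.cong) (auto simp: smult_monom simp flip: mult_smult_left)
    finally show ?thesis unfolding comb_def by simp
  qed
  have mult: "coeff (comb (\<lambda>j. w $ j)) i = (A *\<^sub>v w) $ i" if "w \<in> carrier_vec N" "i < N" for w i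
    using that unfolding comb A_def
    by (simp add: coeff_sum scalar_prod_def atLeast0LessThan mult.commute)
  have dcomb: "coeff (comb x) i = 0" if "i \<ge> N" for x i
  proof -
    have "coeff (g j) i = 0" if "j < N" for j
      using dg[OF that] \<open>i \<ge> N\<close> by (intro coeff_eq_0) simp
    then show ?thesis unfolding comb by (simp add: coeff_sum)
  qed
  have det: "det A \<noteq> 0"
  proof
    assume "det A = 0"
    then obtain w where w: "w \<in> carrier_vec N" "w \<noteq> 0\<^sub>v N" "A *\<^sub>v w = 0\<^sub>v N"
      using det_0_iff_vec_prod_zero[OF A] by blast
    have "comb (\<lambda>j. w $ j) = 0"
    proof (rule poly_eqI)
      fix i show "coeff (comb (\<lambda>j. w $ j)) i = coeff 0 i"
        using mult[OF w(1), of i] dcomb[of i] w(3) by (cases "i < N") auto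
    qed
    moreover have "degree (\<Sum>j<n. monom (w $ (n - 1 + j)) j) < degree f"
      using n by (intro degree_lessI) (auto simp: coeff_sum_monom n_def)
    ultimately have "(\<Sum>j<n. monom (w $ (n - 1 + j)) j) = 0 \<and> (\<Sum>j<n - 1. monom (w $ j) j) = 0"
      unfolding comb_def by (intro sylvester_combination_eq_0[OF sep])
    then have z: "\<And>i. i < n \<Longrightarrow> w $ (n - 1 + i) = 0" "\<And>i. i < n - 1 \<Longrightarrow> w $ i = 0"
      by (metis coeff_0 coeff_sum_monom)+
    have "w $ i = 0" if "i < N" for i
      using z(1)[of "i - (n - 1)"] z(2)[of i] that n unfolding N_def by (cases "i < n - 1") auto
    then have "w = 0\<^sub>v N" using w(1) by (intro eq_vecI) auto
    with w(2) show False by simp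
  qed
  \<comment> \<open>The first column of the adjugate is mapped by \<open>A\<close> to
    \<open>det A\<close> times the first unit vector, which encodes the constant polynomial
    \<open>det A\<close>.\<close>
  define w where "w = col (adj_mat A) 0"
  have N0: "0 < N" using n unfolding N_def by simp
  have adj: "adj_mat A \<in> carrier_mat N N" "A * adj_mat A = det A \<cdot>\<^sub>m 1\<^sub>m N" using adj_mat[OF A] by auto
  have w: "w \<in> carrier_vec N" unfolding w_def using adj(1) by (metis carrier_matD(1) col_dim carrier_vec_dim_vec)
  have Aw: "A *\<^sub>v w = col (det A \<cdot>\<^sub>m 1\<^sub>m N) 0"
    unfolding w_def using N0 adj(1) A adj(2) by (metis col_mult2)
  have "comb (\<lambda>j. w $ j) = [:det A:]"
  proof (rule poly_eqI)
    fix i show "coeff (comb (\<lambda>j. w $ j)) i = coeff [:det A:] i"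
      using mult[OF w, of i] dcomb[of i "\<lambda>j. w $ j"] N0
      by (cases "i < N") (auto simp: Aw coeff_pCons split: nat.split)
  qed
  moreover have "\<bar>det A\<bar> \<le> fact N * (int n * H) ^ N"
  proof (rule abs_det_le[OF A])
    fix i j assume ij: "i < N" "j < N"
    have le: "\<bar>coeff f k\<bar> \<le> int n * H" for k
      using H[of k] H0 n mult_right_mono[of 1 "int n" H] by linarith
    have "\<bar>coeff (pderiv f) k\<bar> \<le> int n * H" for k
    proof (cases "k < n")
      case True
      have "\<bar>coeff (pderiv f) k\<bar> = int (Suc k) * \<bar>coeff f (Suc k)\<bar>"
        by (simp add: coeff_pderiv abs_mult)
      also have "\<dots> \<le> int n * H" using True H H0 by (intro mult_mono) auto
      finally show ?thesis .
    next
      case False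
      then have "coeff f (Suc k) = 0" by (intro coeff_eq_0) (simp add: n_def)
      then show ?thesis using H0 by (simp add: coeff_pderiv)
    qed
    then show "\<bar>A $$ (i, j)\<bar> \<le> int n * H"
      using ij le H0 unfolding A_def g_def by (auto simp: coeff_monom_mult)
  qed
  ultimately show ?thesis using det unfolding comb_def N_def n_def by blast
qed

text \<open>\<^const>\<open>general_recursive\<close> up to the values on lists of the wrong length, which makes the
  closure properties independent of the values of partial list functions.\<close>

definition recursive_on :: "nat \<Rightarrow> (nat list \<Rightarrow> nat) \<Rightarrow> bool" where
  "recursive_on k F \<longleftrightarrow> (\<exists>G. general_recursive k G \<and> (\<forall>xs. length xs = k \<longrightarrow> F xs = G xs))"

lemma recursive_on_proj: "i < k \<Longrightarrow> recursive_on k (\<lambda>xs. xs ! i)"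
  unfolding recursive_on_def using general_recursive.proj by blast

lemma recursive_on_zero: "recursive_on k (\<lambda>xs. 0)"
  unfolding recursive_on_def using general_recursive.zero by blast

lemma recursive_on_comp1:
  assumes "recursive_on 1 F" "recursive_on k A"
  shows "recursive_on k (\<lambda>xs. F [A xs])"
proof -
  obtain F' A' where F: "general_recursive 1 F'" "\<And>xs. length xs = 1 \<Longrightarrow> F xs = F' xs"
    and A: "general_recursive k A'" "\<And>xs. length xs = k \<Longrightarrow> A xs = A' xs"
    using assms unfolding recursive_on_def by auto
  have "general_recursive k (\<lambda>xs. F' (map (\<lambda>G. G xs) [A']))"
    using F(1) A(1) by (intro general_recursive.comp) auto
  then show ?thesis unfolding recursive_on_def using F(2) A(2)
    by (intro exI[of _ "\<lambda>xs. F' (map (\<lambda>G. G xs) [A'])"]) auto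
qed

lemma recursive_on_comp2:
  assumes "recursive_on 2 F" "recursive_on k A" "recursive_on k B"
  shows "recursive_on k (\<lambda>xs. F [A xs, B xs])"
proof -
  obtain F' A' B' where F: "general_recursive 2 F'" "\<And>xs. length xs = 2 \<Longrightarrow> F xs = F' xs"
    and A: "general_recursive k A'" "\<And>xs. length xs = k \<Longrightarrow> A xs = A' xs"
    and B: "general_recursive k B'" "\<And>xs. length xs = k \<Longrightarrow> B xs = B' xs"
    using assms unfolding recursive_on_def by auto
  have "general_recursive k (\<lambda>xs. F' (map (\<lambda>G. G xs) [A', B']))"
    using F(1) A(1) B(1) by (intro general_recursive.comp) (auto simp: numeral_2_eq_2)
  then show ?thesis unfolding recursive_on_def using F(2) A(2) B(2)
    by (intro exI[of _ "\<lambda>xs. F' (map (\<lambda>G. G xs) [A', B'])"]) auto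
qed

lemma recursive_on_Suc: "recursive_on k A \<Longrightarrow> recursive_on k (\<lambda>xs. Suc (A xs))"
  using recursive_on_comp1[of "\<lambda>xs. Suc (xs ! 0)" k A] general_recursive.succ
  unfolding recursive_on_def[of 1] by auto

lemma recursive_on_const: "recursive_on k (\<lambda>xs. c)"
  by (induction c) (auto intro: recursive_on_zero recursive_on_Suc)

lemma recursive_on_rec:
  assumes "recursive_on 1 F" "recursive_on 3 G"
  shows "recursive_on 2 (\<lambda>xs. rec_nat (F [xs ! 1]) (\<lambda>n r. G [n, r, xs ! 1]) (xs ! 0))"
proof -
  obtain F' G' where F: "general_recursive 1 F'" "\<And>xs. length xs = 1 \<Longrightarrow> F xs = F' xs"
    and G: "general_recursive 3 G'" "\<And>xs. length xs = 3 \<Longrightarrow> G xs = G' xs"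
    using assms unfolding recursive_on_def by auto
  have "general_recursive (Suc 1) (\<lambda>xs. rec_nat (F' (tl xs)) (\<lambda>n r. G' (n # r # tl xs)) (hd xs))"
    using F(1) G(1) by (intro general_recursive.prim_rec) (auto simp: numeral_3_eq_3)
  moreover have "rec_nat (F [xs ! 1]) (\<lambda>n r. G [n, r, xs ! 1]) (xs ! 0) =
      rec_nat (F' (tl xs)) (\<lambda>n r. G' (n # r # tl xs)) (hd xs)" if len: "length xs = 2" for xs
  proof -
    obtain a ys where ys: "xs = a # ys" using len by (cases xs) auto
    moreover obtain b where "ys = [b]" using len ys by (cases ys) auto
    ultimately have "xs = [a, b]" by simp
    then show ?thesis using F(2) G(2) by simp
  qed
  ultimately show ?thesis unfolding recursive_on_def by (auto simp: numeral_2_eq_2)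
qed

lemma recursive_on_add:
  assumes "recursive_on k A" "recursive_on k B"
  shows "recursive_on k (\<lambda>xs. A xs + B xs)"
proof -
  have "recursive_on 2 (\<lambda>xs. rec_nat ([xs ! 1] ! 0) (\<lambda>n r. Suc ([n, r, xs ! 1] ! 1)) (xs ! 0))"
    by (rule recursive_on_rec[where F = "\<lambda>xs. xs ! 0" and G = "\<lambda>xs. Suc (xs ! 1)"])
       (intro recursive_on_Suc recursive_on_proj; simp)+
  moreover have "rec_nat b (\<lambda>n r. Suc r) a = a + b" for a b :: nat by (induction a) auto
  ultimately have "recursive_on 2 (\<lambda>xs. xs ! 0 + xs ! 1)" by simp
  from recursive_on_comp2[OF this assms] show ?thesis by simp
qed

lemma recursive_on_mult:
  assumes "recursive_on k A" "recursive_on k B"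
  shows "recursive_on k (\<lambda>xs. A xs * B xs)"
proof -
  have "recursive_on 2 (\<lambda>xs. rec_nat 0 (\<lambda>n r. [n, r, xs ! 1] ! 1 + [n, r, xs ! 1] ! 2) (xs ! 0))"
    by (rule recursive_on_rec[where F = "\<lambda>_. 0" and G = "\<lambda>xs. xs ! 1 + xs ! 2"])
       (intro recursive_on_zero recursive_on_add recursive_on_proj; simp)+
  moreover have "rec_nat 0 (\<lambda>n r. r + b) a = a * b" for a b :: nat by (induction a) auto
  ultimately have "recursive_on 2 (\<lambda>xs. xs ! 0 * xs ! 1)" by simp
  from recursive_on_comp2[OF this assms] show ?thesis by simp
qed

lemma recursive_on_power:
  assumes "recursive_on k A" "recursive_on k B"
  shows "recursive_on k (\<lambda>xs. A xs ^ B xs)"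
proof -
  have "recursive_on 2 (\<lambda>xs. rec_nat 1 (\<lambda>n r. [n, r, xs ! 1] ! 1 * [n, r, xs ! 1] ! 2) (xs ! 0))"
    by (rule recursive_on_rec[where F = "\<lambda>_. 1" and G = "\<lambda>xs. xs ! 1 * xs ! 2"])
       (intro recursive_on_const recursive_on_mult recursive_on_proj; simp)+
  moreover have "rec_nat 1 (\<lambda>n r. r * b) a = b ^ a" for a b :: nat by (induction a) auto
  ultimately have "recursive_on 2 (\<lambda>xs. (xs ! 1) ^ (xs ! 0))" by simp
  \<comment> \<open>The recursion runs over the exponent, which must therefore come first.\<close>
  from recursive_on_comp2[OF this assms(2,1)] show ?thesis by simp
qed

text \<open>\<open>E\<close> stands for the code of \<open>f\<close>, which exceeds the degree and
  bounds the coefficients. Base and exponent are generous, so that a single closed expression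
  dominates \<open>power_residue_bound\<close>, the leading coefficient and the Sylvester
  determinant.\<close>

definition bad_prime_bound :: "nat \<Rightarrow> nat" where
  "bad_prime_bound E = (10 * E + 10) ^ (10 * E + 10)"

lemma effectively_computable_bad_prime_bound:
  "effectively_computable (\<lambda>f. Suc (bad_prime_bound (int_poly_encode f)))"
proof -
  have "recursive_on 1 (\<lambda>xs. Suc ((10 * (xs ! 0) + 10) ^ (10 * (xs ! 0) + 10)))"
    by (intro recursive_on_Suc recursive_on_power recursive_on_add recursive_on_mult
        recursive_on_const recursive_on_proj) auto
  then obtain G where "general_recursive 1 G"
    "\<And>xs. length xs = 1 \<Longrightarrow> Suc ((10 * (xs ! 0) + 10) ^ (10 * (xs ! 0) + 10)) = G xs"
    unfolding recursive_on_def by auto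
  then show ?thesis unfolding effectively_computable_def bad_prime_bound_def
    by (intro exI[of _ G]) (metis One_nat_def length_Cons list.size(3) nth_Cons_0)
qed

section \<open>The code of a polynomial bounds its degree and coefficients\<close>

lemma mem_le_list_encode: "x \<in> set xs \<Longrightarrow> x < list_encode xs"
proof (induction xs)
  case (Cons a xs)
  then show ?case
    using le_prod_encode_1[of a "list_encode xs"] le_prod_encode_2[of "list_encode xs" a] by auto
qed simp

lemma length_le_list_encode: "length xs \<le> list_encode xs"
proof (induction xs)
  case (Cons a xs)
  then show ?case using le_prod_encode_2[of "list_encode xs" a] by simp
qed simp

lemma abs_le_int_encode: "\<bar>k\<bar> \<le> int (int_encode k)"
  by (simp add: int_encode_def sum_encode_def)

lemma coeff_le_int_poly_encode: "\<bar>coeff f i\<bar> \<le> int (int_poly_encode f)"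
proof (cases "coeff f i = 0")
  case False
  then have "i \<le> degree f" by (rule le_degree)
  moreover have "f \<noteq> 0" using False by auto
  ultimately have "coeff f i \<in> set (coeffs f)" using coeff_in_coeffs by blast
  then have "int_encode (coeff f i) < int_poly_encode f"
    unfolding int_poly_encode_def by (intro mem_le_list_encode) auto
  then show ?thesis using abs_le_int_encode[of "coeff f i"] by linarith
qed simp

lemma degree_less_int_poly_encode: "f \<noteq> 0 \<Longrightarrow> degree f < int_poly_encode f"
  using length_le_list_encode[of "map int_encode (coeffs f)"]
  by (simp add: int_poly_encode_def length_coeffs_degree)

section \<open>Squarefree twists in residue classes\<close>

text \<open>In a finite group closure under multiplication already gives a subgroup, since inverses
  are powers; the rest is Lagrange's theorem for the units modulo \<open>p\<close>.\<close>

lemma subset_residues_power_card: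
  fixes H :: "int set" and p :: nat
  assumes p: "prime p" and H: "H \<subseteq> {0<..<int p}" "1 \<in> H"
    and mult: "\<And>a b. a \<in> H \<Longrightarrow> b \<in> H \<Longrightarrow> a * b mod int p \<in> H"
  shows "card H dvd p - 1" and "\<And>a. a \<in> H \<Longrightarrow> [a ^ card H = 1] (mod int p)"
proof -
  interpret residues "int p" "residue_ring (int p)"
    using prime_gt_1_nat[OF p] by unfold_locales auto
  define G where "G = units_of (residue_ring (int p))"
  interpret G: Group.group G unfolding G_def by (rule units_group)
  have Geq: "carrier G = {0<..<int p}"
  proof -
    have "coprime x (int p)" if "0 < x" "x < int p" for x
    proof -
      have "\<not> int p dvd x" using that zdvd_not_zless by blast
      then show ?thesis using prime_imp_coprime[of "int p" x] p by (simp add: coprime_commute)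
    qed
    then show ?thesis unfolding G_def units_of_carrier res_units_eq by auto
  qed
  have Gm: "x \<otimes>\<^bsub>G\<^esub> y = x * y mod int p" for x y
    unfolding G_def units_of_mult res_mult_eq ..
  have G1: "\<one>\<^bsub>G\<^esub> = 1" unfolding G_def units_of_one res_one_eq ..
  have pow: "x [^]\<^bsub>G\<^esub> k = x ^ k mod int p" for x and k :: nat
  proof (induction k)
    case 0
    then show ?case using G1 prime_gt_1_nat[OF p] by simp
  next
    case (Suc k)
    then show ?case by (simp add: Gm mod_mult_right_eq mult.commute)
  qed
  have fin: "finite (carrier G)" unfolding Geq by simp
  have powH: "x [^]\<^bsub>G\<^esub> k \<in> H" if "x \<in> H" for x and k :: nat
    using that by (induction k) (simp_all add: G1 H(2) Gm mult)
  have sub: "subgroup H G"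
  proof (rule G.subgroupI)
    fix x assume x: "x \<in> H"
    then have xG: "x \<in> carrier G" using H Geq by auto
    have "Coset.order G > 0" using fin xG by (auto simp: Coset.order_def card_gt_0_iff)
    then have "x [^]\<^bsub>G\<^esub> (Coset.order G - 1) \<otimes>\<^bsub>G\<^esub> x = x [^]\<^bsub>G\<^esub> Coset.order G"
      by (metis G.nat_pow_Suc Suc_diff_1)
    also have "\<dots> = \<one>\<^bsub>G\<^esub>" using G.pow_order_eq_1[OF xG] .
    finally have "inv\<^bsub>G\<^esub> x = x [^]\<^bsub>G\<^esub> (Coset.order G - 1)" using xG by (intro G.inv_equality) auto
    then show "inv\<^bsub>G\<^esub> x \<in> H" using powH[OF x] by simp
  qed (use H Geq Gm mult in auto)
  have "card (rcosets\<^bsub>G\<^esub> H) * card H = Coset.order G" using G.lagrange[OF sub] .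
  then have "card H dvd Coset.order G" by (metis dvd_triv_right)
  moreover have "nat (int p - 1) = p - 1" by simp
  ultimately show "card H dvd p - 1" unfolding Coset.order_def Geq by simp
  fix a assume a: "a \<in> H"
  interpret SG: Group.group "G\<lparr>carrier := H\<rparr>" using sub by (rule G.subgroup_imp_group)
  have "a [^]\<^bsub>G\<lparr>carrier := H\<rparr>\<^esub> card H = \<one>\<^bsub>G\<lparr>carrier := H\<rparr>\<^esub>"
    using SG.pow_order_eq_1[of a] a by (simp add: Coset.order_def)
  then have "a [^]\<^bsub>G\<^esub> card H = 1" by (simp add: G.nat_pow_consistent[symmetric] G1)
  then show "[a ^ card H = 1] (mod int p)"
    unfolding pow cong_def using prime_gt_1_nat[OF p] by simp
qed

text \<open>The class of \<open>h\<close> modulo \<open>M\<close> contains positive squarefree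
  products of primes satisfying \<open>P\<close>, even prime to any prescribed \<open>Y\<close>. The
  freedom in \<open>Y\<close> keeps products of such numbers squarefree, which makes the notion
  multiplicative, and later supplies infinitely many twists.\<close>

definition admissible :: "(int \<Rightarrow> bool) \<Rightarrow> int \<Rightarrow> int \<Rightarrow> bool" where
  "admissible P M h \<longleftrightarrow> coprime h M \<and>
     (\<forall>Y>0. \<exists>D>0. squarefree D \<and> coprime D Y \<and> [D = h] (mod M) \<and>
        (\<forall>q. prime q \<longrightarrow> q dvd D \<longrightarrow> P q))"

lemma admissible_1: "admissible P M 1"
  unfolding admissible_def
  by (auto intro!: exI[of _ 1] dest: not_prime_unit)

lemma admissible_mult:
  assumes "admissible P M h" "admissible P M h'"
  shows "admissible P M (h * h')"
  unfolding admissible_def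
proof (intro conjI allI impI)
  show "coprime (h * h') M" using assms unfolding admissible_def by simp
  fix Y :: int assume Y: "Y > 0"
  obtain D where D: "D > 0" "squarefree D" "coprime D Y" "[D = h] (mod M)"
    "\<And>q. prime q \<Longrightarrow> q dvd D \<Longrightarrow> P q"
    using assms(1) Y unfolding admissible_def by blast
  have "Y * D > 0" using Y D(1) by simp
  then obtain D' where D': "D' > 0" "squarefree D'" "coprime D' (Y * D)" "[D' = h'] (mod M)"
    "\<And>q. prime q \<Longrightarrow> q dvd D' \<Longrightarrow> P q"
    using assms(2) unfolding admissible_def by blast
  show "\<exists>D>0. squarefree D \<and> coprime D Y \<and> [D = h * h'] (mod M) \<and> (\<forall>q. prime q \<longrightarrow> q dvd D \<longrightarrow> P q)"
  proof (intro exI[of _ "D * D'"] conjI allI impI)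
    show "squarefree (D * D')"
      using D(2) D'(2,3) by (intro squarefree_mult_coprime) (auto simp: coprime_commute)
    show "coprime (D * D') Y" using D(3) D'(3) by simp
    show "[D * D' = h * h'] (mod M)" using D(4) D'(4) by (rule cong_mult)
    show "P q" if "prime q" "q dvd D * D'" for q
      using that D(5) D'(5) by (auto simp: prime_dvd_mult_iff)
  qed (use D D' in simp)
qed

lemma admissible_of_prime_divisors:
  assumes "v > 0" "\<And>q. prime q \<Longrightarrow> q dvd v \<Longrightarrow> admissible P M q"
  shows "admissible P M v"
  using assms
proof (induction "nat v" arbitrary: v rule: less_induct)
  case less
  show ?case
  proof (cases "v = 1")
    case True
    then show ?thesis by (simp add: admissible_1)
  next
    case False
    then obtain q where q: "prime q" "q dvd v" using less.prems(1) prime_divisor_exists[of v] by auto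
    then obtain w where w: "v = q * w" by (auto simp: dvd_def)
    have q1: "q > 1" using q(1) prime_gt_1_int by blast
    then have w0: "w > 0" using less.prems(1) w by (simp add: zero_less_mult_iff)
    have "1 * w < q * w" using w0 q1 by (rule mult_strict_right_mono[rotated])
    then have "nat w < nat v" using w w0 by simp
    moreover have "admissible P M r" if "prime r" "r dvd w" for r
      using that less.prems(2)[of r] unfolding w by (metis dvd_mult)
    ultimately have "admissible P M w" using w0 less.hyps by blast
    moreover have "admissible P M q" using less.prems(2) q by blast
    ultimately show ?thesis unfolding w by (intro admissible_mult)
  qed
qed

text \<open>Infinitely many exceptions would have infinitely many members in one class modulo
  \<open>M\<close>. For every \<open>Y\<close> one of these does not divide \<open>Y\<close> and
  represents the class, so the class would be admissible after all.\<close>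

lemma finite_inadmissible_primes:
  assumes M: "M > 0"
  shows "finite {q. prime q \<and> coprime q M \<and> P q \<and> \<not> admissible P M q}" (is "finite ?A")
proof (rule ccontr)
  assume inf: "\<not> finite ?A"
  have "(\<lambda>q. q mod M) ` ?A \<subseteq> {0..<M}" using M by auto
  then have "finite ((\<lambda>q. q mod M) ` ?A)" by (rule finite_subset) simp
  then obtain q0 where q0: "q0 \<in> ?A" "\<not> finite {q \<in> ?A. q mod M = q0 mod M}"
    using pigeonhole_infinite[OF inf] by blast
  have "admissible P M q0" unfolding admissible_def
  proof (intro conjI allI impI)
    fix Y :: int assume Y: "Y > 0"
    have "finite {q. q dvd Y}" using Y by (intro finite_divisors_int) auto
    then obtain q where q: "q \<in> ?A" "q mod M = q0 mod M" "\<not> q dvd Y"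
      using q0(2) rev_finite_subset[of "{q. q dvd Y}" "{q \<in> ?A. q mod M = q0 mod M}"] by blast
    show "\<exists>D>0. squarefree D \<and> coprime D Y \<and> [D = q0] (mod M) \<and> (\<forall>q. prime q \<longrightarrow> q dvd D \<longrightarrow> P q)"
    proof (intro exI[of _ q] conjI allI impI)
      show "coprime q Y" using q prime_imp_coprime by blast
      show "P r" if "prime r" "r dvd q" for r using that q primes_dvd_imp_eq by blast
    qed (use q prime_gt_0_int squarefree_prime in \<open>auto simp: cong_def\<close>)
  qed (use q0 in auto)
  then show False using q0(1) by simp
qed

lemma poly_sign_at_large_ints:
  fixes f :: "int poly"
  assumes "f \<noteq> 0"
  shows "\<exists>A. \<forall>x\<ge>A. poly f x * lead_coeff f > 0"
proof -
  define g where "g = smult (lead_coeff f) f"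
  have lc: "lead_coeff g > 0" using assms zero_less_power2[of "lead_coeff f"] unfolding g_def by (simp add: power2_eq_square)
  then have "lead_coeff (map_poly real_of_int g) > 0" by (simp add: degree_map_poly coeff_map_poly)
  then obtain A where A: "\<And>x. x \<ge> A \<Longrightarrow> poly (map_poly real_of_int g) x \<ge> lead_coeff (map_poly real_of_int g)"
    using poly_pinfty_gt_lc by blast
  have "poly f x * lead_coeff f > 0" if "x \<ge> \<lceil>A\<rceil>" for x
  proof -
    have "real_of_int (poly g x) > 0"
      using A[of "of_int x"] that \<open>lead_coeff (map_poly real_of_int g) > 0\<close>
      by (simp add: ceiling_le_iff poly_map_poly_of_int)
    then have "poly g x > 0" by (simp only: of_int_0_less_iff)
    then show ?thesis unfolding g_def by (simp add: mult.commute)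
  qed
  then show ?thesis by blast
qed

text \<open>The residue \<open>f t / f x0\<close> is realised by the integer
  \<open>v = f a / f x0\<close>, where \<open>a\<close> is congruent to \<open>t\<close> modulo
  \<open>p\<close> and to \<open>x0\<close> modulo \<open>W * f x0\<close>. The second congruence
  makes \<open>v\<close> an integer that is 1 modulo \<open>W\<close>; its prime factors divide
  \<open>f a\<close>, so \<open>f\<close> has a root modulo each of them.\<close>

lemma admissible_value_ratio:
  fixes f :: "int poly" and p :: nat
  assumes p: "prime p" and f0: "f \<noteq> 0"
    and Q: "Q > 0" "\<not> int p dvd Q"
    and x0: "poly f x0 * lead_coeff f > 0" "\<not> int p dvd poly f x0"
    and t: "\<not> int p dvd poly f t"
  shows "\<exists>v. admissible (\<lambda>q. \<exists>a. q dvd poly f a) (Q * int p) v \<and> [v = 1] (mod Q) \<and>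
    [v * poly f x0 = poly f t] (mod int p)"
proof -
  define P where "P = (\<lambda>q. \<exists>a. q dvd poly f a)"
  define M where "M = Q * int p"
  define c where "c = poly f x0"
  have pp: "prime (int p)" using p by simp
  have M: "M > 0" unfolding M_def using Q prime_gt_0_nat[OF p] by simp
  have c0: "c \<noteq> 0" using x0(1) unfolding c_def by auto
  define exceptional where "exceptional = {q. prime q \<and> coprime q M \<and> P q \<and> \<not> admissible P M q}"
  have finX: "finite exceptional" unfolding exceptional_def using M by (rule finite_inadmissible_primes)
  \<comment> \<open>No prime factor of \<open>v = 1 + W j\<close> divides \<open>W\<close>, so
    \<open>W\<close> collects the primes to be avoided: those of \<open>Q\<close> and the
    exceptional ones.\<close>
  define W where "W = Q * \<Prod>exceptional"
  have W: "W > 0" unfolding W_def using Q(1)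
    by (intro mult_pos_pos prod_pos) (auto simp: exceptional_def prime_gt_0_int)
  have "\<not> int p dvd \<Prod>exceptional"
  proof
    assume "int p dvd \<Prod>exceptional"
    then obtain q where q: "q \<in> exceptional" "int p dvd q" using pp finX by (auto simp: prime_dvd_prod_iff)
    then have "q = int p" using primes_dvd_imp_eq[OF pp] by (auto simp: exceptional_def)
    then have "coprime (int p) (Q * int p)" using q(1) by (simp add: exceptional_def M_def)
    then show False using pp by (auto simp: not_prime_unit)
  qed
  then have pW: "\<not> int p dvd W * c" using Q(2) x0(2) pp
    unfolding W_def c_def by (simp add: prime_dvd_mult_iff)
  define B where "B = W * \<bar>c\<bar>"
  have B: "B > 0" unfolding B_def using W c0 by simp
  have "coprime B (int p)"
    using prime_imp_coprime[OF pp pW] unfolding B_def by (simp add: coprime_commute)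
  then obtain i where "[B * i = 1] (mod int p)" using cong_solve_coprime_int by blast
  then have "[B * i * (t - x0) = 1 * (t - x0)] (mod int p)" by (rule cong_mult) simp
  then have i: "int p dvd B * (i * (t - x0)) - (t - x0)" by (simp add: cong_iff_dvd_diff mult.assoc)
  obtain A where A: "\<And>x. x \<ge> A \<Longrightarrow> poly f x * lead_coeff f > 0"
    using poly_sign_at_large_ints[OF f0] by blast
  \<comment> \<open>A multiple of \<open>p B\<close> large enough to push \<open>a\<close> to where
    \<open>f\<close> has the sign of its leading coefficient; as \<open>f x0\<close> has that sign
    too, \<open>v\<close> is positive.\<close>
  define z where "z = \<bar>A - x0 - B * (i * (t - x0))\<bar>"
  define a where "a = x0 + B * (i * (t - x0) + int p * z)"
  have aA: "a \<ge> A"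
  proof -
    have "int p * B \<ge> 1 * 1"
      using B prime_gt_0_nat[OF p] by (intro mult_mono) auto
    then have "1 * z \<le> (int p * B) * z" unfolding z_def by (intro mult_right_mono) auto
    then have "x0 + B * (i * (t - x0)) + z \<le> a" unfolding a_def by (simp add: algebra_simps)
    moreover have "A - x0 - B * (i * (t - x0)) \<le> z" unfolding z_def by (rule abs_ge_self)
    then have "A \<le> x0 + B * (i * (t - x0)) + z" by (simp only: diff_le_eq add_ac)
    ultimately show ?thesis by (rule order_trans[rotated])
  qed
  have at: "int p dvd a - t"
  proof -
    have "a - t = (B * (i * (t - x0)) - (t - x0)) + int p * (B * z)" unfolding a_def by (simp add: algebra_simps)
    then show ?thesis using i dvd_triv_left[of "int p" "B * z"] by (simp only: dvd_add)
  qed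
  have "W * c dvd a - x0"
  proof -
    have "W * c dvd B" unfolding B_def by simp
    then show ?thesis unfolding a_def by simp
  qed
  then have "W * c dvd poly f a - poly f x0" using diff_dvd_poly_diff dvd_trans by blast
  then obtain j where j: "poly f a - poly f x0 = W * c * j" by (auto simp: dvd_def)
  define v where "v = 1 + W * j"
  have fa: "poly f a = v * c" using j unfolding v_def c_def by (simp add: algebra_simps)
  have v0: "v > 0"
  proof -
    have "v * (c * lead_coeff f) > 0" using A[OF aA] unfolding fa by (simp add: mult.assoc)
    then show ?thesis using x0(1) unfolding c_def by (simp add: zero_less_mult_iff)
  qed
  have "int p dvd poly f a - poly f t" using at diff_dvd_poly_diff dvd_trans by blast
  then have ft: "[v * poly f x0 = poly f t] (mod int p)" unfolding fa c_def by (simp add: cong_iff_dvd_diff)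
  have "admissible P M v"
  proof (rule admissible_of_prime_divisors[OF v0])
    fix q :: int assume q: "prime q" "q dvd v"
    have "\<not> q dvd W"
    proof
      assume "q dvd W"
      then have "q dvd v - W * j" using q(2) by simp
      then show False unfolding v_def using q(1) by (simp add: not_prime_unit)
    qed
    then have qQ: "\<not> q dvd Q" and qX: "\<not> q dvd \<Prod>exceptional" unfolding W_def by auto
    have "\<not> q dvd int p"
    proof
      assume "q dvd int p"
      then have "q = int p" using primes_dvd_imp_eq[OF q(1) pp] by simp
      then have "int p dvd poly f t"
        using ft q(2) by (metis cong_dvd_iff dvd_mult2)
      then show False using t by simp
    qed
    then have "\<not> q dvd M" unfolding M_def using qQ q(1) by (simp add: prime_dvd_mult_iff)
    then have "coprime q M" using prime_imp_coprime[OF q(1)] by blast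
    moreover have "P q" unfolding P_def using q(2) fa by (metis dvd_mult2)
    moreover have "q \<notin> exceptional" using qX finX by (auto dest: dvd_prodI)
    ultimately show "admissible P M q" using q(1) unfolding exceptional_def by blast
  qed
  moreover have "[v = 1] (mod Q)" unfolding v_def W_def by (simp add: cong_iff_dvd_diff)
  ultimately show ?thesis using ft unfolding P_def M_def by blast
qed

text \<open>The residues modulo \<open>p\<close> represented by admissible numbers congruent to 1 modulo \<open>Q\<close> form a
  group containing all quotients \<open>f t / f x0\<close>. If its order \<open>e\<close> were a proper divisor of \<open>p - 1\<close>,
  then \<open>f ^ e\<close> would be constant modulo \<open>p\<close> away from the roots of \<open>f\<close>.\<close>

lemma admissible_residues:
  fixes f u v :: "int poly" and p :: nat
  assumes p: "prime p" and bezout: "u * f + v * pderiv f = [:R:]" "\<not> int p dvd R"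
    and lc: "\<not> int p dvd lead_coeff f" and deg: "degree f > 0"
    and bound: "p > power_residue_bound (degree f)"
    and Q: "Q > 0" "\<not> int p dvd Q"
    and x0: "poly f x0 * lead_coeff f > 0" "\<not> int p dvd poly f x0"
    and m: "coprime m (int p)"
  shows "\<exists>h. admissible (\<lambda>q. \<exists>a. q dvd poly f a) (Q * int p) h \<and> [h = 1] (mod Q) \<and> [h = m] (mod int p)"
proof -
  define adm where "adm = admissible (\<lambda>q. \<exists>a. q dvd poly f a) (Q * int p)"
  define H where "H = {h \<in> {0<..<int p}. \<exists>v. adm v \<and> [v = 1] (mod Q) \<and> [v = h] (mod int p)}"
  have pp: "prime (int p)" using p by simp
  have p1: "int p > 1" using prime_gt_1_nat[OF p] by simp
  have res: "x mod int p \<in> {0<..<int p}" if "\<not> int p dvd x" for x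
  proof -
    have "x mod int p \<noteq> 0" using that by (simp add: dvd_eq_mod_eq_0)
    moreover have "0 \<le> x mod int p" "x mod int p < int p" using p1 by simp_all
    ultimately show ?thesis by simp
  qed
  have ndvd: "\<not> int p dvd x" if "adm x" for x
  proof
    assume "int p dvd x"
    moreover have "coprime x (Q * int p)" using that unfolding adm_def admissible_def by blast
    ultimately have "is_unit (int p)" by (meson coprime_common_divisor dvd_triv_right)
    then show False using p1 by simp
  qed
  have HI: "x mod int p \<in> H" if "adm x" "[x = 1] (mod Q)" for x
    using that res[OF ndvd[OF that(1)]] unfolding H_def by (auto simp: cong_def)
  have H1: "1 \<in> H" using HI[of 1] admissible_1 p1 unfolding adm_def by auto
  have Hmult: "a * b mod int p \<in> H" if ab: "a \<in> H" "b \<in> H" for a b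
  proof -
    obtain x y where xy: "adm x" "[x = 1] (mod Q)" "[x = a] (mod int p)"
      "adm y" "[y = 1] (mod Q)" "[y = b] (mod int p)" using ab unfolding H_def by blast
    have "adm (x * y)" using xy admissible_mult unfolding adm_def by blast
    moreover have "[x * y = 1 * 1] (mod Q)" using xy by (intro cong_mult)
    ultimately have "x * y mod int p \<in> H" by (intro HI) auto
    moreover have "[x * y = a * b] (mod int p)" using xy by (intro cong_mult)
    ultimately show ?thesis by (simp add: cong_def)
  qed
  have sub: "H \<subseteq> {0<..<int p}" unfolding H_def by blast
  define e where "e = card H"
  have dvd: "e dvd p - 1" and pow: "\<And>a. a \<in> H \<Longrightarrow> [a ^ e = 1] (mod int p)"
    using subset_residues_power_card[OF p sub H1 Hmult] unfolding e_def by blast+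
  have "H = {0<..<int p}"
  proof (rule ccontr)
    assume "H \<noteq> {0<..<int p}"
    then have "card H < card {0<..<int p}" using sub by (intro psubset_card_mono) auto
    then have lt: "e < p - 1" unfolding e_def by simp
    obtain k where k: "k * e = p - 1" using dvd by (metis dvd_div_mult_self)
    have "k \<noteq> 0" using k lt by (intro notI) simp
    moreover have "k \<noteq> 1" using k lt by (intro notI) simp
    ultimately have k2: "k \<ge> 2" by simp
    \<comment> \<open>Compared with the constant \<open>f x0 ^ e\<close>: the ratio of
      \<open>f t\<close> to \<open>f x0\<close> lies in \<open>H\<close>, so its \<open>e\<close>-th
      power is 1 and the two \<open>e\<close>-th powers must agree.\<close>
    obtain t where t: "\<not> int p dvd poly f t" "\<not> int p dvd poly f t ^ e - poly f x0 ^ e"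
      using exists_nonroot_not_power_residue[OF p k k2 bezout lc deg bound] by blast
    have "f \<noteq> 0" using deg by auto
    from admissible_value_ratio[OF p this Q x0 t(1)]
    obtain w where w: "adm w" "[w = 1] (mod Q)" "[w * poly f x0 = poly f t] (mod int p)"
      unfolding adm_def by blast
    have "[(w mod int p) ^ e = 1] (mod int p)" using pow[OF HI[OF w(1,2)]] .
    then have "[w ^ e = 1] (mod int p)" by (simp add: cong_def power_mod)
    then have "[w ^ e * poly f x0 ^ e = 1 * poly f x0 ^ e] (mod int p)" by (rule cong_mult) simp
    moreover have "[w ^ e * poly f x0 ^ e = poly f t ^ e] (mod int p)"
      using cong_pow[OF w(3), of e] by (simp only: power_mult_distrib)
    ultimately have "[poly f t ^ e = poly f x0 ^ e] (mod int p)"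
      by (metis cong_sym cong_trans mult_1)
    then show False using t(2) by (simp add: cong_iff_dvd_diff)
  qed
  moreover have "\<not> int p dvd m"
  proof
    assume "int p dvd m"
    then have "is_unit (int p)" using m by (metis coprime_common_divisor dvd_refl)
    then show False using p1 by simp
  qed
  ultimately have "m mod int p \<in> H" using res by blast
  then show ?thesis unfolding H_def adm_def by (auto simp: cong_def)
qed

text \<open>To obtain \<open>D > 1\<close> also when \<open>m\<close> is 1 modulo \<open>p\<close>,
  the number is built as a product of representatives of the classes 2 and \<open>m / 2\<close>
  modulo \<open>p\<close>; the first factor cannot be 1. A factor greater than 1 and prime to
  \<open>Y\<close> is what makes the later twist new.\<close>

lemma exists_squarefree_twist:
  fixes f u v :: "int poly" and p :: nat
  assumes p: "prime p" "p > 2" and bezout: "u * f + v * pderiv f = [:R:]" "\<not> int p dvd R"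
    and lc: "\<not> int p dvd lead_coeff f" and deg: "degree f > 0"
    and bound: "p > power_residue_bound (degree f)"
    and Q: "Q > 0" "\<not> int p dvd Q"
    and x0: "poly f x0 * lead_coeff f > 0" "\<not> int p dvd poly f x0"
    and m: "coprime m (int p)" and Y: "Y > 0"
  shows "\<exists>D>1. squarefree D \<and> coprime D Y \<and> [D = 1] (mod Q) \<and> [D = m] (mod int p) \<and>
    (\<forall>q. prime q \<longrightarrow> q dvd D \<longrightarrow> (\<exists>a. q dvd poly f a))"
proof -
  note R = admissible_residues[OF p(1) bezout lc deg bound Q x0]
  have pp: "prime (int p)" using p by simp
  have "\<not> int p dvd 2" using p(2) zdvd_imp_le[of "int p" 2] by auto
  then have c2: "coprime 2 (int p)" using prime_imp_coprime[OF pp] by (metis coprime_commute)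
  then obtain i where i: "[2 * i = 1] (mod int p)" using cong_solve_coprime_int by blast
  then have "coprime (i * m) (int p)"
    using m by (metis coprime_iff_invertible_int coprime_mult_left_iff mult.commute)
  then obtain h' where h': "admissible (\<lambda>q. \<exists>a. q dvd poly f a) (Q * int p) h'"
    "[h' = 1] (mod Q)" "[h' = i * m] (mod int p)" using R by blast
  obtain h where h: "admissible (\<lambda>q. \<exists>a. q dvd poly f a) (Q * int p) h"
    "[h = 1] (mod Q)" "[h = 2] (mod int p)" using R[OF c2] by blast
  obtain D where D: "D > 0" "squarefree D" "coprime D Y" "[D = h] (mod (Q * int p))"
    "\<And>q. prime q \<Longrightarrow> q dvd D \<Longrightarrow> \<exists>a. q dvd poly f a"
    using h(1) Y unfolding admissible_def by blast
  have "Y * D > 0" using Y D(1) by simp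
  then obtain D' where D': "D' > 0" "squarefree D'" "coprime D' (Y * D)" "[D' = h'] (mod (Q * int p))"
    "\<And>q. prime q \<Longrightarrow> q dvd D' \<Longrightarrow> \<exists>a. q dvd poly f a"
    using h'(1) unfolding admissible_def by blast
  have m1: "[D = 1] (mod Q)" "[D' = 1] (mod Q)"
    using D(4) D'(4) h(2) h'(2) by (meson cong_modulus_mult cong_trans)+
  have m2: "[D = 2] (mod int p)" "[D' = i * m] (mod int p)"
    using D(4) D'(4) h(3) h'(3) by (metis cong_modulus_mult cong_trans mult.commute)+
  have "D \<noteq> 1"
  proof
    assume "D = 1"
    then have "int p dvd 2 - 1" using m2(1) by (simp add: cong_iff_dvd_diff dvd_diff_commute)
    then show False using p(2) by simp
  qed
  then have "D * D' > 1 * 1" using D(1) D'(1) by (intro mult_less_le_imp_less) auto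
  moreover have "squarefree (D * D')"
    using D(2) D'(2,3) by (intro squarefree_mult_coprime) (auto simp: coprime_commute)
  moreover have "coprime (D * D') Y" using D(3) D'(3) by simp
  moreover have "[D * D' = 1 * 1] (mod Q)" using m1 by (rule cong_mult)
  moreover have "[D * D' = m] (mod int p)"
  proof -
    have "[D * D' = 2 * (i * m)] (mod int p)" using m2 by (rule cong_mult)
    also have "2 * (i * m) = 2 * i * m" by simp
    also have "[2 * i * m = 1 * m] (mod int p)" using i by (rule cong_mult) simp
    finally show ?thesis by simp
  qed
  moreover have "\<exists>a. q dvd poly f a" if "prime q" "q dvd D * D'" for q
    using that D(5) D'(5) by (auto simp: prime_dvd_mult_iff)
  ultimately show ?thesis by (intro exI[of _ "D * D'"]) auto
qed

section \<open>Estimates for the explicit bound\<close>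

lemma ge_factors_bad_prime_bound:
  assumes "n < E"
  shows "power_residue_bound n \<le> bad_prime_bound E"
    and "E \<le> bad_prime_bound E"
    and "fact (2 * n - 1) * (n * E) ^ (2 * n - 1) \<le> bad_prime_bound E"
proof -
  define Y where "Y = 10 * E + 10"
  have Y: "Y \<ge> 10" "n + 1 \<le> Y" "n \<le> Y" "E \<le> Y" "2 * n \<le> Y" "10 * n + 10 \<le> Y"
    using assms unfolding Y_def by auto
  have mono: "Y ^ k \<le> bad_prime_bound E" if "k \<le> Y" for k
    unfolding bad_prime_bound_def Y_def[symmetric] using that Y(1) by (intro power_increasing) auto
  show "E \<le> bad_prime_bound E" using mono[of 1] Y by simp
  have p: "(n + 1) ^ n \<le> Y ^ n" using Y by (intro power_mono) auto
  have "power_residue_bound n \<le> 2 * (Y * Y * (1 + Y ^ n * Y) + Y * Y ^ n + 2 * Y)"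
    unfolding power_residue_bound_def using Y p by (intro mult_le_mono add_mono order_refl) auto
  \<comment> \<open>Each of the five terms, counting \<open>2 * Y\<close> twice, is at most
    \<open>Y ^ (n + 3)\<close>; the resulting factor 10 is absorbed by one more power of
    \<open>Y\<close>.\<close>
  also have "\<dots> \<le> 10 * Y ^ (n + 3)"
  proof -
    have "Y * Y \<le> Y ^ (n + 3)" "Y \<le> Y ^ (n + 3)" "Y * Y ^ n \<le> Y ^ (n + 3)"
      using power_increasing[of 2 "n + 3" Y] power_increasing[of 1 "n + 3" Y]
        power_increasing[of "n + 1" "n + 3" Y] Y(1) by (auto simp: power2_eq_square)
    moreover have "Y * Y * (1 + Y ^ n * Y) = Y * Y + Y ^ (n + 3)"
      by (simp add: algebra_simps power_add power3_eq_cube)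
    ultimately have "2 * (Y * Y * (1 + Y ^ n * Y) + Y * Y ^ n + 2 * Y) \<le>
        2 * (Y ^ (n + 3) + Y ^ (n + 3) + Y ^ (n + 3) + 2 * Y ^ (n + 3))"
      by (simp only:) (intro mult_le_mono add_mono order_refl)
    then show ?thesis by simp
  qed
  also have "\<dots> \<le> Y ^ (n + 4)" using Y(1) mult_right_mono[of 10 Y "Y ^ (n + 3)"] by (simp add: power_add numeral_eq_Suc)
  also have "\<dots> \<le> bad_prime_bound E" using Y by (intro mono) auto
  finally show "power_residue_bound n \<le> bad_prime_bound E" .
  define N where "N = 2 * n - 1"
  have "fact N \<le> Y ^ N"
  proof -
    have "fact N \<le> N ^ N" using fact_le_power[of N, where 'a = nat] by simp
    also have "\<dots> \<le> Y ^ N" using Y unfolding N_def by (intro power_mono) auto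
    finally show ?thesis .
  qed
  moreover have "(n * E) ^ N \<le> (Y ^ 2) ^ N"
    using Y by (intro power_mono) (auto simp: power2_eq_square intro: mult_le_mono)
  ultimately have "fact N * (n * E) ^ N \<le> Y ^ N * (Y ^ 2) ^ N" by (rule mult_le_mono)
  also have "\<dots> = Y ^ (N + 2 * N)" by (simp only: power_add power_mult)
  also have "\<dots> \<le> bad_prime_bound E" using Y unfolding N_def by (intro mono) auto
  finally show "fact (2 * n - 1) * (n * E) ^ (2 * n - 1) \<le> bad_prime_bound E" unfolding N_def .
qed

lemma bad_prime_bound_spec:
  fixes f :: "int poly"
  assumes sep: "separable_int_poly f" and deg: "degree f > 0"
    and Z: "Z = bad_prime_bound (int_poly_encode f)"
  shows "power_residue_bound (degree f) \<le> Z" and "\<bar>lead_coeff f\<bar> \<le> int Z"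
    and "\<exists>u v R. u * f + v * pderiv f = [:R:] \<and> R \<noteq> 0 \<and> \<bar>R\<bar> \<le> int Z"
proof -
  define E where "E = int_poly_encode f"
  have "f \<noteq> 0" using deg by auto
  then have dE: "degree f < E" unfolding E_def by (rule degree_less_int_poly_encode)
  note B = ge_factors_bad_prime_bound[OF dE, folded Z[folded E_def]]
  show "power_residue_bound (degree f) \<le> Z" by (rule B)
  have c: "\<bar>coeff f i\<bar> \<le> int E" for i unfolding E_def by (rule coeff_le_int_poly_encode)
  then show "\<bar>lead_coeff f\<bar> \<le> int Z" using B(2) by (meson of_nat_mono order_trans)
  have "fact (2 * degree f - 1) * (int (degree f) * int E) ^ (2 * degree f - 1) =
      int (fact (2 * degree f - 1) * (degree f * E) ^ (2 * degree f - 1))" by simp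
  also have "\<dots> \<le> int Z" using B(3) by (rule of_nat_mono)
  finally show "\<exists>u v R. u * f + v * pderiv f = [:R:] \<and> R \<noteq> 0 \<and> \<bar>R\<bar> \<le> int Z"
    using bounded_bezout[OF sep[unfolded separable_int_poly_def] deg c] by (meson order_trans)
qed

text \<open>The base value has the sign that \<open>f\<close> takes at large arguments, so that
  quotients of later values by it are positive.\<close>

lemma exists_value_prime_to:
  fixes f :: "int poly"
  assumes p: "prime (p::nat)" and lc: "\<not> int p dvd lead_coeff f" and deg: "degree f < p"
  obtains x where "poly f x * lead_coeff f > 0" "\<not> int p dvd poly f x"
proof -
  have f0: "f \<noteq> 0" using lc by auto
  have "\<not> [:int p:] dvd f" using lc by (rule not_const_dvd)
  then obtain a where a: "\<not> int p dvd poly f a" using const_dvd_of_vanishing[OF p deg] by blast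
  obtain A where A: "\<And>x. x \<ge> A \<Longrightarrow> poly f x * lead_coeff f > 0"
    using poly_sign_at_large_ints[OF f0] by blast
  define x where "x = a + int p * \<bar>A - a\<bar>"
  have "1 * \<bar>A - a\<bar> \<le> int p * \<bar>A - a\<bar>" using prime_ge_1_nat[OF p] by (intro mult_right_mono) auto
  then have "A - a \<le> int p * \<bar>A - a\<bar>" using abs_ge_self[of "A - a"] by (simp only: mult_1)
  then have "x \<ge> A" unfolding x_def by (simp only: diff_le_eq add.commute)
  moreover have "\<not> int p dvd poly f x"
  proof
    assume "int p dvd poly f x"
    moreover have "int p dvd x - a" unfolding x_def by simp
    then have "int p dvd poly f x - poly f a" using diff_dvd_poly_diff dvd_trans by blast
    ultimately have "int p dvd poly f x - (poly f x - poly f a)" by (rule dvd_diff)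
    then show False using a by simp
  qed
  ultimately show ?thesis using A that by blast
qed

section \<open>Construction of infinitely many twists\<close>

lemma everywhere_locally_soluble_twists:
  fixes f :: "int poly" and p Z :: nat
  assumes bound: "power_residue_bound (degree f) \<le> Z" "\<bar>lead_coeff f\<bar> \<le> int Z"
    and bezout: "u * f + v * pderiv f = [:R:]" "R \<noteq> 0" "\<bar>R\<bar> \<le> int Z"
    and deg: "degree f > 0" and p: "prime p" "p > Z" and m: "coprime m (int p)"
  shows "infinite {d :: int. squarefree d \<and> [d = m] (mod int p) \<and>
           twist_has_nontrivial_point (ring_of_type_algebra :: real ring) f d \<and>
           (\<forall>l :: nat. prime l \<longrightarrow> twist_has_nontrivial_point (padic_field l) f d)}" (is "infinite ?T")
proof
  assume fin: "finite ?T"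
  have f0: "f \<noteq> 0" using deg by auto
  have good: "\<not> int l dvd k" if "l > Z" "k \<noteq> 0" "\<bar>k\<bar> \<le> int Z" for l k
    using that dvd_imp_le_int[of k "int l"] by auto
  have goodR: "\<not> int l dvd R" and goodlc: "\<not> int l dvd lead_coeff f" if "l > Z" for l
    using good[OF that] bezout bound(2) f0 by auto
  have "2 * degree f \<le> power_residue_bound (degree f)" unfolding power_residue_bound_def by simp
  then have degZ: "2 * degree f \<le> Z" using bound(1) by simp
  obtain x0 where x0: "poly f x0 * lead_coeff f > 0" "\<not> int p dvd poly f x0"
    using exists_value_prime_to[OF p(1) goodlc[OF p(2)]] degZ p(2) by auto
  have fx0: "poly f x0 \<noteq> 0" using x0(2) by auto
  define s where "s = squarefree_part (poly f x0)"
  define t where "t = square_part (poly f x0)"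
  have st: "poly f x0 = s * t ^ 2" unfolding s_def t_def by (rule squarefree_decompose)
  have s: "squarefree s" "s \<noteq> 0" unfolding s_def by auto
  have pp: "prime (int p)" using p by simp
  have "\<not> int p dvd s" using x0(2) unfolding st by auto
  then have "coprime s (int p)" using prime_imp_coprime[OF pp] by (metis coprime_commute)
  then obtain i where i: "[s * i = 1] (mod int p)" using cong_solve_coprime_int by blast
  then have im: "coprime (i * m) (int p)"
    using m by (metis coprime_iff_invertible_int coprime_mult_left_iff mult.commute)
  \<comment> \<open>With \<open>D\<close> congruent to 1 modulo \<open>4 Z!\<close>, it is congruent
    to 1 modulo \<open>4 l\<close> for every prime \<open>l \<le> Z\<close>; \<open>p > Z\<close>
    keeps \<open>p\<close> from dividing \<open>Q\<close>.\<close>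
  define Q where "Q = 4 * (fact Z :: int)"
  have Q: "Q > 0" unfolding Q_def by simp
  have pQ: "\<not> int p dvd Q"
  proof
    assume "int p dvd Q"
    then have "int p dvd 4 \<or> int p dvd fact Z" unfolding Q_def using pp by (simp only: prime_dvd_mult_iff)
    then show False
    proof
      assume "int p dvd 4"
      then have "int p dvd 2 * 2" by simp
      then have "int p dvd 2" using pp prime_dvd_mult_iff by blast
      then show False using zdvd_imp_le[of "int p" 2] degZ deg p(2) by simp
    next
      assume "int p dvd fact Z"
      then have "p dvd fact Z" by (metis of_nat_dvd_iff of_nat_fact)
      then show False using prime_dvd_fact_iff[OF p(1)] p(2) by simp
    qed
  qed
  define T0 where "T0 = ?T - {0}"
  \<comment> \<open>As in Euclid's argument, \<open>D\<close> is made prime to all twists in the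
    finite set. The new \<open>d = s D\<close> would belong to the set, so \<open>D\<close> would
    divide \<open>Y\<close> and be a unit. The factor \<open>\<bar>s\<bar>\<close> makes
    \<open>D\<close> prime to \<open>s\<close>, so that \<open>d\<close> is squarefree.\<close>
  define Y where "Y = \<bar>s\<bar> * (\<Prod>d\<in>T0. \<bar>d\<bar>)"
  have Y: "Y > 0" unfolding Y_def T0_def using s(2) by (intro mult_pos_pos prod_pos) auto
  have p2: "p > 2" using degZ deg p(2) by simp
  obtain D where D: "D > 1" "squarefree D" "coprime D Y" "[D = 1] (mod Q)" "[D = i * m] (mod int p)"
    "\<And>q. prime q \<Longrightarrow> q dvd D \<Longrightarrow> \<exists>a. q dvd poly f a"
    using exists_squarefree_twist[OF p(1) p2 bezout(1) goodR[OF p(2)] goodlc[OF p(2)] deg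
        le_less_trans[OF bound(1) p(2)] Q pQ x0 im Y] by blast
  define d where "d = s * D"
  have cop: "coprime D s" using D(3) unfolding Y_def by simp
  then have sqd: "squarefree d" unfolding d_def using s(1) D(2)
    by (intro squarefree_mult_coprime) (auto simp: coprime_commute)
  have d0: "d \<noteq> 0" using s D(1) unfolding d_def by simp
  have "[d = s * (i * m)] (mod int p)" unfolding d_def using D(5) by (intro cong_mult) auto
  also have "s * (i * m) = s * i * m" by simp
  also have "[s * i * m = 1 * m] (mod int p)" using i by (rule cong_mult) simp
  finally have dm: "[d = m] (mod int p)" by simp
  have real: "twist_has_nontrivial_point (ring_of_type_algebra :: real ring) f d"
    unfolding d_def using D(1) st fx0 by (intro twist_real_point_of_value) auto
  have padic: "twist_has_nontrivial_point (padic_field l) f d" if l: "prime l" for l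
  proof (cases "l \<le> Z")
    case True
    have "l dvd fact Z" using l True by (simp add: prime_dvd_fact_iff)
    then have "int l dvd fact Z" by (metis of_nat_dvd_iff of_nat_fact)
    then have "4 * int l dvd Q" unfolding Q_def by simp
    then have "[D = 1] (mod (4 * int l))" using D(4) cong_dvd_modulus by blast
    then show ?thesis unfolding d_def using l st fx0 by (intro twist_padic_point_of_value) auto
  next
    case False
    then have lZ: "l > Z" by simp
    have pl: "prime (int l)" using l by simp
    show ?thesis
    proof (cases "int l dvd d")
      case True
      then have "int l dvd s \<or> int l dvd D" unfolding d_def using pl by (simp add: prime_dvd_mult_iff)
      then have "\<exists>a. int l dvd poly f a" using D(6)[OF pl] st by (metis dvd_mult2)
      then show ?thesis
        using twist_padic_point_of_root[OF l bezout(1) goodR[OF lZ] _ d0] by blast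
    next
      case False
      then show ?thesis
        using twist_padic_point_of_unit[OF l bezout(1) goodR[OF lZ] goodlc[OF lZ] deg
            le_less_trans[OF bound(1) lZ]] by blast
    qed
  qed
  have "d \<in> T0" using sqd dm real padic d0 unfolding T0_def by blast
  then have "\<bar>d\<bar> dvd (\<Prod>d\<in>T0. \<bar>d\<bar>)" using fin unfolding T0_def by (intro dvd_prodI) auto
  then have "D dvd Y" unfolding Y_def d_def by (simp add: abs_mult) (metis abs_dvd_iff dvd_mult dvd_mult_right)
  then have "is_unit D" using D(3) by (metis coprime_common_divisor dvd_refl)
  then show False using D(1) by simp
qed

theorem theorem1p4:
  shows "\<exists>N :: int poly \<Rightarrow> nat. effectively_computable N \<and>
    (\<forall>f :: int poly.
       separable_int_poly f \<and> Polynomial.degree f > 0 \<and>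
       (odd (Polynomial.degree f) \<or>
        even (Polynomial.degree f) \<and>
          (\<exists>g :: int poly. Factorial_Ring.irreducible g \<and> Polynomial.degree g > 0 \<and> g dvd f \<and>
             comm_group (galois_group g))) \<longrightarrow>
       (\<forall>p :: nat. Factorial_Ring.prime p \<and> p \<ge> N f \<longrightarrow>
          (\<forall>m :: int. coprime m (int p) \<longrightarrow>
             infinite {d :: int. squarefree d \<and> [d = m] (mod int p) \<and>
               twist_has_nontrivial_point (ring_of_type_algebra :: real ring) f d \<and>
               (\<forall>l :: nat. Factorial_Ring.prime l \<longrightarrow>
                  twist_has_nontrivial_point (padic_field l) f d)})))"
proof (intro exI[of _ "\<lambda>f. Suc (bad_prime_bound (int_poly_encode f))"] conjI allI impI)
  show "effectively_computable (\<lambda>f. Suc (bad_prime_bound (int_poly_encode f)))"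
    by (rule effectively_computable_bad_prime_bound)
next
  fix f :: "int poly" and p :: nat and m :: int
  assume f: "separable_int_poly f \<and> Polynomial.degree f > 0 \<and>
       (odd (Polynomial.degree f) \<or>
        even (Polynomial.degree f) \<and>
          (\<exists>g :: int poly. Factorial_Ring.irreducible g \<and> Polynomial.degree g > 0 \<and> g dvd f \<and>
             comm_group (galois_group g)))"
    and p: "Factorial_Ring.prime p \<and> p \<ge> Suc (bad_prime_bound (int_poly_encode f))"
    and m: "coprime m (int p)"
  have sep: "separable_int_poly f" and deg: "degree f > 0" using f by auto
  note B = bad_prime_bound_spec[OF sep deg refl]
  obtain u v R where uvR: "u * f + v * pderiv f = [:R:]" "R \<noteq> 0"
    "\<bar>R\<bar> \<le> int (bad_prime_bound (int_poly_encode f))" using B(3) by blast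
  show "infinite {d :: int. squarefree d \<and> [d = m] (mod int p) \<and>
               twist_has_nontrivial_point (ring_of_type_algebra :: real ring) f d \<and>
               (\<forall>l :: nat. Factorial_Ring.prime l \<longrightarrow>
                  twist_has_nontrivial_point (padic_field l) f d)}"
    using p m by (intro everywhere_locally_soluble_twists[OF B(1,2) uvR deg]) auto
qed

end
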